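(* Let $M^3$ be a three-dimensional Riemannian manifold and let $\Sigma^2\subset M^3$ be a surface making a constant angle with a parallel transported direction. Then $\Sigma^2$ is an extrinsically flat and ruled surface.
   Context: Let $\nabla$ be the Levi-Civita connection of $M^3$. A regular surface $\Sigma^2\subset M^3$ with unit normal $\nu$ makes a constant angle with a parallel transported direction (is a surface of constant parallel angle) if there exists a unit vector field $V$ of $M^3$ defined along $\Sigma^2$ (not necessarily tangent), parallel transported along any curve in $\Sigma^2$, i.e. $\nabla_XV=0$ for every $X$ tangent to $\Sigma^2$, such that the angle between $V$ and $\nu$ is constant. Extrinsically flat: the determinant of the shape operator $A(X)=-\nabla_X\nu$ vanishes. Ruled: $\Sigma^2$ is locally foliated by curves (rulings) that are geodesics of $M^3$. *)

theory Defs
  imports "HOL-Analysis.Analysis"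
begin

section \<open>Smooth maps between Euclidean spaces\<close>

primrec Ck_on :: "nat \<Rightarrow> 'a::real_normed_vector set \<Rightarrow> ('a \<Rightarrow> 'b::real_normed_vector) \<Rightarrow> bool" where
  "Ck_on 0 S f \<longleftrightarrow> continuous_on S f"
| "Ck_on (Suc k) S f \<longleftrightarrow> (\<forall>x\<in>S. f differentiable (at x)) \<and>
     (\<forall>v. Ck_on k S (\<lambda>x. frechet_derivative f (at x) v))"

(* Only meant for open S: the derivatives are taken at x, not at x within S. *)
definition smooth_on :: "'a::real_normed_vector set \<Rightarrow> ('a \<Rightarrow> 'b::real_normed_vector) \<Rightarrow> bool" where
  "smooth_on S f \<longleftrightarrow> (\<forall>k. Ck_on k S f)"


section \<open>Smooth manifolds\<close>

(* A chart is a domain together with a coordinate map; the values of the map outside the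
   domain are irrelevant. *)
type_synonym ('m, 'n) chart = "'m set \<times> ('m \<Rightarrow> real^'n)"

definition transition :: "('m, 'n::finite) chart \<Rightarrow> ('m, 'n) chart \<Rightarrow> real^'n \<Rightarrow> real^'n" where
  "transition c d = snd d \<circ> inv_into (fst c) (snd c)"

definition charts_at :: "('m, 'n::finite) chart set \<Rightarrow> 'm \<Rightarrow> ('m, 'n) chart set" where
  "charts_at A p = {c \<in> A. p \<in> fst c}"

locale smooth_manifold =
  fixes X :: "'m topology" and A :: "('m, 'n::finite) chart set"
  assumes hausdorff: "Hausdorff_space X"
    and second_countable: "second_countable X"
    and covering: "(\<Union>c\<in>A. fst c) = topspace X"
    and open_domain: "c \<in> A \<Longrightarrow> openin X (fst c)"
    and open_image: "c \<in> A \<Longrightarrow> open (snd c ` fst c)"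
    and homeomorphism: "c \<in> A \<Longrightarrow>
      homeomorphic_map (subtopology X (fst c)) (top_of_set (snd c ` fst c)) (snd c)"
    and smooth_transition: "\<lbrakk>c \<in> A; d \<in> A\<rbrakk> \<Longrightarrow>
      smooth_on (snd c ` (fst c \<inter> fst d)) (transition c d)"

definition smooth_map ::
  "'m topology \<Rightarrow> ('m, 'n::finite) chart set \<Rightarrow> 'a::real_normed_vector set \<Rightarrow> ('a \<Rightarrow> 'm) \<Rightarrow> bool" where
  "smooth_map X A W F \<longleftrightarrow> open W \<and> continuous_map (top_of_set W) X F \<and>
     (\<forall>c\<in>A. smooth_on {u \<in> W. F u \<in> fst c} (snd c \<circ> F))"


section \<open>Tangent vectors\<close>

(* A tangent vector is the family of its coordinate vectors in all charts around the base point.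
   Components in the remaining charts are 0, so that a tangent vector is determined by its
   components in any one chart around the base point. *)
type_synonym ('m, 'n) tvec = "('m, 'n) chart \<Rightarrow> real^'n"

definition tangent_space :: "('m, 'n::finite) chart set \<Rightarrow> 'm \<Rightarrow> ('m, 'n) tvec set" where
  "tangent_space A p = {v. (\<forall>c. c \<notin> charts_at A p \<longrightarrow> v c = 0) \<and>
     (\<forall>c\<in>charts_at A p. \<forall>d\<in>charts_at A p.
        v d = frechet_derivative (transition c d) (at (snd c p)) (v c))}"

definition differential ::
  "('m, 'n::finite) chart set \<Rightarrow> ('a::real_normed_vector \<Rightarrow> 'm) \<Rightarrow> 'a \<Rightarrow> 'a \<Rightarrow> ('m, 'n) tvec" where
  "differential A F u a =
     (\<lambda>c. if c \<in> charts_at A (F u) then frechet_derivative (snd c \<circ> F) (at u) a else 0)"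


section \<open>Riemannian metrics\<close>

(* g c p is the Gram matrix, at the point p, of the coordinate vector fields of the chart c. *)
type_synonym ('m, 'n) metric_coeffs = "('m, 'n) chart \<Rightarrow> 'm \<Rightarrow> real^'n^'n"

definition local_metric ::
  "('m, 'n::finite) metric_coeffs \<Rightarrow> ('m, 'n) chart \<Rightarrow> real^'n \<Rightarrow> real^'n^'n" where
  "local_metric g c y = g c (inv_into (fst c) (snd c) y)"

locale riemannian_manifold = smooth_manifold X A
  for X :: "'m topology" and A :: "('m, 'n::finite) chart set" +
  fixes g :: "('m, 'n) metric_coeffs"
  assumes metric_smooth: "c \<in> A \<Longrightarrow> smooth_on (snd c ` fst c) (local_metric g c)"
    and metric_symmetric: "\<lbrakk>c \<in> A; p \<in> fst c\<rbrakk> \<Longrightarrow> transpose (g c p) = g c p"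
    and metric_positive: "\<lbrakk>c \<in> A; p \<in> fst c; v \<noteq> 0\<rbrakk> \<Longrightarrow> v \<bullet> (g c p *v v) > 0"
    and metric_transform: "\<lbrakk>c \<in> A; d \<in> A; p \<in> fst c \<inter> fst d\<rbrakk> \<Longrightarrow>
      v \<bullet> (g c p *v w) =
        frechet_derivative (transition c d) (at (snd c p)) v \<bullet>
          (g d p *v frechet_derivative (transition c d) (at (snd c p)) w)"

(* For tangent vectors the value does not depend on the selected chart: see riem_inner_chart. *)
definition riem_inner ::
  "('m, 'n::finite) chart set \<Rightarrow> ('m, 'n) metric_coeffs \<Rightarrow> 'm \<Rightarrow> ('m, 'n) tvec \<Rightarrow> ('m, 'n) tvec \<Rightarrow> real" where
  "riem_inner A g p v w = (let c = (SOME c. c \<in> charts_at A p) in v c \<bullet> (g c p *v w c))"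

definition riem_norm ::
  "('m, 'n::finite) chart set \<Rightarrow> ('m, 'n) metric_coeffs \<Rightarrow> 'm \<Rightarrow> ('m, 'n) tvec \<Rightarrow> real" where
  "riem_norm A g p v = sqrt (riem_inner A g p v v)"

definition riem_angle ::
  "('m, 'n::finite) chart set \<Rightarrow> ('m, 'n) metric_coeffs \<Rightarrow> 'm \<Rightarrow> ('m, 'n) tvec \<Rightarrow> ('m, 'n) tvec \<Rightarrow> real" where
  "riem_angle A g p v w =
     arccos (riem_inner A g p v w / (riem_norm A g p v * riem_norm A g p w))"

lemma (in riemannian_manifold) riem_inner_chart:
  assumes "c \<in> charts_at A p" "v \<in> tangent_space A p" "w \<in> tangent_space A p"
  shows "riem_inner A g p v w = v c \<bullet> (g c p *v w c)"
proof -
  define d where "d = (SOME c. c \<in> charts_at A p)"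
  have d: "d \<in> charts_at A p"
    unfolding d_def using assms(1) by (rule someI)
  have t: "v d = frechet_derivative (transition c d) (at (snd c p)) (v c)"
    "w d = frechet_derivative (transition c d) (at (snd c p)) (w c)"
    using assms d unfolding tangent_space_def by blast+
  have "c \<in> A" "d \<in> A" "p \<in> fst c \<inter> fst d"
    using assms(1) d by (auto simp: charts_at_def)
  from metric_transform[OF this, of "v c" "w c"] show ?thesis
    unfolding riem_inner_def Let_def d_def[symmetric] t by (rule sym)
qed


section \<open>The Levi-Civita connection\<close>

(* metric_deriv g c p k i j is the k-th partial derivative of g_ij. *)
definition metric_deriv ::
  "('m, 'n::finite) metric_coeffs \<Rightarrow> ('m, 'n) chart \<Rightarrow> 'm \<Rightarrow> 'n \<Rightarrow> 'n \<Rightarrow> 'n \<Rightarrow> real" where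
  "metric_deriv g c p k i j =
     frechet_derivative (\<lambda>y. local_metric g c y $ i $ j) (at (snd c p)) (axis k 1)"

(* christoffel g c p k i j is Gamma^k_ij. *)
definition christoffel ::
  "('m, 'n::finite) metric_coeffs \<Rightarrow> ('m, 'n) chart \<Rightarrow> 'm \<Rightarrow> 'n \<Rightarrow> 'n \<Rightarrow> 'n \<Rightarrow> real" where
  "christoffel g c p k i j = (1/2) * (\<Sum>l\<in>UNIV. matrix_inv (g c p) $ k $ l *
     (metric_deriv g c p i j l + metric_deriv g c p j i l - metric_deriv g c p l i j))"

(* The Christoffel symbols are the coefficients of the unique torsion-free metric connection. *)
lemma (in riemannian_manifold) christoffel_unique:
  fixes \<Gamma> :: "'n \<Rightarrow> 'n \<Rightarrow> 'n \<Rightarrow> real"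
  assumes c: "c \<in> A" and p: "p \<in> fst c"
  shows "((\<forall>k i j. \<Gamma> k i j = \<Gamma> k j i) \<and>
          (\<forall>k i j. metric_deriv g c p k i j =
             (\<Sum>l\<in>UNIV. \<Gamma> l k i * g c p $ l $ j + \<Gamma> l k j * g c p $ i $ l)))
         \<longleftrightarrow> \<Gamma> = christoffel g c p"
proof -
  define G where "G = g c p"
  define D where "D = metric_deriv g c p"
  have G_sym: "G $ i $ j = G $ j $ i" for i j
    using metric_symmetric[OF c p] unfolding G_def by (simp add: transpose_def vec_eq_iff)
  have D_sym: "D k i j = D k j i" for k i j
  proof -
    let ?f = "\<lambda>y. local_metric g c y $ i $ j" and ?h = "\<lambda>y. local_metric g c y $ j $ i"
    have eq: "?f y = ?h y" if "y \<in> snd c ` fst c" for y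
    proof -
      have "inv_into (fst c) (snd c) y \<in> fst c"
        using that by (rule inv_into_into)
      from metric_symmetric[OF c this] show ?thesis
        unfolding local_metric_def by (simp add: transpose_def vec_eq_iff)
    qed
    have op: "open (snd c ` fst c)" and mem: "snd c p \<in> snd c ` fst c"
      using open_image[OF c] p by auto
    have "(?f has_derivative F) (at (snd c p)) \<longleftrightarrow> (?h has_derivative F) (at (snd c p))" for F
      using has_derivative_transform_within_open[OF _ op mem, of ?f F UNIV ?h]
        has_derivative_transform_within_open[OF _ op mem, of ?h F UNIV ?f] eq by auto
    then show ?thesis
      by (simp add: D_def metric_deriv_def frechet_derivative_def)
  qed
  have "inj ((*v) G)"
  proof (rule injI)
    fix v w assume "G *v v = G *v w"
    then have "(v - w) \<bullet> (G *v (v - w)) = 0"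
      by (simp add: matrix_vector_mult_diff_distrib)
    then show "v = w"
      using metric_positive[OF c p, of "v - w"] by (force simp: G_def)
  qed
  then have "invertible G"
    by (simp add: invertible_left_inverse matrix_left_invertible_injective inj_on_def)
  then have inv: "G ** matrix_inv G = mat 1" "matrix_inv G ** G = mat 1"
    unfolding matrix_inv_def invertible_def by (metis (mono_tags, lifting) someI_ex)+
  have invl: "(\<Sum>l\<in>UNIV. matrix_inv G $ k $ l * (\<Sum>m\<in>UNIV. G $ l $ m * x m)) = x k"
    and invr: "(\<Sum>m\<in>UNIV. G $ k $ m * (\<Sum>l\<in>UNIV. matrix_inv G $ m $ l * x l)) = x k"
    for k and x :: "'n \<Rightarrow> real"
  proof -
    let ?x = "\<chi> i. x i"
    have "matrix_inv G *v (G *v ?x) = ?x" "G *v (matrix_inv G *v ?x) = ?x"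
      by (simp_all add: matrix_vector_mul_assoc inv)
    then have "(matrix_inv G *v (G *v ?x)) $ k = x k" "(G *v (matrix_inv G *v ?x)) $ k = x k"
      by simp_all
    then show "(\<Sum>l\<in>UNIV. matrix_inv G $ k $ l * (\<Sum>m\<in>UNIV. G $ l $ m * x m)) = x k"
      "(\<Sum>m\<in>UNIV. G $ k $ m * (\<Sum>l\<in>UNIV. matrix_inv G $ m $ l * x l)) = x k"
      by (simp_all add: matrix_vector_mult_def)
  qed
  let ?E = "\<lambda>\<Gamma> k i j. \<Sum>m\<in>UNIV. G $ k $ m * \<Gamma> m i j"
  have split: "(\<Sum>l\<in>UNIV. \<Gamma> l k i * G $ l $ j + \<Gamma> l k j * G $ i $ l) = ?E \<Gamma> j k i + ?E \<Gamma> i k j"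
    for \<Gamma> k i j
    by (simp add: sum.distrib mult.commute G_sym[of _ j])
  have E_chr: "?E (christoffel g c p) l i j = (D i j l + D j i l - D l i j) / 2" for l i j
  proof -
    let ?x = "\<lambda>l. (D i j l + D j i l - D l i j)"
    have "?E (christoffel g c p) l i j =
      (1/2) * (\<Sum>m\<in>UNIV. G $ l $ m * (\<Sum>l\<in>UNIV. matrix_inv G $ m $ l * ?x l))"
      unfolding christoffel_def G_def[symmetric] D_def[symmetric]
      by (simp add: sum_distrib_left mult.left_commute)
    then show ?thesis by (simp only: invr)
  qed
  show ?thesis
    unfolding G_def[symmetric] D_def[symmetric] split
  proof
    assume a: "(\<forall>k i j. \<Gamma> k i j = \<Gamma> k j i) \<and> (\<forall>k i j. D k i j = ?E \<Gamma> j k i + ?E \<Gamma> i k j)"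
    then have s: "\<And>k i j. ?E \<Gamma> k i j = ?E \<Gamma> k j i"
      and d: "\<And>k i j. D k i j = ?E \<Gamma> j k i + ?E \<Gamma> i k j"
      by (auto intro!: sum.cong)
    have solve: "\<lbrakk>p = p'; q = q'; r = r'; x = p + q; y = p' + r; z = q' + r'\<rbrakk> \<Longrightarrow> p = (x + y - z) / 2"
      for p p' q q' r r' x y z :: real
      by simp
    have "?E \<Gamma> l i j = (D i j l + D j i l - D l i j) / 2" for l i j
      by (rule solve[OF s s s d d d])
    then have "?E \<Gamma> l i j = ?E (christoffel g c p) l i j" for l i j
      by (simp only: E_chr)
    then have "\<Gamma> k i j = christoffel g c p k i j" for k i j
      using invl[of k "\<lambda>m. \<Gamma> m i j"] invl[of k "\<lambda>m. christoffel g c p m i j"] by simp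
    then show "\<Gamma> = christoffel g c p" by (intro ext)
  next
    assume a: "\<Gamma> = christoffel g c p"
    have "christoffel g c p k i j = christoffel g c p k j i" for k i j
      unfolding christoffel_def D_def[symmetric] D_sym[of _ i j]
      by (simp add: add.commute)
    moreover have "D k i j = ?E (christoffel g c p) j k i + ?E (christoffel g c p) i k j" for k i j
      unfolding E_chr D_sym[of k j i] by (simp flip: add_divide_distrib)
    ultimately show "(\<forall>k i j. \<Gamma> k i j = \<Gamma> k j i) \<and> (\<forall>k i j. D k i j = ?E \<Gamma> j k i + ?E \<Gamma> i k j)"
      unfolding a by blast
  qed
qed

(* The connection induced along a map F: for a vector field Y along F, this is the Levi-Civita
   covariant derivative of Y at u in the direction dF(a).  It covers fields along curves
   (with a = 1) and fields along parametrized surfaces. *)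
definition cov_deriv ::
  "('m, 'n::finite) chart set \<Rightarrow> ('m, 'n) metric_coeffs \<Rightarrow> ('a::real_normed_vector \<Rightarrow> 'm) \<Rightarrow>
   ('a \<Rightarrow> ('m, 'n) tvec) \<Rightarrow> 'a \<Rightarrow> 'a \<Rightarrow> ('m, 'n) tvec" where
  "cov_deriv A g F Y u a =
     (\<lambda>c. if c \<in> charts_at A (F u) then
        frechet_derivative (\<lambda>w. Y w c) (at u) a +
        (\<chi> k. \<Sum>i\<in>UNIV. \<Sum>j\<in>UNIV.
           christoffel g c (F u) k i j * differential A F u a c $ i * Y u c $ j)
      else 0)"

definition geodesic_on ::
  "'m topology \<Rightarrow> ('m, 'n::finite) chart set \<Rightarrow> ('m, 'n) metric_coeffs \<Rightarrow> real set \<Rightarrow> (real \<Rightarrow> 'm) \<Rightarrow> bool" where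
  "geodesic_on X A g I \<gamma> \<longleftrightarrow> smooth_map X A I \<gamma> \<and>
     (\<forall>s\<in>I. cov_deriv A g \<gamma> (\<lambda>s. differential A \<gamma> s 1) s 1 = (\<lambda>c. 0))"


section \<open>Regular surfaces\<close>

definition surface_param ::
  "'m topology \<Rightarrow> ('m, 'n::finite) chart set \<Rightarrow> 'm set \<Rightarrow> (real^2) set \<Rightarrow> (real^2 \<Rightarrow> 'm) \<Rightarrow> bool" where
  "surface_param X A S W x \<longleftrightarrow> smooth_map X A W x \<and>
     openin (subtopology X S) (x ` W) \<and>
     homeomorphic_map (top_of_set W) (subtopology X (x ` W)) x \<and>
     (\<forall>u\<in>W. inj (differential A x u))"

definition regular_surface ::
  "'m topology \<Rightarrow> ('m, 'n::finite) chart set \<Rightarrow> 'm set \<Rightarrow> bool" where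
  "regular_surface X A S \<longleftrightarrow> S \<subseteq> topspace X \<and>
     (\<forall>p\<in>S. \<exists>W x. surface_param X A S W x \<and> p \<in> x ` W)"

definition surface_tangent_space ::
  "'m topology \<Rightarrow> ('m, 'n::finite) chart set \<Rightarrow> 'm set \<Rightarrow> 'm \<Rightarrow> ('m, 'n) tvec set" where
  "surface_tangent_space X A S p =
     {differential A x u a |W x u a. surface_param X A S W x \<and> u \<in> W \<and> x u = p}"

(* Smooth vector fields of the ambient manifold along S, not necessarily tangent to S. *)
definition vector_field_along ::
  "'m topology \<Rightarrow> ('m, 'n::finite) chart set \<Rightarrow> 'm set \<Rightarrow> ('m \<Rightarrow> ('m, 'n) tvec) \<Rightarrow> bool" where
  "vector_field_along X A S V \<longleftrightarrow> (\<forall>p\<in>S. V p \<in> tangent_space A p) \<and>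
     (\<forall>W x. surface_param X A S W x \<longrightarrow>
        (\<forall>c\<in>A. smooth_on {u \<in> W. x u \<in> fst c} (\<lambda>u. V (x u) c)))"

definition unit_vector_field_along ::
  "'m topology \<Rightarrow> ('m, 'n::finite) chart set \<Rightarrow> ('m, 'n) metric_coeffs \<Rightarrow> 'm set \<Rightarrow>
   ('m \<Rightarrow> ('m, 'n) tvec) \<Rightarrow> bool" where
  "unit_vector_field_along X A g S V \<longleftrightarrow> vector_field_along X A S V \<and>
     (\<forall>p\<in>S. riem_norm A g p (V p) = 1)"

definition unit_normal_field ::
  "'m topology \<Rightarrow> ('m, 'n::finite) chart set \<Rightarrow> ('m, 'n) metric_coeffs \<Rightarrow> 'm set \<Rightarrow>
   ('m \<Rightarrow> ('m, 'n) tvec) \<Rightarrow> bool" where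
  "unit_normal_field X A g S \<nu> \<longleftrightarrow> unit_vector_field_along X A g S \<nu> \<and>
     (\<forall>p\<in>S. \<forall>v\<in>surface_tangent_space X A S p. riem_inner A g p (\<nu> p) v = 0)"

definition parallel_along ::
  "'m topology \<Rightarrow> ('m, 'n::finite) chart set \<Rightarrow> ('m, 'n) metric_coeffs \<Rightarrow> 'm set \<Rightarrow>
   ('m \<Rightarrow> ('m, 'n) tvec) \<Rightarrow> bool" where
  "parallel_along X A g S V \<longleftrightarrow>
     (\<forall>W x. surface_param X A S W x \<longrightarrow>
        (\<forall>u\<in>W. \<forall>a. cov_deriv A g x (V \<circ> x) u a = (\<lambda>c. 0)))"

definition constant_parallel_angle ::
  "'m topology \<Rightarrow> ('m, 'n::finite) chart set \<Rightarrow> ('m, 'n) metric_coeffs \<Rightarrow> 'm set \<Rightarrow>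
   ('m \<Rightarrow> ('m, 'n) tvec) \<Rightarrow> bool" where
  "constant_parallel_angle X A g S \<nu> \<longleftrightarrow>
     (\<exists>V. unit_vector_field_along X A g S V \<and> parallel_along X A g S V \<and>
        (\<exists>\<theta>. \<forall>p\<in>S. riem_angle A g p (V p) (\<nu> p) = \<theta>))"

(* B is the matrix of the shape operator, v |-> - nabla_v nu, at x u in the basis of the tangent
   plane given by the partial derivatives of x.  There is at most one such B, as
   differential A x u is injective. *)
definition shape_operator_matrix ::
  "('m, 'n::finite) chart set \<Rightarrow> ('m, 'n) metric_coeffs \<Rightarrow> ('m \<Rightarrow> ('m, 'n) tvec) \<Rightarrow>
   (real^2 \<Rightarrow> 'm) \<Rightarrow> real^2 \<Rightarrow> real^2^2 \<Rightarrow> bool" where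
  "shape_operator_matrix A g \<nu> x u B \<longleftrightarrow>
     (\<forall>a. differential A x u (B *v a) = (\<lambda>c. - cov_deriv A g x (\<nu> \<circ> x) u a c))"

definition extrinsically_flat ::
  "'m topology \<Rightarrow> ('m, 'n::finite) chart set \<Rightarrow> ('m, 'n) metric_coeffs \<Rightarrow> 'm set \<Rightarrow>
   ('m \<Rightarrow> ('m, 'n) tvec) \<Rightarrow> bool" where
  "extrinsically_flat X A g S \<nu> \<longleftrightarrow>
     (\<forall>W x. surface_param X A S W x \<longrightarrow>
        (\<forall>u\<in>W. \<exists>B. shape_operator_matrix A g \<nu> x u B \<and> det B = 0))"

(* The parametrization x of an open rectangle is a foliation chart of S; its leaves are the
   curves on which the second coordinate is constant. *)
definition ruled_surface ::
  "'m topology \<Rightarrow> ('m, 'n::finite) chart set \<Rightarrow> ('m, 'n) metric_coeffs \<Rightarrow> 'm set \<Rightarrow> bool" where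
  "ruled_surface X A g S \<longleftrightarrow>
     (\<forall>p\<in>S. \<exists>a b x. surface_param X A S (box a b) x \<and> p \<in> x ` box a b \<and>
        (\<forall>t\<in>{a$2<..<b$2}. geodesic_on X A g {a$1<..<b$1} (\<lambda>s. x (vector [s, t]))))"

end

theory Submission
  imports Defs
begin

text \<open>Write \<open>C = \<langle>V, \<nu>\<rangle>\<close> and \<open>T = V - C \<nu>\<close>, the tangential part of \<open>V\<close>. As \<open>V\<close> is parallel and
  \<open>C\<close> is constant, \<open>\<nabla>\<nu>\<close> is orthogonal to both \<open>\<nu>\<close> and \<open>V\<close>, hence to \<open>T\<close>.

  If \<open>C\<^sup>2 \<noteq> 1\<close>, then \<open>T\<close> does not vanish, so the shape operator is not surjective; by self-adjointness
  it kills \<open>T\<close>, so that \<open>\<nabla>\<^sub>T T = - C \<nabla>\<^sub>T \<nu> = 0\<close> and the integral curves of \<open>T\<close> are geodesics.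
  If \<open>C\<^sup>2 = 1\<close>, then \<open>\<nu> = C V\<close> is parallel and the surface is totally geodesic, so that its own geodesics
  are geodesics of the ambient manifold; a one-parameter family of them, transverse to a curve, is a ruling.

  Both rulings are one-parameter families of solutions of a smooth ordinary differential equation.
  Smoothness in the parameter is an induction on the order of differentiability: the derivative with
  respect to the parameter solves the linearized equation, which has the same form.\<close>

section \<open>Smooth maps\<close>

text \<open>The length of \<open>T\<close> is constant, so one of the two cases holds on the whole
  surface and there is no exceptional set to pass through. The definition of a ruled surface shapes
  the second half: geodesics through each point are not enough, they must be the coordinate lines of
  a chart on a rectangle. So a smooth family of them, started transversally, is composed with the
  parametrization, and the inverse function theorem makes the result a chart; this is why smooth
  dependence on the starting point is essential. On the geometric side, a tangent vector is a family
  of coordinate vectors over all charts, and a covariant derivative is such a family only by the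
  transformation law of the Christoffel symbols, obtained here from the uniqueness of the symmetric
  metric connection. Self-adjointness of the shape operator is the symmetry of the second covariant
  derivatives of the parametrization, paired with the normal.\<close>

lemma Ck_on_subset: "Ck_on k S f \<Longrightarrow> T \<subseteq> S \<Longrightarrow> Ck_on k T f"
  by (induction k arbitrary: f) (auto intro: continuous_on_subset)

lemma Ck_on_SucD: "Ck_on (Suc k) S f \<Longrightarrow> Ck_on k S f"
proof (induction k arbitrary: f)
  case 0
  then show ?case
    by (auto intro!: continuous_at_imp_continuous_on differentiable_imp_continuous_within)
next
  case (Suc k)
  then show ?case by (metis Ck_on.simps(2))
qed

lemma Ck_on_le: "Ck_on l S f \<Longrightarrow> k \<le> l \<Longrightarrow> Ck_on k S f"
  by (induction l) (auto simp: le_Suc_eq dest: Ck_on_SucD simp del: Ck_on.simps)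

lemma Ck_on_cong:
  assumes "open S" "\<And>x. x \<in> S \<Longrightarrow> f x = g x" "Ck_on k S f"
  shows "Ck_on k S g"
  using assms(2,3)
proof (induction k arbitrary: f g)
  case 0
  then show ?case by (simp cong: continuous_on_cong)
next
  case (Suc k)
  have d: "(g has_derivative F) (at x)" if "x \<in> S" "(f has_derivative F) (at x)" for F x
    using has_derivative_transform_within_open[OF that(2) assms(1) that(1)] Suc.prems(1) by blast
  have df: "(f has_derivative frechet_derivative f (at x)) (at x)" if "x \<in> S" for x
    using Suc.prems(2) that by (simp add: frechet_derivative_works)
  have e: "frechet_derivative f (at x) = frechet_derivative g (at x)" if "x \<in> S" for x
    using frechet_derivative_at[OF d[OF that df[OF that]]] .
  have "Ck_on k S (\<lambda>x. frechet_derivative g (at x) v)" for v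
  proof (rule Suc.IH)
    show "frechet_derivative f (at x) v = frechet_derivative g (at x) v" if "x \<in> S" for x
      using e that by simp
  qed (use Suc.prems in simp)
  then show ?case using d[OF _ df] unfolding differentiable_def Ck_on.simps by blast
qed

text \<open>Replaces the chosen \<open>frechet_derivative\<close> by an explicit derivative
  \<open>D\<close>, so that each closure property below becomes a differentiation rule followed by
  the induction hypothesis.\<close>

lemma Ck_on_SucI:
  assumes "open S" "\<And>x. x \<in> S \<Longrightarrow> (f has_derivative D x) (at x)"
    and "\<And>v. Ck_on k S (\<lambda>x. D x v)"
  shows "Ck_on (Suc k) S f"
proof -
  have "Ck_on k S (\<lambda>x. frechet_derivative f (at x) v)" for v
    by (rule Ck_on_cong[OF assms(1) _ assms(3)[of v]]) (use frechet_derivative_at[OF assms(2)] in metis)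
  then show ?thesis using assms(2) by (auto simp: differentiable_def)
qed

lemma Ck_on_has_derivative:
  "Ck_on (Suc k) S f \<Longrightarrow> x \<in> S \<Longrightarrow> (f has_derivative frechet_derivative f (at x)) (at x)"
  by (simp add: frechet_derivative_works)

lemma Ck_on_derivative: "Ck_on (Suc k) S f \<Longrightarrow> Ck_on k S (\<lambda>x. frechet_derivative f (at x) v)"
  by simp

lemma Ck_on_imp_continuous_on: "Ck_on k S f \<Longrightarrow> continuous_on S f"
  using Ck_on_le[of k S f 0] by simp

text \<open>Derivatives in \<open>Ck_on\<close> are taken at the point and not within
  \<open>S\<close>, so regularity is a local matter. This glues results from shorter time intervals
  and from single chart domains.\<close>

lemma Ck_on_local:
  assumes "\<And>x. x \<in> S \<Longrightarrow> \<exists>T. open T \<and> x \<in> T \<and> Ck_on k T f"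
  shows "Ck_on k S f"
  using assms
proof (induction k arbitrary: f)
  case 0
  have "isCont f x" if "x \<in> S" for x
    using 0[OF that] by (auto simp: continuous_on_eq_continuous_at)
  then show ?case by (auto intro: continuous_at_imp_continuous_on)
next
  case (Suc k)
  have "Ck_on k S (\<lambda>x. frechet_derivative f (at x) v)" for v
    using Suc.prems by (intro Suc.IH) (metis Ck_on.simps(2))
  moreover have "f differentiable (at x)" if "x \<in> S" for x
    using Suc.prems[OF that] by auto
  ultimately show ?case by simp
qed

lemma Ck_on_const [simp]: "Ck_on k S (\<lambda>x. c)"
proof (induction k arbitrary: c)
  case (Suc k)
  then show ?case by simp
qed simp

lemma Ck_on_bounded_linear:
  assumes "bounded_linear L" "open S" "Ck_on k S f"
  shows "Ck_on k S (\<lambda>x. L (f x))"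
  using assms(3)
proof (induction k arbitrary: f)
  case 0
  then show ?case by (simp add: bounded_linear.continuous_on[OF assms(1)])
next
  case (Suc k)
  show ?case
    by (rule Ck_on_SucI[OF assms(2) bounded_linear.has_derivative[OF assms(1) Ck_on_has_derivative[OF Suc.prems]]])
      (use Suc in auto)
qed

lemma Ck_on_ident [simp]: "Ck_on k S (\<lambda>x. x)"
  by (induction k) auto

lemma Ck_on_linear: "bounded_linear L \<Longrightarrow> Ck_on k S L"
  using Ck_on_bounded_linear[of L UNIV k "\<lambda>x. x"] Ck_on_subset[of k UNIV L S] by simp

lemma Ck_on_add:
  assumes "open S" "Ck_on k S f" "Ck_on k S g"
  shows "Ck_on k S (\<lambda>x. f x + g x)"
  using assms(2,3)
proof (induction k arbitrary: f g)
  case (Suc k)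
  show ?case
    by (rule Ck_on_SucI[OF assms(1) has_derivative_add[OF Ck_on_has_derivative[OF Suc.prems(1)]
          Ck_on_has_derivative[OF Suc.prems(2)]]]) (use Suc in auto)
qed (auto intro: continuous_intros)

lemma (in bounded_bilinear) Ck_on:
  assumes "open S" "Ck_on k S f" "Ck_on k S g"
  shows "Ck_on k S (\<lambda>x. prod (f x) (g x))"
  using assms(2,3)
proof (induction k arbitrary: f g)
  case 0
  then show ?case by (auto intro: continuous_on)
next
  case (Suc k)
  show ?case
    by (rule Ck_on_SucI[OF assms(1) FDERIV[OF Ck_on_has_derivative[OF Suc.prems(1)]
          Ck_on_has_derivative[OF Suc.prems(2)]]])
      (use Suc.prems Ck_on_SucD[OF Suc.prems(1)] Ck_on_SucD[OF Suc.prems(2)] in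
         \<open>auto intro!: Ck_on_add[OF assms(1)] Suc.IH\<close>)
qed

lemma Ck_on_sum:
  assumes "open S" "\<And>i. i \<in> I \<Longrightarrow> Ck_on k S (f i)"
  shows "Ck_on k S (\<lambda>x. \<Sum>i\<in>I. f i x)"
  using assms(2) by (induction I rule: infinite_finite_induct) (auto intro!: Ck_on_add[OF assms(1)])

lemma Ck_on_Pair:
  assumes "open S" "Ck_on k S f" "Ck_on k S g"
  shows "Ck_on k S (\<lambda>x. (f x, g x))"
proof -
  have "Ck_on k S (\<lambda>x. (f x, 0) + (0, g x))"
    by (intro Ck_on_add assms Ck_on_bounded_linear[OF _ assms(1,2)] Ck_on_bounded_linear[OF _ assms(1,3)])
      (auto intro!: bounded_linear_intros)
  then show ?thesis by simp
qed

lemma Ck_on_vec: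
  fixes f :: "'a::real_normed_vector \<Rightarrow> 'b::euclidean_space ^ 'n::finite"
  assumes "open S" "\<And>i. Ck_on k S (\<lambda>x. f x $ i)"
  shows "Ck_on k S f"
proof -
  have "bounded_linear (\<lambda>y. axis i y :: 'b ^ 'n)" for i
    by (rule linear_conv_bounded_linear[THEN iffD1], rule linearI) (auto simp: axis_def vec_eq_iff)
  then have "Ck_on k S (\<lambda>x. \<Sum>i\<in>UNIV. axis i (f x $ i))"
    by (intro Ck_on_sum[OF assms(1)] Ck_on_bounded_linear[OF _ assms])
  moreover have "(\<Sum>i\<in>UNIV. axis i (y $ i)) = y" for y :: "'b ^ 'n"
    by (simp add: vec_eq_iff sum_component axis_def if_distrib sum.delta cong: if_cong)
  ultimately show ?thesis by simp
qed

text \<open>\<open>Ck_on\<close> controls the derivative of \<open>g\<close> only in fixed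
  directions, while the chain rule evaluates it at the moving vector
  \<open>frechet_derivative f (at x) v\<close>. Expanding that vector in \<open>Basis\<close> turns
  the derivative into a finite sum of products of \<open>C^k\<close> functions; hence the middle
  space is Euclidean.\<close>

lemma Ck_on_compose:
  fixes f :: "'a::real_normed_vector \<Rightarrow> 'b::euclidean_space" and g :: "'b \<Rightarrow> 'c::real_normed_vector"
  assumes "open S" "open T" "f ` S \<subseteq> T" "Ck_on k S f" "Ck_on k T g"
  shows "Ck_on k S (\<lambda>x. g (f x))"
  using assms(4,5)
proof (induction k arbitrary: g)
  case 0
  then show ?case using assms(3) by (auto intro: continuous_on_compose2)
next
  case (Suc k)
  have gd: "(g has_derivative frechet_derivative g (at (f x))) (at (f x))" if "x \<in> S" for x
    using Ck_on_has_derivative[OF Suc.prems(2)] assms(3) that by auto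
  have d: "((\<lambda>x. g (f x)) has_derivative
      (\<lambda>v. \<Sum>b\<in>Basis. (frechet_derivative f (at x) v \<bullet> b) *\<^sub>R frechet_derivative g (at (f x)) b)) (at x)"
    if "x \<in> S" for x
  proof -
    have l: "linear (frechet_derivative g (at (f x)))"
      using gd[OF that] has_derivative_linear by blast
    have "(\<Sum>b\<in>Basis. (w \<bullet> b) *\<^sub>R frechet_derivative g (at (f x)) b) = frechet_derivative g (at (f x)) w" for w
    proof -
      have "frechet_derivative g (at (f x)) (\<Sum>b\<in>Basis. (w \<bullet> b) *\<^sub>R b)
          = (\<Sum>b\<in>Basis. (w \<bullet> b) *\<^sub>R frechet_derivative g (at (f x)) b)"
        by (simp add: linear_sum[OF l] linear_scale[OF l])
      then show ?thesis by (simp add: euclidean_representation)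
    qed
    then show ?thesis
      using has_derivative_compose[OF Ck_on_has_derivative[OF Suc.prems(1) that] gd[OF that]] by simp
  qed
  show ?case
  proof (rule Ck_on_SucI[OF assms(1) d])
    show "Ck_on k S (\<lambda>x. \<Sum>b\<in>Basis. (frechet_derivative f (at x) v \<bullet> b) *\<^sub>R frechet_derivative g (at (f x)) b)" for v
    proof (intro Ck_on_sum assms(1) bounded_bilinear.Ck_on[OF bounded_bilinear_scaleR]
        bounded_bilinear.Ck_on[OF bounded_bilinear_inner] Ck_on_const)
      show "Ck_on k S (\<lambda>x. frechet_derivative f (at x) v)" using Suc.prems by simp
      show "Ck_on k S (\<lambda>x. frechet_derivative g (at (f x)) b)" for b
        by (rule Suc.IH) (use Suc.prems Ck_on_SucD in auto)
    qed
  qed assumption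
qed

lemma Ck_on_inverse:
  fixes f :: "'a::real_normed_vector \<Rightarrow> real"
  assumes "open S" "\<And>x. x \<in> S \<Longrightarrow> f x \<noteq> 0" "Ck_on k S f"
  shows "Ck_on k S (\<lambda>x. inverse (f x))"
  using assms(3)
proof (induction k)
  case 0
  then show ?case using assms(2) by (auto intro: continuous_on_inverse)
next
  case (Suc k)
  have "Ck_on k S (\<lambda>x. - (inverse (f x) * frechet_derivative f (at x) v * inverse (f x)))" for v
    using Suc Ck_on_SucD[OF Suc.prems]
    by (intro Ck_on_bounded_linear[OF bounded_linear_minus[OF bounded_linear_ident] assms(1)]
        bounded_bilinear.Ck_on[OF bounded_bilinear_mult assms(1)]) auto
  then show ?case
    by (intro Ck_on_SucI[OF assms(1) Deriv.has_derivative_inverse[OF assms(2) Ck_on_has_derivative[OF Suc.prems]]]) auto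
qed

section \<open>Symmetry of second derivatives\<close>

lemma onorm_scaleR_le:
  assumes "norm a \<le> B"
  shows "onorm (\<lambda>h. h *\<^sub>R a) \<le> B"
proof (rule onorm_le)
  show "norm (h *\<^sub>R a) \<le> B * norm h" for h
    using mult_right_mono[OF assms norm_ge_zero[of h]] by (simp add: mult.commute)
qed

text \<open>The second difference of \<open>f\<close> over the parallelogram with sides
  \<open>t v\<close> and \<open>t w\<close> is \<open>t * t\<close> times the second derivative up
  to \<open>o(t * t)\<close>, by continuity of the latter; and this difference does not see the
  order of \<open>v\<close> and \<open>w\<close>.\<close>

lemma Ck_on_second_derivative_symmetric:
  fixes f :: "'a::real_normed_vector \<Rightarrow> 'b::real_normed_vector"
  assumes "open S" "Ck_on (Suc (Suc 0)) S f" "x \<in> S"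
  shows "frechet_derivative (\<lambda>y. frechet_derivative f (at y) v) (at x) w =
    frechet_derivative (\<lambda>y. frechet_derivative f (at y) w) (at x) v"
proof -
  define D where "D v y = frechet_derivative f (at y) v" for v y
  define H where "H v w y = frechet_derivative (D v) (at y) w" for v w y
  have df: "(f has_derivative (\<lambda>v. D v y)) (at y)" if "y \<in> S" for y
    using Ck_on_has_derivative[OF assms(2) that] unfolding D_def .
  have dD: "(D v has_derivative (\<lambda>w. H v w y)) (at y)" if "y \<in> S" for y v
    using Ck_on_has_derivative[OF Ck_on_derivative[OF assms(2)] that] unfolding D_def H_def .
  have cH: "continuous_on S (H v w)" for v w
    using assms(2) unfolding H_def D_def by simp
  \<comment> \<open>The mean value inequality is used twice, in direction \<open>w\<close>
    (\<open>step1\<close>) and then in direction \<open>v\<close> (for \<open>\<phi>\<close>). The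
    term \<open>(t * t) *\<^sub>R H v w x\<close> is subtracted beforehand, so that only the
    oscillation of \<open>H v w\<close> on \<open>ball x d\<close> enters, which is at most
    \<open>e\<close>.\<close>
  have key: "\<exists>\<delta>>0. \<forall>t. 0 < t \<and> t < \<delta> \<longrightarrow>
      norm (f (x + t *\<^sub>R v + t *\<^sub>R w) - f (x + t *\<^sub>R v) - f (x + t *\<^sub>R w) + f x - (t * t) *\<^sub>R H v w x) \<le> t * t * e"
    if e: "e > 0" for v w e
  proof -
    obtain d where d: "d > 0" "ball x d \<subseteq> S" "\<And>y. y \<in> ball x d \<Longrightarrow> norm (H v w y - H v w x) \<le> e"
    proof -
      obtain d1 where d1: "d1 > 0" "ball x d1 \<subseteq> S" using assms openE by blast
      obtain d2 where d2: "d2 > 0" "\<And>y. y \<in> S \<Longrightarrow> dist y x < d2 \<Longrightarrow> dist (H v w y) (H v w x) < e"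
        using cH[of v w] assms(3) e unfolding continuous_on_iff by metis
      show thesis
        proof (rule that[of "min d1 d2"])
          show "norm (H v w y - H v w x) \<le> e" if "y \<in> ball x (min d1 d2)" for y
            using d2(2)[of y] d1(2) that by (auto simp: dist_norm norm_minus_commute intro!: less_imp_le)
        qed (use d1 d2 in auto)
    qed
    \<comment> \<open>Keeps the whole parallelogram of side \<open>t < \<delta>\<close> inside
      \<open>ball x d\<close>; the summand 1 makes the denominator positive.\<close>
    define \<delta> where "\<delta> = d / (norm v + norm w + 1)"
    have pos: "norm v + norm w + 1 > 0" by (intro add_nonneg_pos add_nonneg_nonneg) auto
    have "\<delta> > 0" using d(1) pos by (simp add: \<delta>_def)
    moreover have "norm (f (x + t *\<^sub>R v + t *\<^sub>R w) - f (x + t *\<^sub>R v) - f (x + t *\<^sub>R w) + f x - (t * t) *\<^sub>R H v w x) \<le> t * t * e"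
      if t: "0 < t" "t < \<delta>" for t
    proof -
      have inb: "x + s *\<^sub>R v + r *\<^sub>R w \<in> ball x d" if "s \<in> {0..t}" "r \<in> {0..t}" for s r
      proof -
        have "norm (s *\<^sub>R v + r *\<^sub>R w) \<le> s * norm v + r * norm w"
          using that norm_triangle_ineq[of "s *\<^sub>R v" "r *\<^sub>R w"] by simp
        also have "\<dots> \<le> t * norm v + t * norm w"
          using that by (intro add_mono mult_right_mono) auto
        also have "\<dots> \<le> t * (norm v + norm w + 1)" using t by (simp add: algebra_simps)
        also have "\<dots> < d" using t pos by (simp add: \<delta>_def pos_less_divide_eq)
        finally have "dist x (x + (s *\<^sub>R v + r *\<^sub>R w)) < d" by (metis add_diff_cancel_left' dist_commute dist_norm)
        then show ?thesis by (simp add: add.assoc)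
      qed
      have inS: "x + s *\<^sub>R v + r *\<^sub>R w \<in> S" if "s \<in> {0..t}" "r \<in> {0..t}" for s r
        using inb[OF that] d(2) by auto
      have step1: "norm (D v (x + s *\<^sub>R v + t *\<^sub>R w) - D v (x + s *\<^sub>R v) - t *\<^sub>R H v w x) \<le> t * e"
        if s: "s \<in> {0..t}" for s
      proof -
        have l: "linear (\<lambda>w. H v w y)" if "y \<in> S" for y using dD[OF that] has_derivative_linear by blast
        have der: "((\<lambda>r. D v (x + s *\<^sub>R v + r *\<^sub>R w) - r *\<^sub>R H v w x) has_vector_derivative
            H v w (x + s *\<^sub>R v + r *\<^sub>R w) - H v w x) (at r within {0..t})" if "r \<in> {0..t}" for r
        proof -
          note i = inS[OF s that]
          have "((\<lambda>r. x + s *\<^sub>R v + r *\<^sub>R w) has_derivative (\<lambda>h. h *\<^sub>R w)) (at r within {0..t})"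
            by (auto intro!: derivative_eq_intros)
          from has_derivative_compose[OF this dD[OF i]]
          have "((\<lambda>r. D v (x + s *\<^sub>R v + r *\<^sub>R w) - r *\<^sub>R H v w x) has_derivative
              (\<lambda>h. H v (h *\<^sub>R w) (x + s *\<^sub>R v + r *\<^sub>R w) - h *\<^sub>R H v w x)) (at r within {0..t})"
            by (intro has_derivative_diff) (auto intro!: derivative_eq_intros)
          then show ?thesis
            by (simp add: has_vector_derivative_def linear_scale[OF l[OF i]] scaleR_diff_right)
        qed
        have "norm ((D v (x + s *\<^sub>R v + t *\<^sub>R w) - t *\<^sub>R H v w x) - (D v (x + s *\<^sub>R v + 0 *\<^sub>R w) - 0 *\<^sub>R H v w x)) \<le> e * norm (t - 0)"
        proof (rule differentiable_bound[OF convex_real_interval(5)[of 0 t] der[unfolded has_vector_derivative_def]])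
          show "onorm (\<lambda>h. h *\<^sub>R (H v w (x + s *\<^sub>R v + r *\<^sub>R w) - H v w x)) \<le> e" if "r \<in> {0..t}" for r
            by (rule onorm_scaleR_le[OF d(3)[OF inb[OF s that]]])
        qed (use t in auto)
        then show ?thesis using t by (simp add: algebra_simps)
      qed
      define \<phi> where "\<phi> s = f (x + s *\<^sub>R v + t *\<^sub>R w) - f (x + s *\<^sub>R v) - s *\<^sub>R t *\<^sub>R H v w x" for s
      have l: "linear (\<lambda>w. D w y)" if "y \<in> S" for y using df[OF that] has_derivative_linear by blast
      have der: "(\<phi> has_derivative (\<lambda>h. h *\<^sub>R (D v (x + s *\<^sub>R v + t *\<^sub>R w) - D v (x + s *\<^sub>R v) - t *\<^sub>R H v w x))) (at s within {0..t})"
        if s: "s \<in> {0..t}" for s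
      proof -
        have i1: "x + s *\<^sub>R v + t *\<^sub>R w \<in> S" using inS[OF s, of t] t by simp
        have i2: "x + s *\<^sub>R v \<in> S" using inS[OF s, of 0] t by simp
        have e: "((\<lambda>s. x + s *\<^sub>R v + t *\<^sub>R w) has_derivative (\<lambda>h. h *\<^sub>R v)) (at s within {0..t})"
          "((\<lambda>s. x + s *\<^sub>R v) has_derivative (\<lambda>h. h *\<^sub>R v)) (at s within {0..t})"
          by (auto intro!: derivative_eq_intros)
        have "(\<phi> has_derivative (\<lambda>h. D (h *\<^sub>R v) (x + s *\<^sub>R v + t *\<^sub>R w) - D (h *\<^sub>R v) (x + s *\<^sub>R v)
            - h *\<^sub>R t *\<^sub>R H v w x)) (at s within {0..t})"
          unfolding \<phi>_def
          by (intro has_derivative_diff has_derivative_compose[OF e(1) df[OF i1]]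
              has_derivative_compose[OF e(2) df[OF i2]]) (auto intro!: derivative_eq_intros)
        then show ?thesis
          by (simp add: linear_scale[OF l[OF i1]] linear_scale[OF l[OF i2]] scaleR_diff_right)
      qed
      have "norm (\<phi> t - \<phi> 0) \<le> (t * e) * norm (t - 0)"
      proof (rule differentiable_bound[OF convex_real_interval(5)[of 0 t] der])
        show "onorm (\<lambda>h. h *\<^sub>R (D v (x + s *\<^sub>R v + t *\<^sub>R w) - D v (x + s *\<^sub>R v) - t *\<^sub>R H v w x)) \<le> t * e"
          if "s \<in> {0..t}" for s
          by (rule onorm_scaleR_le[OF step1[OF that]])
      qed (use t in auto)
      then show ?thesis using t by (simp add: \<phi>_def algebra_simps)
    qed
    ultimately show ?thesis by blast
  qed
  have "norm (H v w x - H w v x) \<le> 2 * e" if e: "e > 0" for e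
  proof -
    obtain d1 where d1: "d1 > 0" "\<And>t. 0 < t \<and> t < d1 \<Longrightarrow>
      norm (f (x + t *\<^sub>R v + t *\<^sub>R w) - f (x + t *\<^sub>R v) - f (x + t *\<^sub>R w) + f x - (t * t) *\<^sub>R H v w x) \<le> t * t * e"
      using key[OF e] by blast
    obtain d2 where d2: "d2 > 0" "\<And>t. 0 < t \<and> t < d2 \<Longrightarrow>
      norm (f (x + t *\<^sub>R w + t *\<^sub>R v) - f (x + t *\<^sub>R w) - f (x + t *\<^sub>R v) + f x - (t * t) *\<^sub>R H w v x) \<le> t * t * e"
      using key[OF e] by blast
    define t where "t = min d1 d2 / 2"
    have t: "0 < t \<and> t < d1" "0 < t \<and> t < d2" using d1(1) d2(1) by (auto simp: t_def)
    define Q where "Q = f (x + t *\<^sub>R v + t *\<^sub>R w) - f (x + t *\<^sub>R v) - f (x + t *\<^sub>R w) + f x"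
    have n1: "norm (Q - (t * t) *\<^sub>R H v w x) \<le> t * t * e" using d1(2)[OF t(1)] by (simp add: Q_def)
    have n2: "norm (Q - (t * t) *\<^sub>R H w v x) \<le> t * t * e"
      using d2(2)[OF t(2)] by (simp add: Q_def algebra_simps)
    have "(t * t) *\<^sub>R (H v w x - H w v x) = (Q - (t * t) *\<^sub>R H w v x) - (Q - (t * t) *\<^sub>R H v w x)"
      by (simp add: scaleR_diff_right)
    then have "norm ((t * t) *\<^sub>R (H v w x - H w v x)) \<le> t * t * e + t * t * e"
      by (rule ssubst) (rule order_trans[OF norm_triangle_ineq4 add_mono[OF n2 n1]])
    then have "(t * t) * norm (H v w x - H w v x) \<le> (t * t) * (2 * e)"
      by (simp add: mult_ac)
    then show ?thesis using t by (simp add: mult_le_cancel_left)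
  qed
  then have "norm (H v w x - H w v x) \<le> 0 + e" if "e > 0" for e
    using that by (metis add_0 field_sum_of_halves half_gt_zero mult_2)
  then have "norm (H v w x - H w v x) \<le> 0" by (rule field_le_epsilon)
  then show ?thesis by (simp add: H_def D_def[abs_def])
qed

section \<open>Smooth maps and local diffeomorphisms\<close>

lemma smooth_on_imp_Ck: "smooth_on S f \<Longrightarrow> Ck_on k S f"
  by (simp add: smooth_on_def)

lemma smooth_on_has_derivative:
  "smooth_on S f \<Longrightarrow> x \<in> S \<Longrightarrow> (f has_derivative frechet_derivative f (at x)) (at x)"
  using Ck_on_has_derivative[of 0 S f x] by (simp only: smooth_on_def)

lemma smooth_on_derivative: "smooth_on S f \<Longrightarrow> smooth_on S (\<lambda>x. frechet_derivative f (at x) v)"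
  unfolding smooth_on_def using Ck_on_derivative by fast

lemma smooth_on_subset: "smooth_on S f \<Longrightarrow> T \<subseteq> S \<Longrightarrow> smooth_on T f"
  unfolding smooth_on_def by (blast intro: Ck_on_subset)

lemma smooth_on_add: "open S \<Longrightarrow> smooth_on S f \<Longrightarrow> smooth_on S h \<Longrightarrow> smooth_on S (\<lambda>x. f x + h x)"
  unfolding smooth_on_def by (blast intro: Ck_on_add)

lemma smooth_on_Pair: "open S \<Longrightarrow> smooth_on S f \<Longrightarrow> smooth_on S h \<Longrightarrow> smooth_on S (\<lambda>x. (f x, h x))"
  unfolding smooth_on_def by (blast intro: Ck_on_Pair)

lemma smooth_on_minus: "open S \<Longrightarrow> smooth_on S f \<Longrightarrow> smooth_on S (\<lambda>x. - f x)"
  unfolding smooth_on_def by (blast intro: Ck_on_bounded_linear[OF bounded_linear_minus[OF bounded_linear_ident]])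

lemma smooth_on_scaleR:
  "open S \<Longrightarrow> smooth_on S r \<Longrightarrow> smooth_on S f \<Longrightarrow> smooth_on S (\<lambda>x. r x *\<^sub>R f x)"
  unfolding smooth_on_def by (blast intro: bounded_bilinear.Ck_on[OF bounded_bilinear_scaleR])

lemma smooth_on_bounded_linear: "bounded_linear L \<Longrightarrow> smooth_on S L"
  unfolding smooth_on_def by (blast intro: Ck_on_linear)

lemma smooth_on_const: "smooth_on S (\<lambda>x. c)"
  by (simp add: smooth_on_def)

lemma smooth_on_compose:
  fixes f :: "'a::real_normed_vector \<Rightarrow> 'b::euclidean_space" and h :: "'b \<Rightarrow> 'c::real_normed_vector"
  assumes "open S" "open T" "f ` S \<subseteq> T" "smooth_on S f" "smooth_on T h"
  shows "smooth_on S (\<lambda>x. h (f x))"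
  using assms(4,5) unfolding smooth_on_def by (blast intro: Ck_on_compose[OF assms(1-3)])

text \<open>The inverse function theorem needs the derivative as a continuous
  \<open>blinfun\<close>-valued map, which is checked on basis vectors. Injectivity of the
  derivative is recorded on all of \<open>U'\<close>, since a new parametrization must be an
  immersion everywhere and not only at \<open>p\<close>.\<close>

lemma smooth_local_diffeomorphism:
  fixes H :: "'a::euclidean_space \<Rightarrow> 'a"
  assumes U: "open U" and H: "smooth_on U H" and p: "p \<in> U" and inj: "inj (frechet_derivative H (at p))"
  obtains U' V G where "open U'" "U' \<subseteq> U" "p \<in> U'" "open V" "homeomorphism U' V H G"
    "\<And>u. u \<in> U' \<Longrightarrow> inj (frechet_derivative H (at u))"
proof -
  let ?D = "\<lambda>u. frechet_derivative H (at u)"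
  define f' where "f' u = Blinfun (?D u)" for u
  have dH: "(H has_derivative ?D u) (at u)" if "u \<in> U" for u by (rule smooth_on_has_derivative[OF H that])
  have f': "blinfun_apply (f' u) = ?D u" if "u \<in> U" for u
    unfolding f'_def by (rule bounded_linear_Blinfun_apply[OF has_derivative_bounded_linear[OF dH[OF that]]])
  have cont: "continuous_on U f'"
  proof (rule continuous_on_blinfun_componentwise)
    fix i :: 'a
    have "continuous_on U (\<lambda>u. ?D u i)"
      by (rule Ck_on_imp_continuous_on[OF smooth_on_imp_Ck[OF smooth_on_derivative[OF H], of 0]])
    then show "continuous_on U (\<lambda>u. blinfun_apply (f' u) i)"
      by (rule continuous_on_eq) (simp add: f')
  qed
  obtain k where k: "linear k" "k \<circ> ?D p = id"
    using linear_injective_left_inverse[OF has_derivative_linear[OF dH[OF p]] inj] by blast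
  have "Blinfun k o\<^sub>L f' p = id_blinfun"
    using k by (intro blinfun_eqI)
      (simp add: bounded_linear_Blinfun_apply linear_conv_bounded_linear[symmetric] f'[OF p] pointfree_idE)
  note inv = this
  have dH': "(H has_derivative blinfun_apply (f' u)) (at u)" if "u \<in> U" for u
    unfolding f'[OF that] by (rule dH[OF that])
  obtain U' V G where *: "open U'" "U' \<subseteq> U" "p \<in> U'" "open V" "homeomorphism U' V H G"
    "\<And>y. y \<in> V \<Longrightarrow> bij (blinfun_apply (f' (G y)))"
    apply (rule inverse_function_theorem[OF U dH' cont p inv], assumption)
    subgoal premises prems by (rule prems(1)[OF prems(2-5,7,10)])
    done
  have "inj (?D u)" if u: "u \<in> U'" for u
  proof -
    have uU: "u \<in> U" using u *(2) by blast
    have "H u \<in> V" "G (H u) = u" using *(5) u by (auto simp: homeomorphism_def)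
    then have "bij (blinfun_apply (f' u))" using *(6)[of "H u"] by simp
    then show ?thesis unfolding f'[OF uU] by (rule bij_is_inj)
  qed
  then show thesis by (rule that[OF *(1-5)])
qed

section \<open>Dependence of solutions of ordinary differential equations on a parameter\<close>

text \<open>At a maximum point of \<open>norm (R s)\<close> the mean value inequality bounds the
  maximum by half of itself plus \<open>\<rho> + e * \<eta>\<close>, because
  \<open>e * L \<le> 1/2\<close>. Absorbing the half replaces the exponential factor of the usual
  estimate by 2.\<close>

lemma small_interval_gronwall:
  fixes R :: "real \<Rightarrow> 'a::real_normed_vector"
  assumes e: "0 \<le> e" "0 \<le> L" "e * L \<le> 1/2"
    and der: "\<And>s. s \<in> {-e..e} \<Longrightarrow> (R has_vector_derivative R' s) (at s within {-e..e})"
    and bound: "\<And>s. s \<in> {-e..e} \<Longrightarrow> norm (R' s) \<le> L * norm (R s) + \<eta>"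
    and init: "norm (R 0) \<le> \<rho>" and s: "s \<in> {-e..e}"
  shows "norm (R s) \<le> 2 * (\<rho> + e * \<eta>)"
proof -
  have "continuous_on {-e..e} R"
    using der has_vector_derivative_continuous continuous_on_eq_continuous_within by blast
  then have "continuous_on {-e..e} (\<lambda>s. norm (R s))" by (rule continuous_on_norm)
  moreover have "compact {-e..e}" "{-e..e} \<noteq> {}" using e(1) by auto
  ultimately obtain s0 where s0: "s0 \<in> {-e..e}" "\<And>s. s \<in> {-e..e} \<Longrightarrow> norm (R s) \<le> norm (R s0)"
    using continuous_attains_sup by metis
  have "norm (R s0 - R 0) \<le> (L * norm (R s0) + \<eta>) * norm (s0 - 0)"
  proof (rule differentiable_bound[OF convex_real_interval(5)[of "-e" e] der[unfolded has_vector_derivative_def]])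
    show "onorm (\<lambda>h. h *\<^sub>R R' r) \<le> L * norm (R s0) + \<eta>" if "r \<in> {-e..e}" for r
    proof (rule onorm_scaleR_le)
      show "norm (R' r) \<le> L * norm (R s0) + \<eta>"
        using bound[OF that] mult_left_mono[OF s0(2)[OF that] e(2)] by linarith
    qed
  qed (use s0 e in auto)
  also have "\<dots> \<le> (L * norm (R s0) + \<eta>) * e"
  proof (rule mult_left_mono)
    show "0 \<le> L * norm (R s0) + \<eta>" using bound[OF s0(1)] norm_ge_zero[of "R' s0"] by linarith
  qed (use s0 in auto)
  also have "\<dots> = (e * L) * norm (R s0) + e * \<eta>" by (simp add: algebra_simps)
  also have "\<dots> \<le> (1/2) * norm (R s0) + e * \<eta>" using e(3) by (intro add_right_mono mult_right_mono) auto
  finally have "norm (R s0 - R 0) \<le> norm (R s0) / 2 + e * \<eta>" by simp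
  moreover have "norm (R s0) \<le> norm (R s0 - R 0) + norm (R 0)" using norm_triangle_sub by (metis add.commute)
  moreover have "d \<le> 2 * (r + E)" if "a \<le> b / 2 + E" "b \<le> a + c" "d \<le> b" "c \<le> r" for a b c d r E :: real
    using that by simp
  ultimately show ?thesis using s0(2)[OF s] init by blast
qed

text \<open>The Picard operator contracts with factor \<open>e * L \<le> 1/2\<close>. To use the
  fixed point theorem on the complete type of bounded continuous functions on the whole line, time
  is clamped to the interval by \<open>cl\<close>, which makes every \<open>T v\<close>
  bounded.\<close>

lemma picard_lindeloef_small_interval:
  fixes F :: "real \<Rightarrow> 'a::banach \<Rightarrow> 'a"
  assumes e: "0 < e" "0 \<le> L" "e * L \<le> 1/2"
    and cont: "continuous_on ({-e..e} \<times> UNIV) (\<lambda>(s, z). F s z)"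
    and lip: "\<And>s z z'. s \<in> {-e..e} \<Longrightarrow> norm (F s z - F s z') \<le> L * norm (z - z')"
  obtains u where "u 0 = u0"
    "\<And>s. s \<in> {-e..e} \<Longrightarrow> (u has_vector_derivative F s (u s)) (at s within {-e..e})"
proof -
  define cl where "cl s = max (-e) (min e s)" for s :: real
  have cl: "cl s \<in> {-e..e}" for s using e by (auto simp: cl_def)
  have cl_id: "cl s = s" if "s \<in> {-e..e}" for s using that by (auto simp: cl_def)
  have cl_cont: "continuous_on UNIV cl" unfolding cl_def by (intro continuous_intros)
  define h where "h v r = F r (apply_bcontfun v r)" for v :: "real \<Rightarrow>\<^sub>C 'a" and r
  \<comment> \<open>Integrals start at \<open>-e\<close>, and subtracting \<open>J v 0\<close> moves
    the initial condition to time 0; one formula then serves positive and negative times.\<close>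
  define J where "J v s = integral {-e..s} (h v)" for v s
  define T where "T v s = u0 + (J v (cl s) - J v 0)" for v s
  have h_cont: "continuous_on {-e..e} (h v)" for v
  proof -
    have "continuous_on {-e..e} (\<lambda>r. (r, apply_bcontfun v r))" by (intro continuous_intros) auto
    from continuous_on_compose2[OF cont this] show ?thesis by (auto simp: h_def[abs_def])
  qed
  have J_der: "(J v has_vector_derivative h v s) (at s within {-e..e})" if "s \<in> {-e..e}" for v s
    unfolding J_def using integral_has_vector_derivative[OF h_cont that] .
  have J_cont: "continuous_on {-e..e} (J v)" for v
    using J_der has_vector_derivative_continuous continuous_on_eq_continuous_within by blast
  have T_cont: "continuous_on UNIV (T v)" for v
    unfolding T_def using cl
    by (intro continuous_intros continuous_on_compose2[OF J_cont[of v] cl_cont]) auto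
  have T_bdd: "bounded (range (T v))" for v
  proof -
    have "compact ((\<lambda>s. u0 + (J v s - J v 0)) ` {-e..e})"
      by (intro compact_continuous_image continuous_intros J_cont) auto
    moreover have "range (T v) \<subseteq> (\<lambda>s. u0 + (J v s - J v 0)) ` {-e..e}" using cl by (auto simp: T_def)
    ultimately show ?thesis using bounded_subset compact_imp_bounded by blast
  qed
  define TT where "TT v = Bcontfun (T v)" for v
  have TT: "apply_bcontfun (TT v) = T v" for v
    unfolding TT_def by (rule Bcontfun_inverse) (use T_cont T_bdd in \<open>auto simp: bcontfun_def\<close>)
  have "dist (TT v) (TT w) \<le> 1/2 * dist v w" for v w
  proof (rule dist_bound)
    fix s
    have "norm ((J v (cl s) - J w (cl s)) - (J v 0 - J w 0)) \<le> (L * dist v w) * norm (cl s - 0)"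
    proof (rule differentiable_bound[where f = "\<lambda>s. J v s - J w s",
          OF convex_real_interval(5)[of "-e" e]])
      show "((\<lambda>s. J v s - J w s) has_derivative (\<lambda>k. k *\<^sub>R (h v r - h w r))) (at r within {-e..e})"
        if "r \<in> {-e..e}" for r
        using has_vector_derivative_diff[OF J_der[OF that] J_der[OF that]]
        by (simp add: has_vector_derivative_def)
      show "onorm (\<lambda>k. k *\<^sub>R (h v r - h w r)) \<le> L * dist v w" if "r \<in> {-e..e}" for r
      proof (rule onorm_scaleR_le)
        have "norm (h v r - h w r) \<le> L * norm (apply_bcontfun v r - apply_bcontfun w r)"
          unfolding h_def by (rule lip[OF that])
        also have "\<dots> \<le> L * dist v w"
          using dist_bounded[of v r w] by (intro mult_left_mono e) (simp add: dist_norm)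
        finally show "norm (h v r - h w r) \<le> L * dist v w" .
      qed
    qed (use cl e in auto)
    also have "\<dots> \<le> (L * dist v w) * e" using cl[of s] e by (intro mult_left_mono) auto
    also have "\<dots> \<le> 1/2 * dist v w"
      using mult_right_mono[OF e(3), of "dist v w"] by (simp add: mult.commute mult.left_commute)
    finally show "dist (apply_bcontfun (TT v) s) (apply_bcontfun (TT w) s) \<le> 1/2 * dist v w"
      unfolding TT T_def dist_norm by (simp add: algebra_simps)
  qed
  then have "\<exists>!v. TT v = v" by (intro banach_fix_type[of "1/2"]) auto
  then obtain v where v: "TT v = v" by blast
  have v_eq: "apply_bcontfun v s = u0 + (J v (cl s) - J v 0)" for s using TT[of v] by (simp add: v T_def)
  show thesis
  proof (rule that[of "apply_bcontfun v"])
    show "apply_bcontfun v 0 = u0" using cl_id[of 0] e by (simp add: v_eq[of 0])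
    fix s assume s: "s \<in> {-e..e}"
    have "((\<lambda>s. u0 + (J v s - J v 0)) has_vector_derivative h v s) (at s within {-e..e})"
      using J_der[OF s, of v] by (auto intro!: derivative_eq_intros)
    then have "(apply_bcontfun v has_vector_derivative h v s) (at s within {-e..e})"
      by (rule has_vector_derivative_transform[OF s, rotated]) (simp add: v_eq cl_id)
    then show "(apply_bcontfun v has_vector_derivative F s (apply_bcontfun v s)) (at s within {-e..e})"
      by (simp add: h_def)
  qed
qed

section \<open>Uniform estimates on compact sets\<close>

lemma uniform_continuity_in_parameter:
  fixes G :: "real \<times> real \<Rightarrow> 'c::metric_space"
  assumes "continuous_on ({a..b} \<times> P) G" "open P" "t0 \<in> P" "\<eta> > 0"
  shows "\<exists>\<delta>>0. \<forall>t. dist t t0 < \<delta> \<longrightarrow> t \<in> P \<and> (\<forall>s\<in>{a..b}. dist (G (s, t)) (G (s, t0)) < \<eta>)"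
proof -
  obtain r where r: "r > 0" "cball t0 r \<subseteq> P" using assms open_contains_cball by blast
  have "uniformly_continuous_on ({a..b} \<times> cball t0 r) G"
    using r by (intro compact_uniformly_continuous continuous_on_subset[OF assms(1)] compact_Times) auto
  then obtain d where d: "d > 0" "\<And>x y. x \<in> {a..b} \<times> cball t0 r \<Longrightarrow> y \<in> {a..b} \<times> cball t0 r \<Longrightarrow>
      dist y x < d \<Longrightarrow> dist (G y) (G x) < \<eta>"
    unfolding uniformly_continuous_on_def using assms(4) by metis
  show ?thesis
  proof (intro exI[of _ "min d r"] conjI allI impI ballI)
    fix t assume t: "dist t t0 < min d r"
    then show "t \<in> P" using r by (auto simp: dist_commute subset_iff)
    fix s assume "s \<in> {a..b}"
    then show "dist (G (s, t)) (G (s, t0)) < \<eta>"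
      using t r by (intro d(2)) (auto simp: dist_Pair_Pair dist_commute)
  qed (use r d in auto)
qed

lemma compact_neighbourhood:
  fixes K :: "'a::euclidean_space set"
  assumes "compact K" "open S" "K \<subseteq> S"
  obtains r K' where "r > 0" "compact K'" "K' \<subseteq> S" "\<And>x y. x \<in> K \<Longrightarrow> norm y \<le> r \<Longrightarrow> x + y \<in> K'"
proof -
  obtain r where r: "r > 0" "(\<Union>x\<in>K. cball x r) \<subseteq> S"
    using compact_subset_open_imp_cball_epsilon_subset[OF assms] .
  show thesis
  proof (rule that[of r "{x + y |x y. x \<in> K \<and> y \<in> cball 0 r}"])
    show "compact {x + y |x y. x \<in> K \<and> y \<in> cball 0 r}" by (rule compact_sums[OF assms(1) compact_cball])
    show "{x + y |x y. x \<in> K \<and> y \<in> cball 0 r} \<subseteq> S"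
    proof clarify
      fix x y assume "x \<in> K" "y \<in> cball (0::'a) r"
      then have "x + y \<in> cball x r" by (simp add: dist_norm)
      then show "x + y \<in> S" using \<open>x \<in> K\<close> r(2) by blast
    qed
  qed (use r in auto)
qed

lemma onorm_le_sum_Basis:
  fixes f :: "'a::euclidean_space \<Rightarrow> 'b::real_normed_vector"
  assumes "linear f"
  shows "onorm f \<le> (\<Sum>b\<in>Basis. norm (f b))"
proof (rule onorm_le)
  fix h
  have "f h = f (\<Sum>b\<in>Basis. (h \<bullet> b) *\<^sub>R b)" by (simp add: euclidean_representation)
  also have "\<dots> = (\<Sum>b\<in>Basis. (h \<bullet> b) *\<^sub>R f b)" by (simp add: linear_sum[OF assms] linear_scale[OF assms])
  also have "norm \<dots> \<le> (\<Sum>b\<in>Basis. norm h * norm (f b))"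
    by (rule sum_norm_le) (simp add: mult_right_mono Basis_le_norm)
  finally show "norm (f h) \<le> (\<Sum>b\<in>Basis. norm (f b)) * norm h" by (simp add: sum_distrib_left mult.commute)
qed

text \<open>Uniform continuity of the derivative on a compact neighbourhood of \<open>K\<close>
  makes the first-order remainder uniform in the base point. In \<open>ode_parameter_Ck\<close>,
  \<open>K\<close> is an entire solution curve, linearized at all times at once.\<close>

lemma C1_uniform_linearization:
  fixes F :: "'a::euclidean_space \<Rightarrow> 'b::real_normed_vector"
  assumes "open S" "Ck_on (Suc 0) S F" "compact K" "K \<subseteq> S" "\<eta> > 0"
  shows "\<exists>\<delta>>0. \<forall>k\<in>K. \<forall>h. norm h < \<delta> \<longrightarrow>
    norm (F (k + h) - F k - frechet_derivative F (at k) h) \<le> \<eta> * norm h"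
proof -
  obtain r K' where r: "r > 0" "compact K'" "K' \<subseteq> S" "\<And>x y. x \<in> K \<Longrightarrow> norm y \<le> r \<Longrightarrow> x + y \<in> K'"
    using compact_neighbourhood[OF assms(3,1,4)] by metis
  let ?D = "\<lambda>b x. frechet_derivative F (at x) b"
  have "\<forall>b. \<exists>d>0. \<forall>x\<in>K'. \<forall>y\<in>K'. dist y x < d \<longrightarrow> dist (?D b y) (?D b x) < \<eta> / DIM('a)"
  proof
    fix b
    have "continuous_on K' (?D b)" using assms(2) r(3) by (auto intro: continuous_on_subset)
    then have "uniformly_continuous_on K' (?D b)" using r(2) compact_uniformly_continuous by blast
    then show "\<exists>d>0. \<forall>x\<in>K'. \<forall>y\<in>K'. dist y x < d \<longrightarrow> dist (?D b y) (?D b x) < \<eta> / DIM('a)"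
      unfolding uniformly_continuous_on_def using assms(5) by simp
  qed
  then obtain d where d: "\<And>b. d b > 0"
    "\<And>b x y. x \<in> K' \<Longrightarrow> y \<in> K' \<Longrightarrow> dist y x < d b \<Longrightarrow> dist (?D b y) (?D b x) < \<eta> / DIM('a)"
    by metis
  define \<delta> where "\<delta> = min r (Min (d ` Basis))"
  have \<delta>: "\<delta> > 0" "\<delta> \<le> r" "\<And>b. b \<in> Basis \<Longrightarrow> \<delta> \<le> d b"
    using r(1) d(1) by (auto simp: \<delta>_def min_le_iff_disj)
  have "norm (F (k + h) - F k - ?D h k) \<le> \<eta> * norm h" if k: "k \<in> K" and h: "norm h < \<delta>" for k h
  proof -
    have inK: "k + t *\<^sub>R h \<in> K'" if "t \<in> {0..1}" for t
    proof (rule r(4)[OF k])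
      have "norm (t *\<^sub>R h) \<le> 1 * norm h" using that unfolding norm_scaleR by (intro mult_right_mono) auto
      then show "norm (t *\<^sub>R h) \<le> r" using h \<delta>(2) by linarith
    qed
    let ?S = "(\<lambda>t. k + t *\<^sub>R h) ` {0..1}"
    have der: "(F has_derivative (\<lambda>b. ?D b x)) (at x)" if "x \<in> K'" for x
      using Ck_on_has_derivative[OF assms(2)] that r(3) by blast
    have kS: "k \<in> ?S" by (rule image_eqI[of _ _ 0]) auto
    have "norm (F (k + h) - F k - ?D (k + h - k) k) \<le> norm (k + h - k) * \<eta>"
    proof (rule differentiable_bound_linearization[where f' = "\<lambda>x b. ?D b x" and S = ?S])
      show "k + t *\<^sub>R (k + h - k) \<in> ?S" if "t \<in> {0..1}" for t using that by auto
      show "(F has_derivative (\<lambda>b. ?D b x)) (at x within ?S)" if "x \<in> ?S" for x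
        using der[THEN has_derivative_at_withinI] inK that by auto
      show "onorm ((\<lambda>b. ?D b x) - (\<lambda>b. ?D b k)) \<le> \<eta>" if xS: "x \<in> ?S" for x
      proof -
        obtain t where t: "t \<in> {0..1}" "x = k + t *\<^sub>R h" using xS by blast
        have x: "x \<in> K'" "k \<in> K'" using inK[OF t(1)] inK[of 0] t(2) by auto
        have dx: "dist x k < \<delta>"
        proof -
          have "norm (t *\<^sub>R h) \<le> 1 * norm h" using t(1) unfolding norm_scaleR by (intro mult_right_mono) auto
          then show ?thesis using h t by (simp add: dist_norm)
        qed
        have "linear (\<lambda>b. ?D b x - ?D b k)"
          using der[OF x(1)] der[OF x(2)] by (intro linear_compose_sub has_derivative_linear)
        then have "onorm (\<lambda>b. ?D b x - ?D b k) \<le> (\<Sum>b\<in>Basis. norm (?D b x - ?D b k))"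
          by (rule onorm_le_sum_Basis)
        also have "\<dots> \<le> (\<Sum>b\<in>(Basis::'a set). \<eta> / DIM('a))"
        proof (rule sum_mono)
          fix b :: 'a assume "b \<in> Basis"
          then have "dist (?D b x) (?D b k) < \<eta> / DIM('a)" using x dx \<delta>(3)[of b] by (intro d(2)) auto
          then show "norm (?D b x - ?D b k) \<le> \<eta> / DIM('a)" by (simp add: dist_norm)
        qed
        also have "\<dots> = \<eta>" by simp
        finally show ?thesis by (simp add: fun_diff_def)
      qed
    qed (use kS in auto)
    then show ?thesis by (simp add: mult.commute)
  qed
  then show ?thesis using \<delta>(1) by blast
qed

lemma C1_lipschitz_on_compact_convex:
  fixes F :: "'a::euclidean_space \<Rightarrow> 'b::real_normed_vector"
  assumes "Ck_on (Suc 0) S F" "compact K" "convex K" "K \<subseteq> S"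
  obtains L where "L \<ge> 0" "\<And>x y. x \<in> K \<Longrightarrow> y \<in> K \<Longrightarrow> norm (F x - F y) \<le> L * norm (x - y)"
proof -
  let ?D = "\<lambda>b x. frechet_derivative F (at x) b"
  have "\<forall>b. \<exists>B. \<forall>x\<in>K. norm (?D b x) \<le> B"
  proof
    fix b
    have "continuous_on K (?D b)" using assms(1,4) by (auto intro: continuous_on_subset)
    then have "bounded (?D b ` K)" using assms(2) compact_continuous_image compact_imp_bounded by blast
    then show "\<exists>B. \<forall>x\<in>K. norm (?D b x) \<le> B" by (auto simp: bounded_iff)
  qed
  then obtain B where B: "\<And>b x. x \<in> K \<Longrightarrow> norm (?D b x) \<le> B b" by metis
  show thesis
  proof (rule that[of "\<bar>\<Sum>b\<in>Basis. B b\<bar>"])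
    fix x y assume xy: "x \<in> K" "y \<in> K"
    show "norm (F x - F y) \<le> \<bar>\<Sum>b\<in>Basis. B b\<bar> * norm (x - y)"
    proof (rule differentiable_bound[OF assms(3) _ _ xy])
      show der: "(F has_derivative (\<lambda>b. ?D b z)) (at z within K)" if "z \<in> K" for z
        using Ck_on_has_derivative[OF assms(1)] that assms(4) has_derivative_at_withinI by blast
      show "onorm (\<lambda>b. ?D b z) \<le> \<bar>\<Sum>b\<in>Basis. B b\<bar>" if "z \<in> K" for z
        using onorm_le_sum_Basis[OF has_derivative_linear[OF der[OF that]]]
          sum_mono[of Basis "\<lambda>b. norm (?D b z)" B] B[OF that] by force
    qed
  qed auto
qed

text \<open>Carries the Lipschitz constant of an equation over to its linearization, so that the
  linearized equation is admissible on the same time interval. The derivative is compared with a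
  difference quotient at a small step \<open>\<tau>\<close> along \<open>w\<close>.\<close>

lemma lipschitz_imp_derivative_bound:
  fixes f :: "'a::real_normed_vector \<Rightarrow> 'b::real_normed_vector"
  assumes "open Z" "z \<in> Z" "(f has_derivative f') (at z)"
    and lip: "\<And>y. y \<in> Z \<Longrightarrow> norm (f y - f z) \<le> L * norm (y - z)"
  shows "norm (f' w) \<le> L * norm w"
proof (rule field_le_epsilon)
  interpret f': bounded_linear f' by (rule has_derivative_bounded_linear[OF assms(3)])
  fix \<epsilon> :: real assume "\<epsilon> > 0"
  define \<epsilon>' where "\<epsilon>' = \<epsilon> / (norm w + 1)"
  have p: "norm w + 1 > 0" by (intro add_nonneg_pos) auto
  have e': "\<epsilon>' > 0" using \<open>\<epsilon> > 0\<close> p by (simp add: \<epsilon>'_def)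
  obtain d1 where d1: "d1 > 0" "\<And>y. norm (y - z) < d1 \<Longrightarrow> norm (f y - f z - f' (y - z)) \<le> \<epsilon>' * norm (y - z)"
    using assms(3) e' unfolding has_derivative_at_alt by metis
  obtain d2 where d2: "d2 > 0" "ball z d2 \<subseteq> Z" using assms(1,2) openE by blast
  define \<tau> where "\<tau> = min d1 d2 / 2 / (norm w + 1)"
  have \<tau>: "\<tau> > 0" using d1 d2 p by (simp add: \<tau>_def)
  have "\<tau> * norm w \<le> \<tau> * (norm w + 1)" using \<tau> by (intro mult_left_mono) auto
  also have "\<dots> = min d1 d2 / 2" using p unfolding \<tau>_def by (intro nonzero_eq_divide_eq[THEN iffD1]) auto
  also have "\<dots> < min d1 d2" using d1(1) d2(1) by (simp add: min_def)
  finally have small: "\<tau> * norm w < min d1 d2" .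
  let ?y = "z + \<tau> *\<^sub>R w"
  have "?y \<in> Z" using small d2 \<tau> by (auto simp: dist_norm subset_iff)
  then have 1: "norm (f ?y - f z) \<le> L * (\<tau> * norm w)" using lip[of ?y] \<tau> by simp
  have 2: "norm (f ?y - f z - \<tau> *\<^sub>R f' w) \<le> \<epsilon>' * (\<tau> * norm w)"
    using d1(2)[of ?y] small \<tau> by (simp add: f'.scaleR)
  have "norm (\<tau> *\<^sub>R f' w) \<le> norm (f ?y - f z) + norm (f ?y - f z - \<tau> *\<^sub>R f' w)"
    by (metis add.commute norm_minus_commute norm_triangle_sub)
  then have "\<tau> * norm (f' w) \<le> L * (\<tau> * norm w) + \<epsilon>' * (\<tau> * norm w)" using 1 2 \<tau> by simp
  also have "\<dots> = \<tau> * (L * norm w + \<epsilon>' * norm w)" by (simp add: algebra_simps)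
  finally have "norm (f' w) \<le> L * norm w + \<epsilon>' * norm w" using \<tau> by simp
  also have "\<epsilon>' * norm w \<le> \<epsilon>" using p \<open>\<epsilon> > 0\<close> by (simp add: \<epsilon>'_def divide_simps)
  finally show "norm (f' w) \<le> L * norm w + \<epsilon>" by simp
qed

text \<open>The solutions for \<open>t\<close> and \<open>t0\<close> are compared by
  \<open>small_interval_gronwall\<close>. The error term is the change of \<open>F\<close> in its
  parameter along the fixed curve \<open>u (s, t0)\<close>, which is uniformly small on a compact
  time interval.\<close>

lemma ode_parameter_continuous:
  fixes F :: "real \<times> real \<times> 'a::euclidean_space \<Rightarrow> 'a"
  assumes P: "open P" and e: "0 \<le> L" "e * L \<le> 1/2"
    and F: "continuous_on ({-e<..<e} \<times> P \<times> Z) F"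
    and lip: "\<And>s t z z'. s \<in> {-e<..<e} \<Longrightarrow> t \<in> P \<Longrightarrow> z \<in> Z \<Longrightarrow> z' \<in> Z \<Longrightarrow>
      norm (F (s, t, z) - F (s, t, z')) \<le> L * norm (z - z')"
    and u0: "continuous_on P u0"
    and init: "\<And>t. t \<in> P \<Longrightarrow> u (0, t) = u0 t"
    and uZ: "\<And>s t. s \<in> {-e<..<e} \<Longrightarrow> t \<in> P \<Longrightarrow> u (s, t) \<in> Z"
    and der: "\<And>s t. s \<in> {-e<..<e} \<Longrightarrow> t \<in> P \<Longrightarrow>
      ((\<lambda>s. u (s, t)) has_vector_derivative F (s, t, u (s, t))) (at s)"
  shows "continuous_on ({-e<..<e} \<times> P) u"
proof -
  have *: "\<exists>d>0. \<forall>s\<in>{-e<..<e}. \<forall>t\<in>P. dist (s, t) (s0, t0) < d \<longrightarrow> dist (u (s, t)) (u (s0, t0)) < \<epsilon>"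
    if s0: "- e < s0" "s0 < e" and t0: "t0 \<in> P" and \<epsilon>: "\<epsilon> > 0" for s0 t0 \<epsilon>
  proof -
    define e' where "e' = (\<bar>s0\<bar> + e) / 2"
    have e': "0 \<le> e'" "e' < e" "\<bar>s0\<bar> < e'" using s0 by (auto simp: e'_def)
    have sub: "{-e'..e'} \<subseteq> {-e<..<e}" using e' by auto
    have eL': "e' * L \<le> 1/2" using mult_right_mono[of e' e L] e e' by linarith
    \<comment> \<open>Chosen so that the bound \<open>2 * (\<eta> + e' * \<eta>)\<close> equals
      \<open>\<epsilon> / 2\<close>.\<close>
    define \<eta> where "\<eta> = \<epsilon> / (4 * (1 + e'))"
    have \<eta>: "\<eta> > 0" using \<epsilon> e' by (simp add: \<eta>_def)
    have ucont: "continuous_on {-e<..<e} (\<lambda>s. u (s, t0))"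
      using der[OF _ t0] has_vector_derivative_continuous
      by (intro continuous_at_imp_continuous_on) blast
    have "continuous_on ({-e'..e'} \<times> P) (\<lambda>p. F (fst p, snd p, u (fst p, t0)))"
    proof (rule continuous_on_compose2[OF F])
      show "continuous_on ({-e'..e'} \<times> P) (\<lambda>p. (fst p, snd p, u (fst p, t0)))"
        using sub by (intro continuous_intros continuous_on_compose2[OF ucont]) auto
    qed (use sub uZ t0 in auto)
    then have "continuous_on ({-e'..e'} \<times> P) (\<lambda>(s, t). F (s, t, u (s, t0)))"
      by (simp add: case_prod_beta)
    from uniform_continuity_in_parameter[OF this P t0 \<eta>]
    obtain d1 where d1: "d1 > 0" "\<And>t. dist t t0 < d1 \<Longrightarrow> t \<in> P"
      "\<And>t s. dist t t0 < d1 \<Longrightarrow> s \<in> {-e'..e'} \<Longrightarrow> dist (F (s, t, u (s, t0))) (F (s, t0, u (s, t0))) < \<eta>"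
      by auto
    obtain d2 where d2: "d2 > 0" "\<And>t. t \<in> P \<Longrightarrow> dist t t0 < d2 \<Longrightarrow> dist (u0 t) (u0 t0) < \<eta>"
      using u0 t0 \<eta> unfolding continuous_on_iff by metis
    obtain d3 where d3: "d3 > 0" "\<And>s. s \<in> {-e<..<e} \<Longrightarrow> dist s s0 < d3 \<Longrightarrow> dist (u (s, t0)) (u (s0, t0)) < \<epsilon> / 2"
      using ucont s0 \<epsilon> unfolding continuous_on_iff
      by (metis greaterThanLessThan_iff half_gt_zero)
    have close: "norm (u (s, t) - u (s, t0)) \<le> \<epsilon> / 2"
      if s: "s \<in> {-e'..e'}" and t: "dist t t0 < min d1 d2" for s t
    proof -
      have tP: "t \<in> P" using d1 t by auto
      have "norm (u (s, t) - u (s, t0)) \<le> 2 * (\<eta> + e' * \<eta>)"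
      proof (rule small_interval_gronwall[where R = "\<lambda>s. u (s, t) - u (s, t0)", OF e'(1) e(1) eL' _ _ _ s])
        fix r assume r: "r \<in> {-e'..e'}"
        then have re: "r \<in> {-e<..<e}" using sub by blast
        show "((\<lambda>s. u (s, t) - u (s, t0)) has_vector_derivative F (r, t, u (r, t)) - F (r, t0, u (r, t0)))
            (at r within {-e'..e'})"
          by (intro has_vector_derivative_diff has_vector_derivative_at_within[OF der] re tP t0)
        have "norm (F (r, t, u (r, t)) - F (r, t, u (r, t0))) \<le> L * norm (u (r, t) - u (r, t0))"
          by (intro lip re tP uZ t0)
        moreover have "norm (F (r, t, u (r, t0)) - F (r, t0, u (r, t0))) \<le> \<eta>"
          using d1(3)[of t r] t r by (simp add: dist_norm)
        ultimately show "norm (F (r, t, u (r, t)) - F (r, t0, u (r, t0))) \<le> L * norm (u (r, t) - u (r, t0)) + \<eta>"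
          using norm_diff_triangle_le by blast
      next
        show "norm (u (0, t) - u (0, t0)) \<le> \<eta>"
          using d2(2)[OF tP] t init tP t0 by (simp add: dist_norm)
      qed
      also have "\<dots> = \<epsilon> / 2" using e' by (simp add: \<eta>_def divide_simps) (simp add: algebra_simps)
      finally show ?thesis .
    qed
    show ?thesis
    proof (intro exI[of _ "min (min d1 d2) (min d3 (e' - \<bar>s0\<bar>))"] conjI ballI impI)
      fix s t assume s: "s \<in> {-e<..<e}" and "t \<in> P" and d: "dist (s, t) (s0, t0) < min (min d1 d2) (min d3 (e' - \<bar>s0\<bar>))"
      have ds: "dist s s0 < min d3 (e' - \<bar>s0\<bar>)" and dt: "dist t t0 < min d1 d2"
        using d dist_fst_le[of "(s, t)" "(s0, t0)"] dist_snd_le[of "(s, t)" "(s0, t0)"] by auto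
      have "dist (u (s, t)) (u (s, t0)) \<le> \<epsilon> / 2"
        using ds by (intro order_trans[OF eq_refl[OF dist_norm] close[OF _ dt]])
          (auto simp: dist_real_def abs_if split: if_splits)
      moreover have "dist (u (s, t0)) (u (s0, t0)) < \<epsilon> / 2" using d3(2)[OF s] ds by auto
      ultimately show "dist (u (s, t)) (u (s0, t0)) < \<epsilon>"
        using dist_triangle[of "u (s, t)" "u (s0, t0)" "u (s, t0)"] by linarith
    qed (use d1 d2 d3 e' in auto)
  qed
  show ?thesis
    unfolding continuous_on_iff using * by (auto simp: Ball_def) (metis greaterThanLessThan_iff)
qed

text \<open>In the step from \<open>k\<close> to \<open>k + 1\<close> the linearized field
  \<open>G\<close> contains \<open>u\<close> itself. The induction hypothesis for the original
  equation makes \<open>u\<close>, hence \<open>G\<close>, of class \<open>C^k\<close>; the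
  induction hypothesis for the linearized equation gives the same for its solution \<open>w\<close>,
  the derivative of \<open>u\<close> in \<open>t\<close>. Therefore field, domain, interval, initial
  values and solution all vary in the induction. Bounding \<open>e * (L + 1)\<close> leaves room for
  the linearization error, which raises the constant \<open>L\<close> to \<open>L + \<eta>1\<close>
  with \<open>\<eta>1 \<le> 1\<close>.\<close>

theorem ode_parameter_Ck:
  fixes F :: "real \<times> real \<times> 'a::euclidean_space \<Rightarrow> 'a"
  assumes P: "open P" and e: "0 \<le> L" "e * (L + 1) \<le> 1/2"
    and "open Z" "Ck_on k ({-e<..<e} \<times> P \<times> Z) F"
    and "\<And>s t z z'. s \<in> {-e<..<e} \<Longrightarrow> t \<in> P \<Longrightarrow> z \<in> Z \<Longrightarrow> z' \<in> Z \<Longrightarrow>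
      norm (F (s, t, z) - F (s, t, z')) \<le> L * norm (z - z')"
    and "Ck_on k P u0"
    and "\<And>t. t \<in> P \<Longrightarrow> u (0, t) = u0 t"
    and "\<And>s t. s \<in> {-e<..<e} \<Longrightarrow> t \<in> P \<Longrightarrow> u (s, t) \<in> Z"
    and "\<And>s t. s \<in> {-e<..<e} \<Longrightarrow> t \<in> P \<Longrightarrow>
      ((\<lambda>s. u (s, t)) has_vector_derivative F (s, t, u (s, t))) (at s)"
  shows "Ck_on k ({-e<..<e} \<times> P) u"
  using assms(2-)
proof (induction k arbitrary: F Z e u0 u)
  case 0
  show ?case
  proof (cases "e \<le> 0")
    case False
    have "e * L \<le> 1/2" using False 0(2) by (simp add: algebra_simps)
    show ?thesis
      unfolding Ck_on.simps
      by (rule ode_parameter_continuous[OF P 0(1) \<open>e * L \<le> 1/2\<close> _ 0(5) _ 0(7,8,9)]) (use 0(4,6) in auto)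
  qed simp
next
  case (Suc k)
  note e = Suc.prems(1,2) and Z = Suc.prems(3) and F = Suc.prems(4) and lip = Suc.prems(5)
    and u0 = Suc.prems(6) and init = Suc.prems(7) and uZ = Suc.prems(8) and der = Suc.prems(9)
  let ?I = "{-e<..<e}"
  let ?O = "?I \<times> P \<times> Z"
  have oO: "open ?O" "open (?I \<times> P)" using P Z by (auto intro!: open_Times)
  have u_Ck: "Ck_on k (?I \<times> P) u"
    by (rule Suc.IH[OF e Z Ck_on_SucD[OF F] lip Ck_on_SucD[OF u0] init uZ der])
  define D where "D p v = frechet_derivative F (at p) v" for p v
  define U where "U s t = (s, t, u (s, t))" for s t
  have UO: "U s t \<in> ?O" if "s \<in> ?I" "t \<in> P" for s t using that uZ by (auto simp: U_def)
  have dF: "(F has_derivative D p) (at p)" if "p \<in> ?O" for p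
    using Ck_on_has_derivative[OF F that] unfolding D_def .
  have linD: "linear (D p)" if "p \<in> ?O" for p using dF[OF that] has_derivative_linear by blast
  \<comment> \<open>\<open>G (s, t, w)\<close> is the derivative of \<open>F\<close> at the solution
    in the direction \<open>(0, 1, w)\<close>. Over \<open>Basis\<close> it involves only
    derivatives in fixed directions, the ones that \<open>Ck_on\<close> controls.\<close>
  define G where "G p = D (U (fst p) (fst (snd p))) (0, 1, 0)
    + (\<Sum>b\<in>Basis. (snd (snd p) \<bullet> b) *\<^sub>R D (U (fst p) (fst (snd p))) (0, 0, b))" for p
  have D_G: "G (s, t, w) = D (U s t) (0, 1, w)" if "s \<in> ?I" "t \<in> P" for s t w
  proof -
    note l = linD[OF UO[OF that]]
    have "(\<Sum>b\<in>Basis. (w \<bullet> b) *\<^sub>R D (U s t) (0, 0, b)) = D (U s t) (\<Sum>b\<in>Basis. (w \<bullet> b) *\<^sub>R (0, 0, b))"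
      by (simp only: linear_sum[OF l] linear_scale[OF l])
    also have "(\<Sum>b\<in>Basis. (w \<bullet> b) *\<^sub>R (0, 0, b)) = (0::real, 0::real, w)"
      by (simp add: prod_eq_iff fst_sum snd_sum euclidean_representation)
    finally show ?thesis by (simp add: G_def flip: linear_add[OF l])
  qed
  have D_bound: "norm (D (U s t) (0, 0, w)) \<le> L * norm w" if "s \<in> ?I" "t \<in> P" for s t w
  proof (rule lipschitz_imp_derivative_bound[OF Z uZ[OF that]])
    have "((\<lambda>z. (s, t, z)) has_derivative (\<lambda>w. (0, 0, w))) (at (u (s, t)))"
      by (auto intro!: derivative_eq_intros)
    from has_derivative_compose[OF this dF[OF UO[OF that, unfolded U_def]]]
    show "((\<lambda>z. F (s, t, z)) has_derivative (\<lambda>w. D (U s t) (0, 0, w))) (at (u (s, t)))"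
      by (simp add: U_def)
  qed (use lip that uZ in auto)
  have G_Ck: "Ck_on k (?I \<times> P \<times> UNIV) G"
  proof -
    have o: "open (?I \<times> P \<times> (UNIV::'a set))" using P by (auto intro!: open_Times)
    have st: "Ck_on k (?I \<times> P \<times> UNIV) (\<lambda>p::real \<times> real \<times> 'a. fst p)"
      "Ck_on k (?I \<times> P \<times> UNIV) (\<lambda>p::real \<times> real \<times> 'a. fst (snd p))"
      "Ck_on k (?I \<times> P \<times> UNIV) (\<lambda>p::real \<times> real \<times> 'a. snd (snd p))"
      by (auto intro!: Ck_on_linear bounded_linear_intros bounded_linear_fst_comp bounded_linear_snd_comp)
    have "Ck_on k (?I \<times> P \<times> UNIV) (\<lambda>p::real \<times> real \<times> 'a. u (fst p, fst (snd p)))"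
      by (rule Ck_on_compose[OF o oO(2) _ Ck_on_Pair[OF o st(1,2)] u_Ck]) auto
    from Ck_on_Pair[OF o st(1) Ck_on_Pair[OF o st(2) this]]
    have U_Ck: "Ck_on k (?I \<times> P \<times> UNIV) (\<lambda>p::real \<times> real \<times> 'a. U (fst p) (fst (snd p)))"
      by (simp add: U_def)
    have "Ck_on k (?I \<times> P \<times> UNIV) (\<lambda>p::real \<times> real \<times> 'a. D (U (fst p) (fst (snd p))) v)" for v
      by (rule Ck_on_compose[OF o oO(1) _ U_Ck Ck_on_derivative[OF F, folded D_def]])
        (rule image_subsetI, rule UO, auto)
    then have "Ck_on k (?I \<times> P \<times> UNIV) (\<lambda>p::real \<times> real \<times> 'a. D (U (fst p) (fst (snd p))) (0, 1, 0)
        + (\<Sum>b\<in>Basis. (snd (snd p) \<bullet> b) *\<^sub>R D (U (fst p) (fst (snd p))) (0, 0, b)))"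
      by (intro Ck_on_add Ck_on_sum o bounded_bilinear.Ck_on[OF bounded_bilinear_scaleR]
          bounded_bilinear.Ck_on[OF bounded_bilinear_inner] Ck_on_const st)
    then show ?thesis by (simp add: G_def[abs_def])
  qed
  have G_lip: "norm (G (s, t, z) - G (s, t, z')) \<le> L * norm (z - z')" if "s \<in> ?I" "t \<in> P" for s t z z'
  proof -
    have "G (s, t, z) - G (s, t, z') = D (U s t) (0, 0, z - z')"
      unfolding D_G[OF that] by (simp flip: linear_diff[OF linD[OF UO[OF that]]])
    then show ?thesis using D_bound[OF that] by simp
  qed
  \<comment> \<open>A smaller \<open>e'\<close> provides a compact time interval inside the open
    one; \<open>Ck_on_local\<close> removes the restriction at the end.\<close>
  have main: "Ck_on (Suc k) ({-e'<..<e'} \<times> P) u" if e': "0 < e'" "e' < e" for e'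
  proof -
    let ?I' = "{-e'<..<e'}" and ?C = "{-e'..e'}"
    have CI: "?C \<subseteq> ?I" "?I' \<subseteq> ?C" using e' by auto
    have eL': "e' * (L + 1) \<le> 1/2" using mult_right_mono[of e' e "L + 1"] e e' by linarith
    then have eL: "e' * L \<le> 1/2" using e' by (simp add: algebra_simps)
    define du0 where "du0 t = frechet_derivative u0 (at t) 1" for t
    have du0: "(u0 has_vector_derivative du0 t) (at t)" if "t \<in> P" for t
    proof -
      note d = Ck_on_has_derivative[OF u0 that]
      have "frechet_derivative u0 (at t) = (\<lambda>h. h *\<^sub>R du0 t)"
      proof
        show "frechet_derivative u0 (at t) h = h *\<^sub>R du0 t" for h
          using linear_scale[OF has_derivative_linear[OF d], of h 1] by (simp add: du0_def)
      qed
      then show ?thesis using d by (simp add: has_vector_derivative_def)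
    qed
    have "\<exists>w. w 0 = du0 t \<and> (\<forall>s\<in>?C. (w has_vector_derivative G (s, t, w s)) (at s within ?C))"
      if t: "t \<in> P" for t
    proof -
      have "continuous_on (?C \<times> UNIV) (\<lambda>p. G (fst p, t, snd p))"
        by (rule continuous_on_compose2[OF Ck_on_imp_continuous_on[OF G_Ck]])
          (use CI t in \<open>auto intro!: continuous_intros\<close>)
      then have c: "continuous_on (?C \<times> UNIV) (\<lambda>(s, z). G (s, t, z))" by (simp add: case_prod_beta)
      have "norm (G (s, t, z) - G (s, t, z')) \<le> L * norm (z - z')" if "s \<in> ?C" for s z z'
        using that CI by (intro G_lip t) blast
      from picard_lindeloef_small_interval[OF e'(1) e(1) eL c this, of "du0 t"]
      obtain w where "w 0 = du0 t" "\<And>s. s \<in> ?C \<Longrightarrow> (w has_vector_derivative G (s, t, w s)) (at s within ?C)"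
        by metis
      then show ?thesis by blast
    qed
    then obtain w' where w': "\<And>t. t \<in> P \<Longrightarrow> w' t 0 = du0 t"
      "\<And>t s. t \<in> P \<Longrightarrow> s \<in> ?C \<Longrightarrow> (w' t has_vector_derivative G (s, t, w' t s)) (at s within ?C)"
      by metis
    define w where "w = (\<lambda>(s, t). w' t s)"
    have w: "w (0, t) = du0 t" "\<And>s. s \<in> ?C \<Longrightarrow> ((\<lambda>s. w (s, t)) has_vector_derivative G (s, t, w (s, t))) (at s within ?C)"
      if "t \<in> P" for t using w'[OF that] by (auto simp: w_def)
    have w_at: "((\<lambda>s. w (s, t)) has_vector_derivative G (s, t, w (s, t))) (at s)"
      if "s \<in> ?I'" "t \<in> P" for s t
    proof -
      have "((\<lambda>s. w (s, t)) has_vector_derivative G (s, t, w (s, t))) (at s within ?I')"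
        using w(2)[OF that(2), of s] that CI has_vector_derivative_within_subset by blast
      then show ?thesis using that at_within_open[of s ?I'] by simp
    qed
    have w_Ck: "Ck_on k (?I' \<times> P) w"
    proof (rule Suc.IH[OF e(1) eL' open_UNIV, of G du0])
      show "Ck_on k (?I' \<times> P \<times> UNIV) G" by (rule Ck_on_subset[OF G_Ck]) (use CI in auto)
      show "Ck_on k P du0" unfolding du0_def by (rule Ck_on_derivative[OF u0])
      show "norm (G (s, t, z) - G (s, t, z')) \<le> L * norm (z - z')"
        if "s \<in> ?I'" "t \<in> P" for s t z z'
        using that CI by (intro G_lip) blast+
    qed (rule w(1) w_at UNIV_I; assumption)+
    \<comment> \<open>So far \<open>w\<close> is only a candidate for the derivative. The remainder
      \<open>R\<close> of the first-order expansion in \<open>t\<close> satisfies a differential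
      inequality in \<open>s\<close>, and \<open>small_interval_gronwall\<close> makes it at most
      \<open>\<eta> * norm (t - t0)\<close>.\<close>
    have u_der: "((\<lambda>t. u (s, t)) has_vector_derivative w (s, t0)) (at t0)"
      if s: "s \<in> ?I'" and t0: "t0 \<in> P" for s t0
      unfolding has_vector_derivative_def has_derivative_at_alt
    proof (intro conjI allI impI bounded_linear_scaleR_left)
      fix \<eta> :: real assume \<eta>: "\<eta> > 0"
      have wc: "continuous_on ?C (\<lambda>s. w (s, t0))"
        using w(2)[OF t0] has_vector_derivative_continuous continuous_on_eq_continuous_within by blast
      obtain W where W: "\<And>s. s \<in> ?C \<Longrightarrow> norm (w (s, t0)) \<le> W"
      proof -
        have "bounded ((\<lambda>s. w (s, t0)) ` ?C)"
          using compact_continuous_image[OF wc] compact_imp_bounded by blast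
        then obtain a where "\<forall>s\<in>?C. norm (w (s, t0)) \<le> a" by (auto simp: bounded_iff)
        then show thesis by (intro that) blast
      qed
      have W0: "W \<ge> 0" using e' by (intro order_trans[OF norm_ge_zero W[of 0]]) auto
      \<comment> \<open>\<open>B\<close> collects the constants of the final estimate, which reads
        \<open>\<eta>1 * B * \<bar>t - t0\<bar>\<close>. Then \<open>\<eta>1\<close> is at most
        \<open>\<eta> / B\<close> for smallness, and at most 1 to stay within the slack in
        \<open>L + 1\<close>.\<close>
      define B where "B = 2 * (1 + e' * (1 + W))"
      have B: "B > 0" using e' W0 by (auto simp: B_def intro!: add_pos_nonneg)
      define \<eta>1 where "\<eta>1 = min 1 (\<eta> / B)"
      have \<eta>1: "\<eta>1 > 0" "\<eta>1 \<le> 1" "\<eta>1 * B \<le> \<eta>"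
        using \<eta> B by (auto simp: \<eta>1_def min_def divide_simps)
      have uc: "continuous_on (?I \<times> P) u" by (rule Ck_on_imp_continuous_on[OF u_Ck])
      have "continuous_on ?C (\<lambda>s. U s t0)"
        unfolding U_def using CI t0 by (intro continuous_intros continuous_on_compose2[OF uc]) auto
      then have K: "compact ((\<lambda>s. U s t0) ` ?C)" using compact_continuous_image by blast
      have KO: "(\<lambda>s. U s t0) ` ?C \<subseteq> ?O" using CI UO t0 by blast
      have F1: "Ck_on (Suc 0) ?O F" by (rule Ck_on_le[OF F]) simp
      obtain d1 where d1: "d1 > 0" "\<And>s h. s \<in> ?C \<Longrightarrow> norm h < d1 \<Longrightarrow>
          norm (F (U s t0 + h) - F (U s t0) - D (U s t0) h) \<le> \<eta>1 * norm h"
        using C1_uniform_linearization[OF oO(1) F1 K KO \<eta>1(1)] unfolding D_def by blast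
      have uC: "continuous_on (?C \<times> P) u" by (rule continuous_on_subset[OF uc Sigma_mono[OF CI(1) order_refl]])
      have "d1 / 2 > 0" using d1 by simp
      from uniform_continuity_in_parameter[OF uC P t0 this]
      obtain d2 where d2: "d2 > 0" "\<And>t. dist t t0 < d2 \<Longrightarrow> t \<in> P"
        "\<And>t s. dist t t0 < d2 \<Longrightarrow> s \<in> ?C \<Longrightarrow> dist (u (s, t)) (u (s, t0)) < d1 / 2" by blast
      obtain d3 where d3: "d3 > 0" "\<And>t. norm (t - t0) < d3 \<Longrightarrow>
          norm (u0 t - u0 t0 - (t - t0) *\<^sub>R du0 t0) \<le> \<eta>1 * norm (t - t0)"
        using du0[OF t0, unfolded has_vector_derivative_def has_derivative_at_alt] \<eta>1(1) by blast
      show "\<exists>d>0. \<forall>t. norm (t - t0) < d \<longrightarrow>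
          norm (u (s, t) - u (s, t0) - (t - t0) *\<^sub>R w (s, t0)) \<le> \<eta> * norm (t - t0)"
      proof (intro exI[of _ "min (d1 / 2) (min d2 d3)"] conjI allI impI)
        fix t assume t: "norm (t - t0) < min (d1 / 2) (min d2 d3)"
        then have tP: "t \<in> P" using d2(2) by (auto simp: dist_norm)
        define R where "R r = u (r, t) - u (r, t0) - (t - t0) *\<^sub>R w (r, t0)" for r
        have "norm (R s) \<le> 2 * (\<eta>1 * \<bar>t - t0\<bar> + e' * (\<eta>1 * (1 + W) * \<bar>t - t0\<bar>))"
        proof (rule small_interval_gronwall[of e' "L + \<eta>1" R])
          have "e' * (L + \<eta>1) \<le> e' * (L + 1)" using \<eta>1 e' by (intro mult_left_mono) auto
          then show "e' * (L + \<eta>1) \<le> 1/2" using eL' by linarith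
          show "norm (R 0) \<le> \<eta>1 * \<bar>t - t0\<bar>"
            using d3(2)[of t] t init[OF tP] init[OF t0] w(1)[OF t0] by (simp add: R_def)
          fix r assume r: "r \<in> ?C"
          then have rI: "r \<in> ?I" using CI by blast
          let ?h = "(0::real, t - t0, u (r, t) - u (r, t0))"
          let ?E = "F (U r t0 + ?h) - F (U r t0) - D (U r t0) ?h"
          \<comment> \<open>Since \<open>u (r, t) - u (r, t0)\<close> is \<open>R r\<close> plus
            \<open>t - t0\<close> times \<open>w (r, t0)\<close>, the linear part of the increment
            of \<open>F\<close> splits into the right-hand side of the equation for \<open>w\<close>
            and a term in \<open>R\<close>.\<close>
          have lin: "(t - t0) *\<^sub>R G (r, t0, w (r, t0)) + D (U r t0) (0, 0, R r) = D (U r t0) ?h"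
            unfolding D_G[OF rI t0]
            by (simp add: R_def flip: linear_scale[OF linD[OF UO[OF rI t0]]] linear_add[OF linD[OF UO[OF rI t0]]])
          have Uh: "U r t0 + ?h = U r t" by (simp add: U_def)
          show "(R has_vector_derivative ?E + D (U r t0) (0, 0, R r)) (at r within ?C)"
          proof -
            have "(R has_vector_derivative F (U r t) - F (U r t0) - (t - t0) *\<^sub>R G (r, t0, w (r, t0))) (at r within ?C)"
              unfolding R_def[abs_def] U_def
              by (intro has_vector_derivative_diff has_vector_derivative_at_within[OF der] rI tP t0
                  bounded_linear.has_vector_derivative[OF bounded_linear_scaleR_right] w(2) r)
            then show ?thesis unfolding Uh lin[symmetric] by simp
          qed
          have h1: "norm ?h \<le> \<bar>t - t0\<bar> + norm (u (r, t) - u (r, t0))"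
            using norm_Pair_le[of "0::real" "(t - t0, u (r, t) - u (r, t0))"]
              norm_Pair_le[of "t - t0" "u (r, t) - u (r, t0)"] by simp
          have "norm (u (r, t) - u (r, t0)) < d1 / 2" using d2(3)[OF _ r, of t] t by (simp add: dist_norm)
          then have hd: "norm ?h < d1" using h1 t by simp
          have "u (r, t) - u (r, t0) = R r + (t - t0) *\<^sub>R w (r, t0)" by (simp add: R_def)
          then have "norm (u (r, t) - u (r, t0)) \<le> norm (R r) + \<bar>t - t0\<bar> * norm (w (r, t0))"
            by (metis norm_scaleR norm_triangle_ineq)
          also have "\<dots> \<le> norm (R r) + \<bar>t - t0\<bar> * W" using W[OF r] by (intro add_left_mono mult_left_mono) auto
          finally have h2: "norm ?h \<le> norm (R r) + (1 + W) * \<bar>t - t0\<bar>" using h1 by (simp add: algebra_simps)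
          have "norm ?E \<le> \<eta>1 * norm ?h" by (rule d1(2)[OF r hd])
          also have "\<dots> \<le> \<eta>1 * (norm (R r) + (1 + W) * \<bar>t - t0\<bar>)" using h2 \<eta>1 by (intro mult_left_mono) auto
          finally have "norm ?E \<le> \<eta>1 * norm (R r) + \<eta>1 * (1 + W) * \<bar>t - t0\<bar>" by (simp add: algebra_simps)
          with D_bound[OF rI t0, of "R r"]
          show "norm (?E + D (U r t0) (0, 0, R r)) \<le> (L + \<eta>1) * norm (R r) + \<eta>1 * (1 + W) * \<bar>t - t0\<bar>"
            by (intro order_trans[OF norm_triangle_ineq]) (simp add: algebra_simps)
        qed (use e e' \<eta>1 s CI in auto)
        also have "\<dots> = (\<eta>1 * B) * \<bar>t - t0\<bar>" by (simp add: B_def algebra_simps)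
        also have "\<dots> \<le> \<eta> * norm (t - t0)" using \<eta>1(3) by (simp add: mult_right_mono)
        finally show "norm (u (s, t) - u (s, t0) - (t - t0) *\<^sub>R w (s, t0)) \<le> \<eta> * norm (t - t0)" by (simp add: R_def)
      qed (use d1 d2 d3 in auto)
    qed
    have o': "open (?I' \<times> P)" using P by (auto intro!: open_Times)
    \<comment> \<open>Partial derivatives give the joint one as soon as one of them is continuous;
      here this is \<open>w\<close>, known from \<open>w_Ck\<close>, while the
      \<open>s\<close>-derivative is used at the point alone.\<close>
    have total: "(u has_derivative (\<lambda>(a, b). a *\<^sub>R F (U (fst p) (snd p)) + b *\<^sub>R w p)) (at p)"
      if p: "p \<in> ?I' \<times> P" for p
    proof -
      obtain s t where st: "p = (s, t)" "s \<in> ?I'" "t \<in> P" using p by blast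
      obtain r where r: "r > 0" "ball t r \<subseteq> P" using P st openE by blast
      have "((\<lambda>(s, t). u (s, t)) has_derivative (\<lambda>(a, b). a *\<^sub>R F (U s t) + blinfun_scaleR_left (w (s, t)) b))
          (at (s, t) within ?I' \<times> ball t r)"
      proof (rule has_derivative_partialsI[where fy = "\<lambda>s t. blinfun_scaleR_left (w (s, t))"])
        show "((\<lambda>s. u (s, t)) has_derivative (\<lambda>a. a *\<^sub>R F (U s t))) (at s within ?I')"
        proof -
          have "s \<in> ?I" using st CI by blast
          from der[OF this st(3)] show ?thesis
            unfolding has_vector_derivative_def U_def by (rule has_derivative_at_withinI)
        qed
        show "((\<lambda>y. u (x, y)) has_derivative blinfun_apply (blinfun_scaleR_left (w (x, y)))) (at y within ball t r)"
          if xy: "x \<in> ?I'" "y \<in> ball t r" for x y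
        proof -
          have "y \<in> P" using xy r by blast
          from u_der[OF xy(1) this] show ?thesis
            unfolding has_vector_derivative_def blinfun_scaleR_left.rep_eq by (rule has_derivative_at_withinI)
        qed
        have "continuous_on (?I' \<times> ball t r) (\<lambda>p. blinfun_scaleR_left (w p))"
          by (intro bounded_linear.continuous_on[OF bounded_linear_blinfun_scaleR_left]
              continuous_on_subset[OF Ck_on_imp_continuous_on[OF w_Ck] Sigma_mono[OF order_refl r(2)]])
        then show "continuous (at (s, t) within ?I' \<times> ball t r) (\<lambda>(x, y). blinfun_scaleR_left (w (x, y)))"
          using st r by (simp add: continuous_on_eq_continuous_within case_prod_unfold)
      qed (use r in auto)
      moreover have "at (s, t) within ?I' \<times> ball t r = at (s, t)"
        using st r by (intro at_within_open) (auto intro!: open_Times)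
      ultimately show ?thesis by (simp add: st case_prod_beta)
    qed
    have U_Ck: "Ck_on k (?I' \<times> P) (\<lambda>p. F (U (fst p) (snd p)))"
    proof -
      have "Ck_on k (?I' \<times> P) u" by (rule Ck_on_subset[OF u_Ck]) (use CI in auto)
      then have "Ck_on k (?I' \<times> P) (\<lambda>p. (fst p, snd p, u p))"
        by (intro Ck_on_Pair o' Ck_on_linear[OF bounded_linear_fst] Ck_on_linear[OF bounded_linear_snd])
      then have "Ck_on k (?I' \<times> P) (\<lambda>p. U (fst p) (snd p))" by (simp add: U_def)
      then show ?thesis
        by (rule Ck_on_compose[OF o' oO(1) _ _ Ck_on_SucD[OF F], rotated])
          (rule image_subsetI, rule UO, use CI in auto)
    qed
    show ?thesis
    proof (rule Ck_on_SucI[OF o' total])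
      show "Ck_on k (?I' \<times> P) (\<lambda>p. (\<lambda>(a, b). a *\<^sub>R F (U (fst p) (snd p)) + b *\<^sub>R w p) v)" for v
        using U_Ck w_Ck by (cases v)
          (auto intro!: Ck_on_add o' bounded_bilinear.Ck_on[OF bounded_bilinear_scaleR])
    qed
  qed
  show ?case
  proof (rule Ck_on_local)
    fix p assume p: "p \<in> ?I \<times> P"
    define e' where "e' = (\<bar>fst p\<bar> + e) / 2"
    have e': "\<bar>fst p\<bar> < e'" "e' < e" using p by (auto simp: e'_def mem_Times_iff abs_less_iff)
    then have "p \<in> {-e'<..<e'} \<times> P" using p by (auto simp: mem_Times_iff)
    moreover have "Ck_on (Suc k) ({-e'<..<e'} \<times> P) u" using e' by (intro main) linarith+
    moreover have "open ({-e'<..<e'} \<times> P)" using P by (intro open_Times) auto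
    ultimately show "\<exists>T. open T \<and> p \<in> T \<and> Ck_on (Suc k) T u" by blast
  qed
qed

theorem ode_smooth_solution_family:
  fixes f :: "'a::euclidean_space \<Rightarrow> 'a" and u0 :: "real \<Rightarrow> 'a"
  assumes U: "open U" and f: "smooth_on U f" and u0: "smooth_on UNIV u0" and q: "u0 0 \<in> U"
  obtains e u where "e > 0" "smooth_on ({-e<..<e} \<times> {-e<..<e}) u"
    "\<And>t. t \<in> {-e<..<e} \<Longrightarrow> u (0, t) = u0 t"
    "\<And>s t. s \<in> {-e<..<e} \<Longrightarrow> t \<in> {-e<..<e} \<Longrightarrow> u (s, t) \<in> U"
    "\<And>s t. s \<in> {-e<..<e} \<Longrightarrow> t \<in> {-e<..<e} \<Longrightarrow>
      ((\<lambda>s. u (s, t)) has_vector_derivative f (u (s, t))) (at s)"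
proof -
  obtain r where r: "r > 0" "cball (u0 0) r \<subseteq> U" using U q open_contains_cball by blast
  let ?K = "cball (u0 0) r"
  have K: "compact ?K" "convex ?K" "closed ?K" "?K \<noteq> {}" using r by auto
  have f1: "Ck_on (Suc 0) U f" and fc: "Ck_on 0 U f" using f unfolding smooth_on_def by blast+
  obtain L where L: "L \<ge> 0" "\<And>x y. x \<in> ?K \<Longrightarrow> y \<in> ?K \<Longrightarrow> norm (f x - f y) \<le> L * norm (x - y)"
    using C1_lipschitz_on_compact_convex[OF f1 K(1,2) r(2)] by metis
  have fK: "continuous_on ?K f" using fc r continuous_on_subset by auto
  then have "bounded (f ` ?K)" using compact_imp_bounded[OF compact_continuous_image[OF _ K(1)]] by blast
  then obtain M where M: "\<And>x. x \<in> ?K \<Longrightarrow> norm (f x) \<le> M" unfolding bounded_iff by blast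
  have M0: "M \<ge> 0" using r(1) by (intro order_trans[OF norm_ge_zero M[of "u0 0"]]) simp
  have "continuous_on UNIV u0" using u0 unfolding smooth_on_def by (metis Ck_on.simps(1))
  then obtain d where d: "d > 0" "\<And>t. \<bar>t\<bar> < d \<Longrightarrow> norm (u0 t - u0 0) < r / 2"
    using r(1) unfolding continuous_on_iff dist_norm by (metis UNIV_I diff_zero half_gt_zero real_norm_def)
  \<comment> \<open>The first bound yields \<open>e' * (L + 1) \<le> 1/2\<close>. The second lets a
    solution of speed at most \<open>M\<close> move by at most \<open>r / 2\<close>; the other half
    of the radius is left for the variation of the initial value.\<close>
  define e' where "e' = min (1 / (2 * (L + 1))) (r / (2 * (M + 1)))"
  have e'_le: "e' \<le> 1 / (2 * (L + 1))" "e' \<le> r / (2 * (M + 1))" by (auto simp: e'_def)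
  have "e' * (2 * (L + 1)) \<le> 1" "e' * (2 * (M + 1)) \<le> r"
    using e'_le L(1) M0 pos_le_divide_eq[of "2 * (L + 1)" e' 1] pos_le_divide_eq[of "2 * (M + 1)" e' r] by auto
  moreover have "e' > 0" using L(1) M0 r(1) by (simp add: e'_def)
  ultimately have e': "e' > 0" "e' * (L + 1) \<le> 1/2" "e' * (M + 1) \<le> r / 2" by (auto simp: algebra_simps)
  have e'L: "e' * L \<le> 1/2" using e' by (simp add: algebra_simps)
  text \<open>Composition with the nearest-point projection makes the field globally Lipschitz without
    changing it near the initial values.\<close>
  define fh where "fh z = f (closest_point ?K z)" for z
  have inK: "closest_point ?K z \<in> ?K" for z by (rule closest_point_in_set[OF K(3,4)])
  have fh_lip: "norm (fh z - fh z') \<le> L * norm (z - z')" for z z'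
  proof -
    have "norm (fh z - fh z') \<le> L * norm (closest_point ?K z - closest_point ?K z')"
      unfolding fh_def by (intro L(2) inK)
    also have "\<dots> \<le> L * norm (z - z')"
      using closest_point_lipschitz[OF K(2,3,4), of z z'] L(1) by (intro mult_left_mono) (auto simp: dist_norm)
    finally show ?thesis .
  qed
  have fh_cont: "continuous_on ({-e'..e'} \<times> UNIV) (\<lambda>(s, z). fh z)"
    unfolding fh_def case_prod_unfold
    by (intro continuous_on_compose2[OF fK] continuous_on_compose2[OF continuous_on_closest_point[OF K(2,3,4), of UNIV]]
        continuous_intros) (use inK in auto)
  have "\<exists>w. w 0 = u0 t \<and> (\<forall>s\<in>{-e'..e'}. (w has_vector_derivative fh (w s)) (at s within {-e'..e'}))" for t
    using picard_lindeloef_small_interval[OF e'(1) L(1) e'L fh_cont, of "u0 t"] fh_lip by metis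
  then obtain w where w0: "\<And>t. w t 0 = u0 t"
    and w_der: "\<And>t s. s \<in> {-e'..e'} \<Longrightarrow> (w t has_vector_derivative fh (w t s)) (at s within {-e'..e'})"
    by metis
  define e where "e = min d e'"
  have e: "e > 0" "e \<le> d" "e \<le> e'" using d e' by (auto simp: e_def)
  let ?I = "{-e<..<e}"
  define u where "u = (\<lambda>(s, t). w t s)"
  have uB: "u (s, t) \<in> ball (u0 0) r" if "s \<in> ?I" "t \<in> ?I" for s t
  proof -
    have s: "s \<in> {-e'..e'}" using that e by auto
    have "norm (w t s - w t 0) \<le> M * norm (s - 0)"
    proof (rule differentiable_bound[OF convex_real_interval(5)[of "-e'" e'] w_der[unfolded has_vector_derivative_def]])
      show "onorm (\<lambda>h. h *\<^sub>R fh (w t x)) \<le> M" for x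
        by (rule onorm_scaleR_le) (simp add: fh_def M[OF inK])
    qed (use s e' in auto)
    also have "\<dots> \<le> M * e'" using s M0 by (intro mult_left_mono) auto
    also have "\<dots> \<le> r / 2" using e' M0 by (simp add: algebra_simps)
    finally have "norm (w t s - u0 t) \<le> r / 2" by (simp add: w0)
    moreover have "norm (u0 t - u0 0) < r / 2" using d(2) that e by auto
    ultimately have "norm (w t s - u0 0) < r" using norm_triangle_ineq[of "w t s - u0 t" "u0 t - u0 0"] by simp
    then show ?thesis by (simp add: u_def dist_norm norm_minus_commute)
  qed
  have u_der: "((\<lambda>s. u (s, t)) has_vector_derivative f (u (s, t))) (at s)" if "s \<in> ?I" "t \<in> ?I" for s t
  proof -
    have "(w t has_vector_derivative fh (w t s)) (at s within ?I)"
      by (rule has_vector_derivative_within_subset[OF w_der]) (use that e in auto)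
    then have "(w t has_vector_derivative fh (w t s)) (at s)" using that at_within_open[of s ?I] by simp
    moreover have "w t s \<in> ?K" using uB[OF that] by (simp add: u_def)
    ultimately show ?thesis by (simp add: u_def fh_def closest_point_self)
  qed
  \<comment> \<open>The projected field is only Lipschitz. Regularity is therefore drawn from
    \<open>f\<close> itself on the open ball, where the solutions remain and both fields
    agree.\<close>
  have "Ck_on k (?I \<times> ?I) u" for k
  proof (rule ode_parameter_Ck[where F = "\<lambda>p. f (snd (snd p))" and Z = "ball (u0 0) r" and L = L and ?u0.0 = u0])
    show "e * (L + 1) \<le> 1/2" using mult_right_mono[OF e(3), of "L + 1"] e'(2) L(1) by linarith
    have "open (?I \<times> ?I \<times> ball (u0 0) r)" by (intro open_Times) auto
    then show "Ck_on k (?I \<times> ?I \<times> ball (u0 0) r) (\<lambda>p. f (snd (snd p)))"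
    proof (rule Ck_on_compose[where f = "\<lambda>p. snd (snd p)" and g = f, OF _ U])
      show "(\<lambda>p. snd (snd p)) ` (?I \<times> ?I \<times> ball (u0 0) r) \<subseteq> U" using r(2) by auto
      show "Ck_on k (?I \<times> ?I \<times> ball (u0 0) r) (\<lambda>p. snd (snd p))"
        by (rule Ck_on_linear[OF bounded_linear_snd_comp[OF bounded_linear_snd]])
      show "Ck_on k U f" using f by (simp add: smooth_on_def)
    qed
    show "Ck_on k ?I u0" using u0 Ck_on_subset unfolding smooth_on_def by blast
    show "norm (f (snd (snd (s, t, z))) - f (snd (snd (s, t, z')))) \<le> L * norm (z - z')"
      if "z \<in> ball (u0 0) r" "z' \<in> ball (u0 0) r" for s t :: real and z z'
      using L(2)[of z z'] that by simp
    show "((\<lambda>s. u (s, t)) has_vector_derivative f (snd (snd (s, t, u (s, t))))) (at s)"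
      if "s \<in> ?I" "t \<in> ?I" for s t using u_der[OF that] by simp
  qed (use L(1) uB in \<open>auto simp: u_def w0\<close>)
  then have "smooth_on (?I \<times> ?I) u" by (simp add: smooth_on_def)
  moreover have "u (s, t) \<in> U" if "s \<in> ?I" "t \<in> ?I" for s t
    using uB[OF that] r(2) by auto
  ultimately show thesis using that[of e u] e(1) u_der by (simp add: u_def w0)
qed

section \<open>Tangent vectors and Christoffel symbols\<close>

lemma linear_eq_on_axis:
  fixes f h :: "real ^ 'n \<Rightarrow> 'b::real_vector"
  assumes "linear f" "linear h" "\<And>i. f (axis i 1) = h (axis i 1)"
  shows "f v = h v"
  using linear_eq_stdbasis[OF assms(1,2)] assms(3) by (auto simp: Basis_vec_def)

text \<open>Product rule for a derivative applied to a moving vector at a moving point; the first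
  summand is the second derivative of \<open>T\<close>. It is used with \<open>T\<close> a
  transition map and with \<open>T\<close> a map read in a chart.\<close>

lemma has_derivative_frechet_apply:
  fixes T :: "'b::euclidean_space \<Rightarrow> 'c::real_normed_vector" and f Y :: "'a::real_normed_vector \<Rightarrow> 'b"
  assumes "open R" "Ck_on (Suc (Suc 0)) R T" "f u \<in> R"
    and f: "(f has_derivative f') (at u)" and Y: "(Y has_derivative Y') (at u)"
  shows "((\<lambda>w. frechet_derivative T (at (f w)) (Y w)) has_derivative
    (\<lambda>a. frechet_derivative (\<lambda>z. frechet_derivative T (at z) (Y u)) (at (f u)) (f' a)
      + frechet_derivative T (at (f u)) (Y' a))) (at u)"
proof -
  let ?D = "\<lambda>z b. frechet_derivative T (at z) b"
  let ?H = "\<lambda>b. frechet_derivative (\<lambda>z. ?D z b) (at (f u))"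
  have lin: "linear (?D z)" if "z \<in> R" for z
    using Ck_on_has_derivative[OF assms(2) that] has_derivative_linear by blast
  have exp: "?D z v = (\<Sum>b\<in>Basis. (v \<bullet> b) *\<^sub>R ?D z b)" if "z \<in> R" for z v
  proof -
    have "?D z v = ?D z (\<Sum>b\<in>Basis. (v \<bullet> b) *\<^sub>R b)" by (simp add: euclidean_representation)
    also have "\<dots> = (\<Sum>b\<in>Basis. (v \<bullet> b) *\<^sub>R ?D z b)" by (simp only: linear_sum[OF lin[OF that]] linear_scale[OF lin[OF that]])
    finally show ?thesis .
  qed
  have dD: "((\<lambda>z. ?D z b) has_derivative ?H b) (at (f u))" for b
    using Ck_on_has_derivative[OF Ck_on_derivative[OF assms(2)] assms(3)] .
  have dS: "((\<lambda>z. \<Sum>b\<in>Basis. (v \<bullet> b) *\<^sub>R ?D z b) has_derivative (\<lambda>h. \<Sum>b\<in>Basis. (v \<bullet> b) *\<^sub>R ?H b h)) (at (f u))" for v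
    by (intro has_derivative_sum bounded_linear.has_derivative[OF bounded_linear_scaleR_right] dD)
  \<comment> \<open>Linearity of the second derivative in its vector slot, which has to be proved
    because the derivative is formed for each fixed vector separately.\<close>
  have Hexp: "?H v = (\<lambda>h. \<Sum>b\<in>Basis. (v \<bullet> b) *\<^sub>R ?H b h)" for v
    by (rule has_derivative_unique[OF dD has_derivative_transform_within_open[OF dS assms(1,3)]])
      (rule exp[symmetric])
  have "((\<lambda>w. \<Sum>b\<in>Basis. (Y w \<bullet> b) *\<^sub>R ?D (f w) b) has_derivative
      (\<lambda>a. \<Sum>b\<in>Basis. (Y u \<bullet> b) *\<^sub>R ?H b (f' a) + (Y' a \<bullet> b) *\<^sub>R ?D (f u) b)) (at u)"
    by (intro has_derivative_sum has_derivative_scaleR has_derivative_compose[OF f dD]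
        bounded_linear.has_derivative[OF bounded_linear_inner_left Y])
  moreover have "(\<Sum>b\<in>Basis. (Y u \<bullet> b) *\<^sub>R ?H b (f' a) + (Y' a \<bullet> b) *\<^sub>R ?D (f u) b) = ?H (Y u) (f' a) + ?D (f u) (Y' a)" for a
    unfolding exp[OF assms(3), of "Y' a"] fun_cong[OF Hexp[of "Y u"], of "f' a"] by (rule sum.distrib)
  ultimately have *: "((\<lambda>w. \<Sum>b\<in>Basis. (Y w \<bullet> b) *\<^sub>R ?D (f w) b) has_derivative
      (\<lambda>a. ?H (Y u) (f' a) + ?D (f u) (Y' a))) (at u)" by simp
  have "\<forall>\<^sub>F w in at u. f w \<in> R"
    using has_derivative_continuous[OF f] assms(1,3) unfolding continuous_within by (rule topological_tendstoD)
  then have "\<forall>\<^sub>F w in at u. (\<Sum>b\<in>Basis. (Y w \<bullet> b) *\<^sub>R ?D (f w) b) = ?D (f w) (Y w)"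
    by eventually_elim (rule exp[symmetric])
  then show ?thesis
    by (rule has_derivative_transform_eventually[OF *]) (rule exp[OF assms(3), symmetric], simp)
qed

section \<open>Charts and tangent spaces\<close>

lemma tangent_spaceI:
  assumes "\<And>c. c \<notin> charts_at A p \<Longrightarrow> v c = 0"
    and "\<And>c d. c \<in> charts_at A p \<Longrightarrow> d \<in> charts_at A p \<Longrightarrow>
      v d = frechet_derivative (transition c d) (at (snd c p)) (v c)"
  shows "v \<in> tangent_space A p"
  unfolding tangent_space_def using assms by blast

lemma tangent_space_outside: "v \<in> tangent_space A p \<Longrightarrow> c \<notin> charts_at A p \<Longrightarrow> v c = 0"
  unfolding tangent_space_def by blast

lemma tangent_space_transition:
  "v \<in> tangent_space A p \<Longrightarrow> c \<in> charts_at A p \<Longrightarrow> d \<in> charts_at A p \<Longrightarrow>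
    v d = frechet_derivative (transition c d) (at (snd c p)) (v c)"
  unfolding tangent_space_def by blast

context smooth_manifold
begin

lemma domain_subset: "c \<in> A \<Longrightarrow> fst c \<subseteq> topspace X"
  using covering by auto

lemma chart_inj: "c \<in> A \<Longrightarrow> inj_on (snd c) (fst c)"
  using homeomorphic_imp_injective_map[OF homeomorphism] domain_subset by (simp add: Int_absorb1)

lemma chart_inv: "c \<in> A \<Longrightarrow> p \<in> fst c \<Longrightarrow> inv_into (fst c) (snd c) (snd c p) = p"
  using chart_inj by (rule inv_into_f_f)

lemma transition_chart: "c \<in> A \<Longrightarrow> p \<in> fst c \<Longrightarrow> transition c d (snd c p) = snd d p"
  by (simp add: transition_def chart_inv)

lemma open_overlap:
  assumes "c \<in> A" "d \<in> A"
  shows "open (snd c ` (fst c \<inter> fst d))"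
proof -
  have "openin (subtopology X (fst c)) (fst c \<inter> fst d)"
    using open_domain[OF assms(2)] by (auto simp: openin_subtopology Int_commute)
  then have "openin (top_of_set (snd c ` fst c)) (snd c ` (fst c \<inter> fst d))"
    using homeomorphic_imp_open_map[OF homeomorphism[OF assms(1)]] by (auto simp: open_map_def)
  then show ?thesis using open_image[OF assms(1)] by (simp add: openin_open_eq)
qed

lemma charts_atD: "c \<in> charts_at A p \<Longrightarrow> c \<in> A" "c \<in> charts_at A p \<Longrightarrow> p \<in> fst c"
  by (auto simp: charts_at_def)

lemma overlap_mem: "c \<in> charts_at A p \<Longrightarrow> d \<in> charts_at A p \<Longrightarrow> snd c p \<in> snd c ` (fst c \<inter> fst d)"
  by (auto simp: charts_at_def)

lemma transition_has_derivative:
  assumes "c \<in> charts_at A p" "d \<in> charts_at A p"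
  shows "(transition c d has_derivative frechet_derivative (transition c d) (at (snd c p))) (at (snd c p))"
  using smooth_on_has_derivative[OF smooth_transition overlap_mem[OF assms]] assms by (auto simp: charts_at_def)

lemma transition_derivative_inverse:
  assumes c: "c \<in> charts_at A p" and d: "d \<in> charts_at A p"
  shows "frechet_derivative (transition d c) (at (snd d p)) (frechet_derivative (transition c d) (at (snd c p)) v) = v"
proof -
  have e: "transition c d (snd c p) = snd d p" using c by (simp add: transition_chart charts_at_def)
  have 1: "((\<lambda>y. transition d c (transition c d y)) has_derivative
     (\<lambda>v. frechet_derivative (transition d c) (at (snd d p)) (frechet_derivative (transition c d) (at (snd c p)) v))) (at (snd c p))"
    by (rule has_derivative_compose[OF transition_has_derivative[OF c d]])
      (simp add: e transition_has_derivative[OF d c])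
  have 2: "transition d c (transition c d y) = y" if "y \<in> snd c ` (fst c \<inter> fst d)" for y
    using that c d by (auto simp: transition_chart charts_at_def)
  have "open (snd c ` (fst c \<inter> fst d))" using open_overlap c d by (auto simp: charts_at_def)
  from has_derivative_transform_within_open[OF 1 this overlap_mem[OF c d] 2]
  have "((\<lambda>y. y) has_derivative
     (\<lambda>v. frechet_derivative (transition d c) (at (snd d p)) (frechet_derivative (transition c d) (at (snd c p)) v))) (at (snd c p))"
    by simp
  from has_derivative_unique[OF this has_derivative_ident] show ?thesis by meson
qed

text \<open>Reduces identities between tangent vectors to a single chart: the transition derivatives
  fix the components in the other charts at \<open>p\<close>, and the remaining components are 0 by
  convention.\<close>

lemma tangent_eqI:
  assumes "v \<in> tangent_space A p" "w \<in> tangent_space A p" "c \<in> charts_at A p" "v c = w c"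
  shows "v = w"
proof
  show "v d = w d" for d
  proof (cases "d \<in> charts_at A p")
    case True
    show ?thesis
      unfolding tangent_space_transition[OF assms(1,3) True] tangent_space_transition[OF assms(2,3) True] assms(4) ..
  qed (simp add: tangent_space_outside[OF assms(1)] tangent_space_outside[OF assms(2)])
qed

lemma smooth_map_open: "smooth_map X A W F \<Longrightarrow> c \<in> A \<Longrightarrow> open {u \<in> W. F u \<in> fst c}"
  using openin_continuous_map_preimage[OF _ open_domain, of "top_of_set W" F c]
  by (simp add: smooth_map_def openin_open_eq)

lemma smooth_map_chart: "smooth_map X A W F \<Longrightarrow> c \<in> A \<Longrightarrow> smooth_on {u \<in> W. F u \<in> fst c} (snd c \<circ> F)"
  by (simp add: smooth_map_def)

lemma smooth_map_has_derivative:
  assumes "smooth_map X A W F" "u \<in> W" "c \<in> charts_at A (F u)"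
  shows "(snd c \<circ> F has_derivative (\<lambda>a. differential A F u a c)) (at u)"
  using smooth_on_has_derivative[OF smooth_map_chart[OF assms(1) charts_atD(1)[OF assms(3)]], of u] assms
  by (simp add: differential_def charts_at_def)

lemma differential_tangent:
  assumes F: "smooth_map X A W F" and u: "u \<in> W"
  shows "differential A F u a \<in> tangent_space A (F u)"
proof -
  have "differential A F u a d = frechet_derivative (transition c d) (at (snd c (F u))) (differential A F u a c)"
    if c: "c \<in> charts_at A (F u)" and d: "d \<in> charts_at A (F u)" for c d
  proof -
    have "((\<lambda>w. transition c d ((snd c \<circ> F) w)) has_derivative
        (\<lambda>a. frechet_derivative (transition c d) (at (snd c (F u))) (differential A F u a c))) (at u)"
      by (rule has_derivative_compose[OF smooth_map_has_derivative[OF F u c]])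
        (simp add: transition_has_derivative[OF c d])
    moreover have "transition c d ((snd c \<circ> F) w) = (snd d \<circ> F) w" if "w \<in> {w \<in> W. F w \<in> fst c}" for w
      using that c by (simp add: transition_chart charts_at_def)
    moreover have "open {w \<in> W. F w \<in> fst c}" "u \<in> {w \<in> W. F w \<in> fst c}"
      using smooth_map_open[OF F] c u by (auto simp: charts_at_def)
    ultimately have "(snd d \<circ> F has_derivative
        (\<lambda>a. frechet_derivative (transition c d) (at (snd c (F u))) (differential A F u a c))) (at u)"
      using has_derivative_transform_within_open by blast
    from has_derivative_unique[OF smooth_map_has_derivative[OF F u d] this] show ?thesis by meson
  qed
  moreover have "differential A F u a c = 0" if "c \<notin> charts_at A (F u)" for c
    using that by (simp add: differential_def)
  ultimately show ?thesis by (intro tangent_spaceI) blast+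
qed

lemma linear_transition_derivative:
  "c \<in> charts_at A p \<Longrightarrow> d \<in> charts_at A p \<Longrightarrow> linear (frechet_derivative (transition c d) (at (snd c p)))"
  by (rule has_derivative_linear[OF transition_has_derivative])

lemma tangent_lincomb:
  assumes "v \<in> tangent_space A p" "w \<in> tangent_space A p"
  shows "(\<lambda>c. a *\<^sub>R v c + b *\<^sub>R w c) \<in> tangent_space A p"
proof (rule tangent_spaceI)
  fix c d assume cd: "c \<in> charts_at A p" "d \<in> charts_at A p"
  note l = linear_transition_derivative[OF cd]
  show "a *\<^sub>R v d + b *\<^sub>R w d = frechet_derivative (transition c d) (at (snd c p)) (a *\<^sub>R v c + b *\<^sub>R w c)"
    unfolding tangent_space_transition[OF assms(1) cd] tangent_space_transition[OF assms(2) cd]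
      linear_add[OF l] linear_scale[OF l] ..
qed (simp add: tangent_space_outside[OF assms(1)] tangent_space_outside[OF assms(2)])

lemma tangent_zero: "(\<lambda>c. 0) \<in> tangent_space A p"
  by (rule tangent_spaceI) (simp_all add: linear_0[OF linear_transition_derivative])

lemma charts_at_nonempty: "p \<in> topspace X \<Longrightarrow> \<exists>c. c \<in> charts_at A p"
  unfolding charts_at_def using covering by blast

end

section \<open>Christoffel symbols as a symmetric bilinear form compatible with the metric\<close>

definition christoffel_form :: "('m, 'n::finite) metric_coeffs \<Rightarrow> ('m, 'n) chart \<Rightarrow> 'm \<Rightarrow> real^'n \<Rightarrow> real^'n \<Rightarrow> real^'n" where
  "christoffel_form g c p v w = (\<chi> k. \<Sum>i\<in>UNIV. \<Sum>j\<in>UNIV. christoffel g c p k i j * v $ i * w $ j)"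

lemma linear_christoffel_form_left: "linear (\<lambda>v. christoffel_form g c p v w)"
  by (rule linearI) (simp_all add: christoffel_form_def vec_eq_iff algebra_simps sum.distrib sum_distrib_left)

lemma linear_christoffel_form_right: "linear (christoffel_form g c p v)"
  by (rule linearI) (simp_all add: christoffel_form_def vec_eq_iff algebra_simps sum.distrib sum_distrib_left)

lemma christoffel_form_axis: "christoffel_form g c p (axis i 1) (axis j 1) $ k = christoffel g c p k i j"
proof -
  have "christoffel g c p k i' j' * axis i 1 $ i' * axis j 1 $ j' =
      (if i' = i then if j' = j then christoffel g c p k i' j' else 0 else 0)" for i' j'
    by (simp add: axis_def)
  moreover have "(\<Sum>j'\<in>UNIV. if i' = i then if j' = j then christoffel g c p k i' j' else 0 else 0) =
      (if i' = i then christoffel g c p k i' j else 0)" for i'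
    by (cases "i' = i") simp_all
  ultimately show ?thesis by (simp add: christoffel_form_def)
qed

lemma cov_deriv_chart:
  "c \<in> charts_at A (F u) \<Longrightarrow> cov_deriv A g F Y u a c =
    frechet_derivative (\<lambda>w. Y w c) (at u) a + christoffel_form g c (F u) (differential A F u a c) (Y u c)"
  by (simp add: cov_deriv_def christoffel_form_def)

context riemannian_manifold
begin

abbreviation "lm \<equiv> local_metric g"

lemma local_metric_chart: "c \<in> A \<Longrightarrow> p \<in> fst c \<Longrightarrow> lm c (snd c p) = g c p"
  by (simp add: local_metric_def chart_inv)

lemma local_metric_has_derivative:
  "c \<in> A \<Longrightarrow> p \<in> fst c \<Longrightarrow> (lm c has_derivative frechet_derivative (lm c) (at (snd c p))) (at (snd c p))"
  using smooth_on_has_derivative[OF metric_smooth, of c "snd c p"] by auto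

lemma metric_deriv_eq:
  assumes "c \<in> A" "p \<in> fst c"
  shows "metric_deriv g c p k i j = frechet_derivative (lm c) (at (snd c p)) (axis k 1) $ i $ j"
proof -
  have "((\<lambda>y. lm c y $ i $ j) has_derivative (\<lambda>h. frechet_derivative (lm c) (at (snd c p)) h $ i $ j)) (at (snd c p))"
    by (intro bounded_linear.has_derivative[OF bounded_linear_vec_nth] local_metric_has_derivative assms)
  from fun_cong[OF frechet_derivative_at[OF this], of "axis k 1"] show ?thesis by (simp add: metric_deriv_def)
qed

lemma christoffel_form_sym: "c \<in> A \<Longrightarrow> p \<in> fst c \<Longrightarrow> christoffel_form g c p v w = christoffel_form g c p w v"
proof -
  assume "c \<in> A" "p \<in> fst c"
  then have *: "christoffel g c p k i j = christoffel g c p k j i" for k i j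
    using christoffel_unique[of c p "christoffel g c p"] by blast
  have "(\<Sum>i\<in>UNIV. \<Sum>j\<in>UNIV. christoffel g c p k i j * v $ i * w $ j) =
      (\<Sum>i\<in>UNIV. \<Sum>j\<in>UNIV. christoffel g c p k i j * w $ i * v $ j)" for k
  proof (subst sum.swap, intro sum.cong refl)
    show "christoffel g c p k j i * v $ j * w $ i = christoffel g c p k i j * w $ i * v $ j" for i j
      using *[of k i j] by simp
  qed
  then show "christoffel_form g c p v w = christoffel_form g c p w v" by (simp add: christoffel_form_def)
qed

text \<open>Both sides of the vector identity are linear in each of \<open>h\<close>,
  \<open>v\<close> and \<open>w\<close>, so it suffices to test it on the coordinate basis, where it
  becomes the index identity of \<open>christoffel_unique\<close>.\<close>

lemma metric_compatible_iff:
  fixes B :: "real^'n \<Rightarrow> real^'n \<Rightarrow> real^'n"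
  assumes c: "c \<in> A" "p \<in> fst c" and B: "\<And>w. linear (\<lambda>v. B v w)" "\<And>v. linear (B v)"
  defines "\<Gamma> \<equiv> \<lambda>k i j. B (axis i 1) (axis j 1) $ k"
  shows "(\<forall>h v w. v \<bullet> (frechet_derivative (lm c) (at (snd c p)) h *v w) =
      B h v \<bullet> (g c p *v w) + v \<bullet> (g c p *v B h w)) \<longleftrightarrow>
    (\<forall>k i j. metric_deriv g c p k i j = (\<Sum>l\<in>UNIV. \<Gamma> l k i * g c p $ l $ j + \<Gamma> l k j * g c p $ i $ l))"
proof -
  let ?D = "frechet_derivative (lm c) (at (snd c p))"
  let ?L = "\<lambda>h v w. v \<bullet> (?D h *v w)" and ?R = "\<lambda>h v w. B h v \<bullet> (g c p *v w) + v \<bullet> (g c p *v B h w)"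
  have linD: "linear ?D" by (rule has_derivative_linear[OF local_metric_has_derivative[OF c]])
  have ax: "axis i 1 \<bullet> (M *v axis j 1) = M $ i $ j" for M :: "real^'n^'n" and i j
    by (simp add: matrix_vector_mult_basis inner_axis' column_def)
  have ax2: "v \<bullet> (g c p *v axis j 1) = (\<Sum>l\<in>UNIV. v $ l * g c p $ l $ j)" for v j
    by (simp add: matrix_vector_mult_basis column_def inner_vec_def)
  have ax3: "axis i 1 \<bullet> (g c p *v v) = (\<Sum>l\<in>UNIV. v $ l * g c p $ i $ l)" for v i
    by (simp add: inner_axis' matrix_vector_mult_def mult.commute)
  have basis: "(?L (axis k 1) (axis i 1) (axis j 1) = ?R (axis k 1) (axis i 1) (axis j 1)) \<longleftrightarrow>
    metric_deriv g c p k i j = (\<Sum>l\<in>UNIV. \<Gamma> l k i * g c p $ l $ j + \<Gamma> l k j * g c p $ i $ l)" for k i j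
    by (simp add: ax ax2 ax3 metric_deriv_eq[OF c] \<Gamma>_def sum.distrib)
  have "?L h v w = ?R h v w"
    if *: "\<And>k i j. ?L (axis k 1) (axis i 1) (axis j 1) = ?R (axis k 1) (axis i 1) (axis j 1)" for h v w
  proof -
    have 1: "?L (axis k 1) (axis i 1) w = ?R (axis k 1) (axis i 1) w" for k i w
    proof (rule linear_eq_on_axis[where f = "?L (axis k 1) (axis i 1)" and h = "?R (axis k 1) (axis i 1)"])
      show "linear (?L (axis k 1) (axis i 1))" "linear (?R (axis k 1) (axis i 1))"
        by (auto intro!: linearI simp: inner_add_right matrix_vector_right_distrib linear_add[OF B(2)]
            linear_scale[OF B(2)] matrix_vector_mult_scaleR algebra_simps)
    qed (rule *)
    have 2: "?L (axis k 1) v w = ?R (axis k 1) v w" for k v w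
    proof (rule linear_eq_on_axis[where f = "\<lambda>v. ?L (axis k 1) v w" and h = "\<lambda>v. ?R (axis k 1) v w"])
      show "linear (\<lambda>v. ?L (axis k 1) v w)" "linear (\<lambda>v. ?R (axis k 1) v w)"
        by (auto intro!: linearI simp: inner_add_left linear_add[OF B(2)] linear_scale[OF B(2)] algebra_simps)
    qed (rule 1)
    show ?thesis
    proof (rule linear_eq_on_axis[where f = "\<lambda>h. ?L h v w" and h = "\<lambda>h. ?R h v w"])
      show "linear (\<lambda>h. ?L h v w)" "linear (\<lambda>h. ?R h v w)"
        by (auto intro!: linearI simp: inner_add_right inner_add_left linear_add[OF linD] linear_scale[OF linD]
            linear_add[OF B(1)] linear_scale[OF B(1)] matrix_vector_mult_add_rdistrib matrix_vector_right_distrib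
            matrix_vector_mult_scaleR scaleR_matrix_vector_assoc[symmetric] algebra_simps)
    qed (rule 2)
  qed
  then have "(\<forall>h v w. ?L h v w = ?R h v w) \<longleftrightarrow>
      (\<forall>k i j. ?L (axis k 1) (axis i 1) (axis j 1) = ?R (axis k 1) (axis i 1) (axis j 1))" by metis
  then show ?thesis by (simp only: basis)
qed

lemma christoffel_form_metric:
  assumes c: "c \<in> A" "p \<in> fst c"
  shows "v \<bullet> (frechet_derivative (lm c) (at (snd c p)) h *v w) =
    christoffel_form g c p h v \<bullet> (g c p *v w) + v \<bullet> (g c p *v christoffel_form g c p h w)"
proof -
  have "\<forall>k i j. metric_deriv g c p k i j = (\<Sum>l\<in>UNIV. christoffel g c p l k i * g c p $ l $ j
      + christoffel g c p l k j * g c p $ i $ l)"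
    using christoffel_unique[OF c, of "christoffel g c p"] by blast
  then show ?thesis
    using metric_compatible_iff[where B = "christoffel_form g c p", OF c linear_christoffel_form_left linear_christoffel_form_right, unfolded christoffel_form_axis]
    by blast
qed

text \<open>Vector form of the uniqueness of the Levi-Civita connection at one point. It reduces the
  transformation law under a change of charts to checking two properties of a candidate.\<close>

lemma christoffel_form_unique:
  fixes B :: "real^'n \<Rightarrow> real^'n \<Rightarrow> real^'n"
  assumes c: "c \<in> A" "p \<in> fst c" and B: "\<And>w. linear (\<lambda>v. B v w)" "\<And>v. linear (B v)"
    and sym: "\<And>v w. B v w = B w v"
    and compat: "\<And>h v w. v \<bullet> (frechet_derivative (lm c) (at (snd c p)) h *v w) =
      B h v \<bullet> (g c p *v w) + v \<bullet> (g c p *v B h w)"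
  shows "B v w = christoffel_form g c p v w"
proof -
  have "(\<lambda>k i j. B (axis i 1) (axis j 1) $ k) = christoffel g c p"
    using christoffel_unique[OF c, of "\<lambda>k i j. B (axis i 1) (axis j 1) $ k"]
      metric_compatible_iff[OF c B] sym compat by metis
  then have "B (axis i 1) (axis j 1) = christoffel_form g c p (axis i 1) (axis j 1)" for i j
    by (simp add: vec_eq_iff christoffel_form_axis fun_eq_iff)
  then have 1: "B (axis i 1) w = christoffel_form g c p (axis i 1) w" for i w
    by (rule linear_eq_on_axis[where f = "B (axis i 1)" and h = "christoffel_form g c p (axis i 1)", OF B(2) linear_christoffel_form_right])
  have "linear (\<lambda>v. B v w)" "linear (\<lambda>v. christoffel_form g c p v w)" by (rule B linear_christoffel_form_left)+
  from linear_eq_on_axis[OF this 1] show ?thesis .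
qed

end

section \<open>Covariant derivatives along maps\<close>

lemma bounded_bilinear_matrix_vector_mult: "bounded_bilinear ((*v) :: real^'n^'m \<Rightarrow> real^'n \<Rightarrow> real^'m)"
  by (rule bilinear_conv_bounded_bilinear[THEN iffD1])
    (auto simp: bilinear_def matrix_vector_mult_add_rdistrib matrix_vector_right_distrib
      matrix_vector_mult_scaleR scaleR_matrix_vector_assoc intro!: linearI)

text \<open>Components are set to 0 outside the charts at the base point, so smoothness of a
  component can only be asked over the preimage of its chart domain.\<close>

definition smooth_field_along ::
  "('m, 'n::finite) chart set \<Rightarrow> 'a::real_normed_vector set \<Rightarrow> ('a \<Rightarrow> 'm) \<Rightarrow> ('a \<Rightarrow> ('m, 'n) tvec) \<Rightarrow> bool" where
  "smooth_field_along A W F Y \<longleftrightarrow> (\<forall>u\<in>W. Y u \<in> tangent_space A (F u)) \<and>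
     (\<forall>c\<in>A. smooth_on {u \<in> W. F u \<in> fst c} (\<lambda>u. Y u c))"

lemma smooth_field_tangent: "smooth_field_along A W F Y \<Longrightarrow> u \<in> W \<Longrightarrow> Y u \<in> tangent_space A (F u)"
  by (simp add: smooth_field_along_def)

lemma smooth_field_smooth: "smooth_field_along A W F Y \<Longrightarrow> c \<in> A \<Longrightarrow> smooth_on {u \<in> W. F u \<in> fst c} (\<lambda>u. Y u c)"
  by (simp add: smooth_field_along_def)

lemma (in smooth_manifold) smooth_field_has_derivative:
  assumes "smooth_field_along A W F Y" "u \<in> W" "c \<in> charts_at A (F u)"
  shows "((\<lambda>w. Y w c) has_derivative frechet_derivative (\<lambda>w. Y w c) (at u)) (at u)"
  by (rule smooth_on_has_derivative[OF smooth_field_smooth[OF assms(1) charts_atD(1)[OF assms(3)]]])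
    (use assms charts_atD(2) in blast)

context smooth_manifold
begin

lemma differential_smooth_field:
  assumes F: "smooth_map X A W F"
  shows "smooth_field_along A W F (\<lambda>u. differential A F u b)"
  unfolding smooth_field_along_def
proof (intro conjI ballI)
  fix c assume c: "c \<in> A"
  have "Ck_on k {u \<in> W. F u \<in> fst c} (\<lambda>u. differential A F u b c)" for k
  proof (rule Ck_on_cong[OF smooth_map_open[OF F c]])
    show "Ck_on k {u \<in> W. F u \<in> fst c} (\<lambda>u. frechet_derivative (snd c \<circ> F) (at u) b)"
      using smooth_on_derivative[OF smooth_map_chart[OF F c]] by (rule smooth_on_imp_Ck)
    show "frechet_derivative (snd c \<circ> F) (at u) b = differential A F u b c" if "u \<in> {u \<in> W. F u \<in> fst c}" for u
      using that c by (simp add: differential_def charts_at_def)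
  qed
  then show "smooth_on {u \<in> W. F u \<in> fst c} (\<lambda>u. differential A F u b c)" by (simp add: smooth_on_def)
qed (rule differential_tangent[OF F])

lemma differential_linear:
  assumes "smooth_map X A W F" "u \<in> W"
  shows "differential A F u (a *\<^sub>R v + b *\<^sub>R w) = (\<lambda>c. a *\<^sub>R differential A F u v c + b *\<^sub>R differential A F u w c)"
proof
  fix c
  show "differential A F u (a *\<^sub>R v + b *\<^sub>R w) c = a *\<^sub>R differential A F u v c + b *\<^sub>R differential A F u w c"
  proof (cases "c \<in> charts_at A (F u)")
    case True
    have l: "linear (\<lambda>a. differential A F u a c)"
      by (rule has_derivative_linear[OF smooth_map_has_derivative[OF assms True]])
    show ?thesis unfolding linear_add[OF l] linear_scale[OF l] ..
  qed (simp add: differential_def)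
qed

lemma differential_field_has_derivative:
  fixes F :: "'a::euclidean_space \<Rightarrow> 'm" and \<sigma> \<tau> :: "'b::real_normed_vector \<Rightarrow> 'a"
  assumes F: "smooth_map X A W F" and s: "\<sigma> s \<in> W" and c: "c \<in> charts_at A (F (\<sigma> s))"
    and \<sigma>: "(\<sigma> has_derivative \<sigma>') (at s)" and \<tau>: "(\<tau> has_derivative \<tau>') (at s)"
  shows "((\<lambda>w. differential A F (\<sigma> w) (\<tau> w) c) has_derivative
    (\<lambda>a. frechet_derivative (\<lambda>u. differential A F u (\<tau> s) c) (at (\<sigma> s)) (\<sigma>' a)
      + differential A F (\<sigma> s) (\<tau>' a) c)) (at s)"
proof -
  let ?W = "{u \<in> W. F u \<in> fst c}" and ?X = "snd c \<circ> F"
  have cA: "c \<in> A" by (rule charts_atD(1)[OF c])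
  have oW: "open ?W" by (rule smooth_map_open[OF F cA])
  have sW: "\<sigma> s \<in> ?W" using s charts_atD(2)[OF c] by simp
  have eq: "differential A F u b c = frechet_derivative ?X (at u) b" if "u \<in> ?W" for u b
    using that cA by (simp add: differential_def charts_at_def)
  have 1: "((\<lambda>w. frechet_derivative ?X (at (\<sigma> w)) (\<tau> w)) has_derivative
    (\<lambda>a. frechet_derivative (\<lambda>z. frechet_derivative ?X (at z) (\<tau> s)) (at (\<sigma> s)) (\<sigma>' a)
      + frechet_derivative ?X (at (\<sigma> s)) (\<tau>' a))) (at s)"
    by (rule has_derivative_frechet_apply[OF oW smooth_on_imp_Ck[OF smooth_map_chart[OF F cA]] sW \<sigma> \<tau>])
  have d: "((\<lambda>z. frechet_derivative ?X (at z) (\<tau> s)) has_derivative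
      frechet_derivative (\<lambda>z. frechet_derivative ?X (at z) (\<tau> s)) (at (\<sigma> s))) (at (\<sigma> s))"
    by (rule smooth_on_has_derivative[OF smooth_on_derivative[OF smooth_map_chart[OF F cA]] sW])
  have "frechet_derivative (\<lambda>u. differential A F u (\<tau> s) c) (at (\<sigma> s)) =
      frechet_derivative (\<lambda>z. frechet_derivative ?X (at z) (\<tau> s)) (at (\<sigma> s))"
    by (rule frechet_derivative_at[symmetric], rule has_derivative_transform_within_open[OF d oW sW])
      (rule eq[symmetric])
  moreover have "\<forall>\<^sub>F w in at s. \<sigma> w \<in> ?W"
    using has_derivative_continuous[OF \<sigma>] oW sW unfolding continuous_within by (rule topological_tendstoD)
  then have "\<forall>\<^sub>F w in at s. frechet_derivative ?X (at (\<sigma> w)) (\<tau> w) = differential A F (\<sigma> w) (\<tau> w) c"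
    by eventually_elim (rule eq[symmetric])
  from has_derivative_transform_eventually[OF 1 this eq[OF sW, symmetric]]
  have "((\<lambda>w. differential A F (\<sigma> w) (\<tau> w) c) has_derivative
    (\<lambda>a. frechet_derivative (\<lambda>z. frechet_derivative ?X (at z) (\<tau> s)) (at (\<sigma> s)) (\<sigma>' a)
      + frechet_derivative ?X (at (\<sigma> s)) (\<tau>' a))) (at s)" by simp
  ultimately show ?thesis by (simp only: eq[OF sW])
qed

lemma differential_compose:
  assumes F: "smooth_map X A W F" and s: "\<sigma> s \<in> W" and \<sigma>: "(\<sigma> has_derivative \<sigma>') (at s)"
  shows "differential A (F \<circ> \<sigma>) s r = differential A F (\<sigma> s) (\<sigma>' r)"
proof
  fix c
  show "differential A (F \<circ> \<sigma>) s r c = differential A F (\<sigma> s) (\<sigma>' r) c"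
  proof (cases "c \<in> charts_at A (F (\<sigma> s))")
    case True
    have "(snd c \<circ> (F \<circ> \<sigma>) has_derivative (\<lambda>r. differential A F (\<sigma> s) (\<sigma>' r) c)) (at s)"
      using has_derivative_compose[OF \<sigma> smooth_map_has_derivative[OF F s True]] by (simp add: o_def)
    from fun_cong[OF frechet_derivative_at[OF this], of r] show ?thesis
      using True by (simp add: differential_def)
  qed (simp add: differential_def)
qed

end

section \<open>The Levi-Civita connection along maps\<close>

context riemannian_manifold
begin

text \<open>The derivative of the metric coefficients is absorbed into the two Christoffel terms by
  \<open>christoffel_form_metric\<close>. \<open>Y\<close> and \<open>Z\<close> are plain coordinate
  functions, so that the rule also covers the images of fixed vectors under a Jacobian in
  \<open>christoffel_form_transition\<close>.\<close>

lemma bilinear_metric_has_derivative: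
  assumes c: "c \<in> A" "p \<in> fst c"
    and f: "(f has_derivative f') (at u)" "f u = snd c p"
    and Y: "(Y has_derivative Y') (at u)" and Z: "(Z has_derivative Z') (at u)"
  shows "((\<lambda>w. Y w \<bullet> (lm c (f w) *v Z w)) has_derivative
    (\<lambda>a. (Y' a + christoffel_form g c p (f' a) (Y u)) \<bullet> (g c p *v Z u) + Y u \<bullet> (g c p *v (Z' a + christoffel_form g c p (f' a) (Z u))))) (at u)"
proof -
  let ?D = "frechet_derivative (lm c) (at (snd c p))"
  have "(lm c has_derivative ?D) (at (f u))"
    unfolding f(2) by (rule local_metric_has_derivative[OF c])
  from has_derivative_compose[OF f(1) this]
  have "((\<lambda>w. Y w \<bullet> (lm c (f w) *v Z w)) has_derivative
    (\<lambda>a. Y u \<bullet> (lm c (f u) *v Z' a + ?D (f' a) *v Z u) + Y' a \<bullet> (lm c (f u) *v Z u))) (at u)"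
    by (intro has_derivative_inner Y bounded_bilinear.FDERIV[OF bounded_bilinear_matrix_vector_mult] Z)
  moreover have "Y u \<bullet> (lm c (f u) *v Z' a + ?D (f' a) *v Z u) + Y' a \<bullet> (lm c (f u) *v Z u) =
    (Y' a + christoffel_form g c p (f' a) (Y u)) \<bullet> (g c p *v Z u) + Y u \<bullet> (g c p *v (Z' a + christoffel_form g c p (f' a) (Z u)))" for a
    using christoffel_form_metric[OF c, of "Y u" "f' a" "Z u"]
    by (simp add: f(2) local_metric_chart[OF c] inner_add_right inner_add_left matrix_vector_right_distrib)
  ultimately show ?thesis by simp
qed

text \<open>The pulled-back Christoffel symbols are symmetric and metric, hence agree with those of the first chart.\<close>

lemma christoffel_form_transition:
  assumes c: "c \<in> charts_at A p" and d: "d \<in> charts_at A p"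
  defines "J \<equiv> frechet_derivative (transition c d) (at (snd c p))"
  shows "J (christoffel_form g c p v w) = frechet_derivative (\<lambda>z. frechet_derivative (transition c d) (at z) w) (at (snd c p)) v
    + christoffel_form g d p (J v) (J w)"
proof -
  let ?T = "transition c d" and ?y = "snd c p"
  let ?O = "snd c ` (fst c \<inter> fst d)"
  define H where "H v w = frechet_derivative (\<lambda>z. frechet_derivative ?T (at z) w) (at ?y) v" for v w
  define K where "K = frechet_derivative (transition d c) (at (snd d p))"
  \<comment> \<open>The transformation law solved for the symbols of \<open>c\<close>. This
    candidate is symmetric by equality of mixed partials (\<open>Hsym\<close>) and metric by the
    computation below.\<close>
  define B where "B v w = K (H v w + christoffel_form g d p (J v) (J w))" for v w
  note cA = charts_atD[OF c] and dA = charts_atD[OF d]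
  have O: "open ?O" "?y \<in> ?O" using open_overlap[OF cA(1) dA(1)] overlap_mem[OF c d] by auto
  have T: "smooth_on ?O ?T" by (rule smooth_transition[OF cA(1) dA(1)])
  have Ty: "?T ?y = snd d p" by (rule transition_chart[OF cA])
  have KJ: "K (J v) = v" for v unfolding K_def J_def by (rule transition_derivative_inverse[OF c d])
  have JK: "J (K v) = v" for v unfolding K_def J_def by (rule transition_derivative_inverse[OF d c])
  have linJ: "linear J" unfolding J_def by (rule linear_transition_derivative[OF c d])
  have linK: "linear K" unfolding K_def by (rule linear_transition_derivative[OF d c])
  have dJ: "((\<lambda>z. frechet_derivative ?T (at z) w) has_derivative (\<lambda>h. H h w)) (at ?y)" for w
    using smooth_on_has_derivative[OF smooth_on_derivative[OF T] O(2)] by (simp add: H_def)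
  have Hsym: "H v w = H w v" for v w
    unfolding H_def by (rule Ck_on_second_derivative_symmetric[OF O(1) smooth_on_imp_Ck[OF T] O(2)])
  have linH: "linear (\<lambda>h. H h w)" for w by (rule has_derivative_linear[OF dJ])
  have linH2: "linear (H v)" for v using linH[of v] by (subst (asm) Hsym)
  have "B v w = christoffel_form g c p v w" for v w
  proof (rule christoffel_form_unique[OF cA])
    show "linear (\<lambda>v. B v w)" for w
      unfolding B_def
      by (intro linear_compose[OF _ linK, unfolded o_def] linear_compose_add linH
          linear_compose[OF linJ linear_christoffel_form_left, unfolded o_def])
    show "linear (B v)" for v
      unfolding B_def
      by (intro linear_compose[OF _ linK, unfolded o_def] linear_compose_add linH2
          linear_compose[OF linJ linear_christoffel_form_right, unfolded o_def])
    show "B v w = B w v" for v w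
      unfolding B_def Hsym[of v w] christoffel_form_sym[OF dA, of "J v"] ..
  next
    fix h v w
    have tr: "a \<bullet> (g c p *v b) = J a \<bullet> (g d p *v J b)" for a b
      unfolding J_def by (rule metric_transform) (use cA dA in auto)
    \<comment> \<open>Compatibility with the metric is the derivative, at the base point, of the
      statement that the transition map preserves inner products.\<close>
    have eq: "v \<bullet> (lm c z *v w) = frechet_derivative ?T (at z) v \<bullet> (lm d (?T z) *v frechet_derivative ?T (at z) w)"
      if "z \<in> ?O" for z
    proof -
      obtain q where q: "z = snd c q" "q \<in> fst c" "q \<in> fst d" using \<open>z \<in> ?O\<close> by blast
      then show ?thesis
        using metric_transform[OF cA(1) dA(1), of q v w] cA(1) dA(1) by (simp add: local_metric_chart transition_chart)
    qed
    have 1: "((\<lambda>z. v \<bullet> (lm c z *v w)) has_derivative (\<lambda>h. v \<bullet> (frechet_derivative (lm c) (at ?y) h *v w))) (at ?y)"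
      by (intro bounded_linear.has_derivative[OF bounded_linear_inner_right]
          bounded_linear.has_derivative[OF bounded_bilinear.bounded_linear_left[OF bounded_bilinear_matrix_vector_mult]]
          local_metric_has_derivative[OF cA])
    have 2: "((\<lambda>z. frechet_derivative ?T (at z) v \<bullet> (lm d (?T z) *v frechet_derivative ?T (at z) w)) has_derivative
      (\<lambda>a. (H a v + christoffel_form g d p (J a) (frechet_derivative ?T (at ?y) v)) \<bullet> (g d p *v frechet_derivative ?T (at ?y) w)
        + frechet_derivative ?T (at ?y) v \<bullet> (g d p *v (H a w + christoffel_form g d p (J a) (frechet_derivative ?T (at ?y) w))))) (at ?y)"
      by (rule bilinear_metric_has_derivative[where Y = "\<lambda>z. frechet_derivative ?T (at z) v"
            and Z = "\<lambda>z. frechet_derivative ?T (at z) w" and f = ?T,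
            OF dA transition_has_derivative[OF c d, folded J_def] Ty dJ dJ])
    have "v \<bullet> (frechet_derivative (lm c) (at ?y) h *v w) =
      (H h v + christoffel_form g d p (J h) (J v)) \<bullet> (g d p *v J w) + J v \<bullet> (g d p *v (H h w + christoffel_form g d p (J h) (J w)))"
      using fun_cong[OF has_derivative_unique[OF has_derivative_transform_within_open[OF 1 O eq] 2], of h]
      by (simp add: J_def)
    also have "\<dots> = J (B h v) \<bullet> (g d p *v J w) + J v \<bullet> (g d p *v J (B h w))" by (simp add: B_def JK)
    also have "\<dots> = B h v \<bullet> (g c p *v w) + v \<bullet> (g c p *v B h w)" by (simp add: tr)
    finally show "v \<bullet> (frechet_derivative (lm c) (at ?y) h *v w) = B h v \<bullet> (g c p *v w) + v \<bullet> (g c p *v B h w)" .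
  qed
  then have "J (christoffel_form g c p v w) = H v w + christoffel_form g d p (J v) (J w)" using JK by (metis B_def)
  then show ?thesis by (simp add: H_def)
qed

text \<open>Differentiating the transition rule of \<open>Y\<close> produces the second derivative
  of the transition map. Together with the Christoffel term of \<open>d\<close> it is exactly the
  image of the Christoffel term of \<open>c\<close>, by
  \<open>christoffel_form_transition\<close>.\<close>

lemma cov_deriv_tangent:
  assumes F: "smooth_map X A W F" and Y: "smooth_field_along A W F Y" and u: "u \<in> W"
  shows "cov_deriv A g F Y u a \<in> tangent_space A (F u)"
proof (rule tangent_spaceI)
  fix c d assume c: "c \<in> charts_at A (F u)" and d: "d \<in> charts_at A (F u)"
  let ?T = "transition c d" and ?y = "snd c (F u)"
  let ?O = "snd c ` (fst c \<inter> fst d)" and ?J = "frechet_derivative (transition c d) (at (snd c (F u)))"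
  let ?X = "\<lambda>w. snd c (F w)"
  note cA = charts_atD[OF c] and dA = charts_atD[OF d]
  have T: "smooth_on ?O ?T" by (rule smooth_transition[OF cA(1) dA(1)])
  have dX: "(?X has_derivative (\<lambda>a. differential A F u a c)) (at u)"
    using smooth_map_has_derivative[OF F u c] by (simp add: o_def)
  note dY = smooth_field_has_derivative[OF Y u c]
  have der: "((\<lambda>w. frechet_derivative ?T (at (?X w)) (Y w c)) has_derivative
    (\<lambda>a. frechet_derivative (\<lambda>z. frechet_derivative ?T (at z) (Y u c)) (at ?y) (differential A F u a c)
      + ?J (frechet_derivative (\<lambda>w. Y w c) (at u) a))) (at u)"
    by (rule has_derivative_frechet_apply[OF open_overlap[OF cA(1) dA(1)] smooth_on_imp_Ck[OF T] overlap_mem[OF c d] dX dY])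
  let ?W = "{w \<in> W. F w \<in> fst c} \<inter> {w \<in> W. F w \<in> fst d}"
  have oW: "open ?W" using smooth_map_open[OF F] cA dA by blast
  have uW: "u \<in> ?W" using u cA dA by auto
  have "((\<lambda>w. Y w d) has_derivative
    (\<lambda>a. frechet_derivative (\<lambda>z. frechet_derivative ?T (at z) (Y u c)) (at ?y) (differential A F u a c)
      + ?J (frechet_derivative (\<lambda>w. Y w c) (at u) a))) (at u)"
  proof (rule has_derivative_transform_within_open[OF der oW uW])
    fix w assume w: "w \<in> ?W"
    then have "c \<in> charts_at A (F w)" "d \<in> charts_at A (F w)" using cA dA by (auto simp: charts_at_def)
    from tangent_space_transition[OF smooth_field_tangent[OF Y] this] w
    show "frechet_derivative ?T (at (?X w)) (Y w c) = Y w d" by simp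
  qed
  from fun_cong[OF frechet_derivative_at[OF this], of a]
  have 1: "frechet_derivative (\<lambda>w. Y w d) (at u) a =
    frechet_derivative (\<lambda>z. frechet_derivative ?T (at z) (Y u c)) (at ?y) (differential A F u a c)
      + ?J (frechet_derivative (\<lambda>w. Y w c) (at u) a)" by simp
  have 2: "differential A F u a d = ?J (differential A F u a c)"
    by (rule tangent_space_transition[OF differential_tangent[OF F u] c d])
  have 3: "Y u d = ?J (Y u c)"
    by (rule tangent_space_transition[OF smooth_field_tangent[OF Y u] c d])
  show "cov_deriv A g F Y u a d = ?J (cov_deriv A g F Y u a c)"
    unfolding cov_deriv_chart[where F = F and u = u, OF c] cov_deriv_chart[where F = F and u = u, OF d] linear_add[OF linear_transition_derivative[OF c d]]
      christoffel_form_transition[OF c d] 1 2 3 by (simp only: add_ac)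
qed (simp add: cov_deriv_def)

lemma cov_deriv_smooth_linear:
  assumes F: "smooth_map X A W F" and Y: "smooth_field_along A W F Y" and u: "u \<in> W"
  shows "cov_deriv A g F Y u (r *\<^sub>R a + q *\<^sub>R b) = (\<lambda>c. r *\<^sub>R cov_deriv A g F Y u a c + q *\<^sub>R cov_deriv A g F Y u b c)"
proof
  fix c
  show "cov_deriv A g F Y u (r *\<^sub>R a + q *\<^sub>R b) c = r *\<^sub>R cov_deriv A g F Y u a c + q *\<^sub>R cov_deriv A g F Y u b c"
  proof (cases "c \<in> charts_at A (F u)")
    case True
    have l: "linear (frechet_derivative (\<lambda>w. Y w c) (at u))"
      by (rule has_derivative_linear[OF smooth_field_has_derivative[OF Y u True]])
    have l2: "linear (\<lambda>v. christoffel_form g c (F u) v (Y u c))" by (rule linear_christoffel_form_left)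
    show ?thesis
      unfolding cov_deriv_chart[where F = F and u = u, OF True] differential_linear[OF F u] linear_add[OF l] linear_scale[OF l]
        linear_add[OF l2] linear_scale[OF l2] by (simp add: algebra_simps)
  qed (simp add: cov_deriv_def)
qed

lemma cov_deriv_lincomb:
  assumes Y: "smooth_field_along A W F Y" and Z: "smooth_field_along A W F Z" and u: "u \<in> W"
  shows "cov_deriv A g F (\<lambda>u c. r *\<^sub>R Y u c + q *\<^sub>R Z u c) u a =
    (\<lambda>c. r *\<^sub>R cov_deriv A g F Y u a c + q *\<^sub>R cov_deriv A g F Z u a c)"
proof
  fix c
  show "cov_deriv A g F (\<lambda>u c. r *\<^sub>R Y u c + q *\<^sub>R Z u c) u a c =
    r *\<^sub>R cov_deriv A g F Y u a c + q *\<^sub>R cov_deriv A g F Z u a c"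
  proof (cases "c \<in> charts_at A (F u)")
    case True
    have "((\<lambda>w. r *\<^sub>R Y w c + q *\<^sub>R Z w c) has_derivative
      (\<lambda>a. r *\<^sub>R frechet_derivative (\<lambda>w. Y w c) (at u) a + q *\<^sub>R frechet_derivative (\<lambda>w. Z w c) (at u) a)) (at u)"
      by (intro has_derivative_add bounded_linear.has_derivative[OF bounded_linear_scaleR_right]
          smooth_field_has_derivative[OF Y u True] smooth_field_has_derivative[OF Z u True])
    from fun_cong[OF frechet_derivative_at[OF this], of a]
    have 1: "frechet_derivative (\<lambda>w. r *\<^sub>R Y w c + q *\<^sub>R Z w c) (at u) a =
      r *\<^sub>R frechet_derivative (\<lambda>w. Y w c) (at u) a + q *\<^sub>R frechet_derivative (\<lambda>w. Z w c) (at u) a" by simp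
    show ?thesis
      unfolding cov_deriv_chart[where F = F and u = u, OF True] 1 linear_add[OF linear_christoffel_form_right] linear_scale[OF linear_christoffel_form_right]
      by (simp add: algebra_simps)
  qed (simp add: cov_deriv_def)
qed

lemma smooth_field_lincomb:
  assumes F: "smooth_map X A W F" and Y: "smooth_field_along A W F Y" and Z: "smooth_field_along A W F Z"
  shows "smooth_field_along A W F (\<lambda>u c. r *\<^sub>R Y u c + q *\<^sub>R Z u c)"
  unfolding smooth_field_along_def
proof (intro conjI ballI)
  fix c assume c: "c \<in> A"
  show "smooth_on {u \<in> W. F u \<in> fst c} (\<lambda>u. r *\<^sub>R Y u c + q *\<^sub>R Z u c)"
    using smooth_field_smooth[OF Y c] smooth_field_smooth[OF Z c] unfolding smooth_on_def
    by (auto intro!: Ck_on_add smooth_map_open[OF F c] Ck_on_bounded_linear[OF bounded_linear_scaleR_right])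
qed (intro tangent_lincomb smooth_field_tangent[OF Y] smooth_field_tangent[OF Z])

lemma riem_inner_has_derivative:
  assumes F: "smooth_map X A W F" and Y: "smooth_field_along A W F Y" and Z: "smooth_field_along A W F Z"
    and u: "u \<in> W"
  shows "((\<lambda>w. riem_inner A g (F w) (Y w) (Z w)) has_derivative
    (\<lambda>a. riem_inner A g (F u) (cov_deriv A g F Y u a) (Z u) + riem_inner A g (F u) (Y u) (cov_deriv A g F Z u a))) (at u)"
proof -
  have "F u \<in> topspace X" using F u by (auto simp: smooth_map_def continuous_map_def)
  then obtain c where c: "c \<in> charts_at A (F u)" using charts_at_nonempty by blast
  note cA = charts_atD[OF c]
  let ?W = "{w \<in> W. F w \<in> fst c}"
  have oW: "open ?W" by (rule smooth_map_open[OF F cA(1)])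
  have uW: "u \<in> ?W" using u cA by auto
  have dX: "((\<lambda>w. snd c (F w)) has_derivative (\<lambda>a. differential A F u a c)) (at u)"
    using smooth_map_has_derivative[OF F u c] by (simp add: o_def)
  note der = bilinear_metric_has_derivative[OF cA dX refl smooth_field_has_derivative[OF Y u c]
      smooth_field_has_derivative[OF Z u c]]
  have "((\<lambda>w. riem_inner A g (F w) (Y w) (Z w)) has_derivative
    (\<lambda>a. cov_deriv A g F Y u a c \<bullet> (g c (F u) *v Z u c) + Y u c \<bullet> (g c (F u) *v cov_deriv A g F Z u a c))) (at u)"
    unfolding cov_deriv_chart[where F = F and u = u, OF c]
  proof (rule has_derivative_transform_within_open[OF der oW uW])
    fix w assume w: "w \<in> ?W"
    then have cw: "c \<in> charts_at A (F w)" using cA by (auto simp: charts_at_def)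
    show "Y w c \<bullet> (lm c (snd c (F w)) *v Z w c) = riem_inner A g (F w) (Y w) (Z w)"
      using riem_inner_chart[OF cw smooth_field_tangent[OF Y] smooth_field_tangent[OF Z]] w
      by (simp add: local_metric_chart[OF cA(1)])
  qed
  then show ?thesis
    unfolding riem_inner_chart[OF c cov_deriv_tangent[OF F Y u] smooth_field_tangent[OF Z u]]
      riem_inner_chart[OF c smooth_field_tangent[OF Y u] cov_deriv_tangent[OF F Z u]] .
qed

lemma riem_inner_smooth:
  assumes F: "smooth_map X A W F" and Y: "smooth_field_along A W F Y" and Z: "smooth_field_along A W F Z"
  shows "smooth_on W (\<lambda>w. riem_inner A g (F w) (Y w) (Z w))"
  unfolding smooth_on_def
proof (intro allI Ck_on_local)
  fix k u assume u: "u \<in> W"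
  have "F u \<in> topspace X" using F u by (auto simp: smooth_map_def continuous_map_def)
  then obtain c where c: "c \<in> charts_at A (F u)" using charts_at_nonempty by blast
  note cA = charts_atD[OF c]
  let ?W = "{w \<in> W. F w \<in> fst c}"
  have oW: "open ?W" by (rule smooth_map_open[OF F cA(1)])
  have "Ck_on k ?W (\<lambda>w. lm c ((snd c \<circ> F) w))"
    by (rule Ck_on_compose[OF oW open_image[OF cA(1)] _ smooth_on_imp_Ck[OF smooth_map_chart[OF F cA(1)]]
          smooth_on_imp_Ck[OF metric_smooth[OF cA(1)]]]) auto
  then have "Ck_on k ?W (\<lambda>w. Y w c \<bullet> (lm c ((snd c \<circ> F) w) *v Z w c))"
    by (intro bounded_bilinear.Ck_on[OF bounded_bilinear_inner oW]
        bounded_bilinear.Ck_on[OF bounded_bilinear_matrix_vector_mult oW]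
        smooth_on_imp_Ck[OF smooth_field_smooth[OF Y cA(1)]] smooth_on_imp_Ck[OF smooth_field_smooth[OF Z cA(1)]])
  then have "Ck_on k ?W (\<lambda>w. riem_inner A g (F w) (Y w) (Z w))"
  proof (rule Ck_on_cong[OF oW, rotated])
    fix w assume w: "w \<in> ?W"
    then have cw: "c \<in> charts_at A (F w)" using cA by (auto simp: charts_at_def)
    show "Y w c \<bullet> (lm c ((snd c \<circ> F) w) *v Z w c) = riem_inner A g (F w) (Y w) (Z w)"
      using riem_inner_chart[OF cw smooth_field_tangent[OF Y] smooth_field_tangent[OF Z]] w
      by (simp add: local_metric_chart[OF cA(1)])
  qed
  then show "\<exists>T. open T \<and> u \<in> T \<and> Ck_on k T (\<lambda>w. riem_inner A g (F w) (Y w) (Z w))"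
    using oW u cA by blast
qed

text \<open>Vanishing torsion along \<open>F\<close>: mixed partial derivatives commute and the
  Christoffel symbols are symmetric. The self-adjointness of the shape operator and the Koszul
  formula both rest on it.\<close>

lemma cov_deriv_differential_sym:
  assumes F: "smooth_map X A W F" and u: "u \<in> W"
  shows "cov_deriv A g F (\<lambda>u. differential A F u b) u a = cov_deriv A g F (\<lambda>u. differential A F u a) u b"
proof
  fix c
  show "cov_deriv A g F (\<lambda>u. differential A F u b) u a c = cov_deriv A g F (\<lambda>u. differential A F u a) u b c"
  proof (cases "c \<in> charts_at A (F u)")
    case True
    note cA = charts_atD[OF True]
    let ?W = "{w \<in> W. F w \<in> fst c}" and ?X = "snd c \<circ> F"
    have oW: "open ?W" by (rule smooth_map_open[OF F cA(1)])
    have uW: "u \<in> ?W" using u cA by auto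
    have S: "smooth_on ?W ?X" by (rule smooth_map_chart[OF F cA(1)])
    have eq: "frechet_derivative (\<lambda>w. differential A F w b c) (at u) =
        frechet_derivative (\<lambda>w. frechet_derivative ?X (at w) b) (at u)" for b
    proof (rule frechet_derivative_at[symmetric], rule has_derivative_transform_within_open[OF
          smooth_on_has_derivative[OF smooth_on_derivative[OF S] uW] oW uW])
      show "frechet_derivative ?X (at w) b = differential A F w b c" if "w \<in> ?W" for w
        using that cA by (simp add: differential_def charts_at_def)
    qed
    show ?thesis
      unfolding cov_deriv_chart[where F = F and u = u, OF True] eq
        Ck_on_second_derivative_symmetric[OF oW smooth_on_imp_Ck[OF S] uW, of b a]
        christoffel_form_sym[OF cA, of "differential A F u a c"] ..
  qed (simp add: cov_deriv_def)
qed

text \<open>Splits the derivative of a field with moving coefficients into a part with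
  \<open>\<tau> s\<close> frozen and the derivative of \<open>\<tau>\<close>. With
  \<open>\<sigma>\<close> a curve it gives accelerations, with \<open>\<sigma>\<close> the identity
  it treats fields on a patch.\<close>

lemma cov_deriv_differential_compose:
  fixes F :: "'a::euclidean_space \<Rightarrow> 'm" and \<sigma> \<tau> :: "'b::real_normed_vector \<Rightarrow> 'a"
  assumes F: "smooth_map X A W F" and s: "\<sigma> s \<in> W"
    and \<sigma>: "(\<sigma> has_derivative \<sigma>') (at s)" and \<tau>: "(\<tau> has_derivative \<tau>') (at s)"
  shows "cov_deriv A g (F \<circ> \<sigma>) (\<lambda>s. differential A F (\<sigma> s) (\<tau> s)) s r =
    (\<lambda>c. cov_deriv A g F (\<lambda>u. differential A F u (\<tau> s)) (\<sigma> s) (\<sigma>' r) c + differential A F (\<sigma> s) (\<tau>' r) c)"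
proof
  fix c
  show "cov_deriv A g (F \<circ> \<sigma>) (\<lambda>s. differential A F (\<sigma> s) (\<tau> s)) s r c =
    cov_deriv A g F (\<lambda>u. differential A F u (\<tau> s)) (\<sigma> s) (\<sigma>' r) c + differential A F (\<sigma> s) (\<tau>' r) c"
  proof (cases "c \<in> charts_at A (F (\<sigma> s))")
    case True
    then have c': "c \<in> charts_at A ((F \<circ> \<sigma>) s)" by simp
    have "(snd c \<circ> (F \<circ> \<sigma>) has_derivative (\<lambda>r. differential A F (\<sigma> s) (\<sigma>' r) c)) (at s)"
      using has_derivative_compose[OF \<sigma> smooth_map_has_derivative[OF F s True]] by (simp add: o_def)
    from fun_cong[OF frechet_derivative_at[OF this], of r]
    have 1: "differential A (F \<circ> \<sigma>) s r c = differential A F (\<sigma> s) (\<sigma>' r) c"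
      using True by (simp add: differential_def)
    from fun_cong[OF frechet_derivative_at[OF differential_field_has_derivative[OF F s True \<sigma> \<tau>]], of r]
    show ?thesis
      unfolding cov_deriv_chart[where F = "F \<circ> \<sigma>" and u = s, OF c'] cov_deriv_chart[where F = F and u = "\<sigma> s", OF True] 1 by (simp add: add_ac)
  qed (simp add: cov_deriv_def differential_def)
qed

end

section \<open>Surfaces with a parallel field of constant angle\<close>

lemma riem_inner_lincomb_left:
  "riem_inner A g p (\<lambda>c. r *\<^sub>R v c + q *\<^sub>R w c) z = r * riem_inner A g p v z + q * riem_inner A g p w z"
  by (simp add: riem_inner_def Let_def inner_add_left)

lemma riem_inner_lincomb_right:
  "riem_inner A g p z (\<lambda>c. r *\<^sub>R v c + q *\<^sub>R w c) = r * riem_inner A g p z v + q * riem_inner A g p z w"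
  by (simp add: riem_inner_def Let_def inner_add_right matrix_vector_right_distrib matrix_vector_mult_scaleR)

lemma riem_inner_zero [simp]: "riem_inner A g p (\<lambda>c. 0) z = 0" "riem_inner A g p z (\<lambda>c. 0) = 0"
  by (simp_all add: riem_inner_def Let_def)

lemma riem_inner_minus_left: "riem_inner A g p (\<lambda>c. - v c) z = - riem_inner A g p v z"
  by (simp add: riem_inner_def Let_def)

lemma cov_deriv_cong:
  assumes "open W" "u \<in> W" "\<And>w. w \<in> W \<Longrightarrow> Y w = Z w"
  shows "cov_deriv A g F Y u a = cov_deriv A g F Z u a"
proof
  fix c
  have *: "((\<lambda>w. Y w c) has_derivative D) (at u) \<longleftrightarrow> ((\<lambda>w. Z w c) has_derivative D) (at u)" for D
    using has_derivative_transform_within_open[OF _ assms(1,2), of "\<lambda>w. Y w c" D UNIV "\<lambda>w. Z w c"]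
      has_derivative_transform_within_open[OF _ assms(1,2), of "\<lambda>w. Z w c" D UNIV "\<lambda>w. Y w c"] assms(3) by auto
  have "frechet_derivative (\<lambda>w. Y w c) (at u) = frechet_derivative (\<lambda>w. Z w c) (at u)"
    unfolding frechet_derivative_def * ..
  then show "cov_deriv A g F Y u a c = cov_deriv A g F Z u a c"
    using assms(2,3) by (simp add: cov_deriv_def)
qed

context riemannian_manifold
begin

lemma riem_inner_commute:
  assumes "p \<in> topspace X" "v \<in> tangent_space A p" "w \<in> tangent_space A p"
  shows "riem_inner A g p v w = riem_inner A g p w v"
proof -
  obtain c where c: "c \<in> charts_at A p" using charts_at_nonempty[OF assms(1)] by blast
  have "v c \<bullet> (g c p *v w c) = (v c v* g c p) \<bullet> w c" by (simp add: dot_lmul_matrix)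
  also have "\<dots> = w c \<bullet> (transpose (g c p) *v v c)" by (simp add: transpose_matrix_vector inner_commute)
  also have "\<dots> = w c \<bullet> (g c p *v v c)" by (simp add: metric_symmetric[OF charts_atD[OF c]])
  finally show ?thesis
    unfolding riem_inner_chart[OF c assms(2,3)] riem_inner_chart[OF c assms(3,2)] .
qed

lemma riem_inner_pos:
  assumes "p \<in> topspace X" "v \<in> tangent_space A p" "v \<noteq> (\<lambda>c. 0)"
  shows "riem_inner A g p v v > 0"
proof -
  obtain c where c: "c \<in> charts_at A p" using charts_at_nonempty[OF assms(1)] by blast
  have "v c \<noteq> 0" using tangent_eqI[OF assms(2) tangent_zero c] assms(3) by blast
  then show ?thesis
    unfolding riem_inner_chart[OF c assms(2,2)] by (rule metric_positive[OF charts_atD[OF c]])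
qed

lemma riem_inner_nonneg: "p \<in> topspace X \<Longrightarrow> v \<in> tangent_space A p \<Longrightarrow> 0 \<le> riem_inner A g p v v"
  using riem_inner_pos[of p v] by (cases "v = (\<lambda>c. 0)") auto

lemma riem_inner_self_eq_0:
  "p \<in> topspace X \<Longrightarrow> v \<in> tangent_space A p \<Longrightarrow> riem_inner A g p v v = 0 \<Longrightarrow> v = (\<lambda>c. 0)"
  using riem_inner_pos[of p v] by (cases "v = (\<lambda>c. 0)") auto

lemma cov_deriv_zero_field:
  assumes "open W" "u \<in> W" "\<And>w. w \<in> W \<Longrightarrow> Y w = (\<lambda>c. 0)"
  shows "cov_deriv A g F Y u a = (\<lambda>c. 0)"
proof
  fix c
  have "cov_deriv A g F Y u a = cov_deriv A g F (\<lambda>w c. 0) u a"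
    by (rule cov_deriv_cong[OF assms])
  then show "cov_deriv A g F Y u a c = 0" by (simp add: cov_deriv_def christoffel_form_def[symmetric] vec_eq_iff)
qed

end

text \<open>Both conclusions are local, so the data are pulled back to one parameter domain. The
  angle enters only through its cosine \<open>C\<close>.\<close>

locale constant_angle_patch = riemannian_manifold X A g
  for X :: "'m topology" and A :: "('m, 3) chart set" and g :: "('m, 3) metric_coeffs" +
  fixes W :: "(real^2) set" and x :: "real^2 \<Rightarrow> 'm" and N V :: "real^2 \<Rightarrow> ('m, 3) tvec" and C :: real
  assumes x: "smooth_map X A W x"
    and inj_dx: "u \<in> W \<Longrightarrow> inj (differential A x u)"
    and N: "smooth_field_along A W x N"
    and V: "smooth_field_along A W x V"
    and N_unit: "u \<in> W \<Longrightarrow> riem_inner A g (x u) (N u) (N u) = 1"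
    and V_unit: "u \<in> W \<Longrightarrow> riem_inner A g (x u) (V u) (V u) = 1"
    and N_normal: "u \<in> W \<Longrightarrow> riem_inner A g (x u) (N u) (differential A x u a) = 0"
    and V_parallel: "u \<in> W \<Longrightarrow> cov_deriv A g x V u a = (\<lambda>c. 0)"
    and angle: "u \<in> W \<Longrightarrow> riem_inner A g (x u) (V u) (N u) = C"
begin

abbreviation "ip u \<equiv> riem_inner A g (x u)"
abbreviation "dx \<equiv> differential A x"
abbreviation "nab \<equiv> cov_deriv A g x"
abbreviation "TS u \<equiv> tangent_space A (x u)"

lemma open_W: "open W" using x by (simp add: smooth_map_def)

lemma x_mem: "u \<in> W \<Longrightarrow> x u \<in> topspace X" using x by (auto simp: smooth_map_def continuous_map_def)

lemma dx_tangent: "u \<in> W \<Longrightarrow> dx u a \<in> TS u" by (rule differential_tangent[OF x])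

lemma N_tangent: "u \<in> W \<Longrightarrow> N u \<in> TS u" by (rule smooth_field_tangent[OF N])

lemma V_tangent: "u \<in> W \<Longrightarrow> V u \<in> TS u" by (rule smooth_field_tangent[OF V])

lemma nab_N_tangent: "u \<in> W \<Longrightarrow> nab N u a \<in> TS u" by (rule cov_deriv_tangent[OF x N])

lemmas dx_lin = differential_linear[OF x]
lemmas dx_field = differential_smooth_field[OF x]

lemma nab_dx_tangent: "u \<in> W \<Longrightarrow> nab (\<lambda>u. dx u b) u a \<in> TS u" by (rule cov_deriv_tangent[OF x dx_field])

lemma ip_const_derivative:
  assumes Y: "smooth_field_along A W x Y" and Z: "smooth_field_along A W x Z" and u: "u \<in> W"
    and const: "\<And>w. w \<in> W \<Longrightarrow> ip w (Y w) (Z w) = k"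
  shows "ip u (nab Y u a) (Z u) + ip u (Y u) (nab Z u a) = 0"
proof -
  have "((\<lambda>w. k) has_derivative (\<lambda>a. ip u (nab Y u a) (Z u) + ip u (Y u) (nab Z u a))) (at u)"
    by (rule has_derivative_transform_within_open[OF riem_inner_has_derivative[OF x Y Z u] open_W u const])
  from fun_cong[OF has_derivative_unique[OF this has_derivative_const], of a] show ?thesis .
qed

lemma ip_commute: "u \<in> W \<Longrightarrow> v \<in> TS u \<Longrightarrow> w \<in> TS u \<Longrightarrow> ip u v w = ip u w v"
  by (rule riem_inner_commute[OF x_mem])

lemma nab_N_N: "u \<in> W \<Longrightarrow> ip u (nab N u a) (N u) = 0"
  using ip_const_derivative[OF N N _ N_unit, of u a]
    ip_commute[OF _ nab_N_tangent N_tangent, of u a] by simp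

lemma nab_N_V: "u \<in> W \<Longrightarrow> ip u (nab N u a) (V u) = 0"
  using ip_const_derivative[OF V N _ angle, of u a] V_parallel
    ip_commute[OF _ nab_N_tangent V_tangent, of u a] by simp

text \<open>The scalars are spelled out so that \<open>T\<close> is literally an instance of the
  lemmas on linear combinations.\<close>

definition T :: "real^2 \<Rightarrow> ('m, 3) tvec" where "T = (\<lambda>u c. 1 *\<^sub>R V u c + (- C) *\<^sub>R N u c)"

lemma T_field: "smooth_field_along A W x T"
  unfolding T_def by (rule smooth_field_lincomb[OF x V N])

lemma T_tangent: "u \<in> W \<Longrightarrow> T u \<in> TS u" by (rule smooth_field_tangent[OF T_field])

lemma ip_T_right: "ip u v (T u) = ip u v (V u) - C * ip u v (N u)"
  unfolding T_def riem_inner_lincomb_right by simp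

lemma ip_T_left: "ip u (T u) v = ip u (V u) v - C * ip u (N u) v"
  unfolding T_def riem_inner_lincomb_left by simp

lemma T_normal: "u \<in> W \<Longrightarrow> ip u (N u) (T u) = 0"
  using ip_commute[OF _ N_tangent V_tangent, of u] by (simp add: ip_T_right N_unit angle)

text \<open>The length is constant, so \<open>T\<close> vanishes everywhere or nowhere, and which of
  the two happens depends on \<open>C\<close> alone.\<close>

lemma T_norm: "u \<in> W \<Longrightarrow> ip u (T u) (T u) = 1 - C\<^sup>2"
  using ip_commute[OF _ N_tangent V_tangent, of u]
  by (simp add: ip_T_right ip_T_left N_unit V_unit angle power2_eq_square)

lemma nab_N_T: "u \<in> W \<Longrightarrow> ip u (nab N u a) (T u) = 0"
  by (simp add: ip_T_right nab_N_N nab_N_V)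

lemma nab_T: "u \<in> W \<Longrightarrow> nab T u a = (\<lambda>c. - C *\<^sub>R nab N u a c)"
  unfolding T_def by (subst cov_deriv_lincomb[OF V N]) (simp_all add: V_parallel)

lemma nab_N_zero_of_unit_cosine:
  assumes "C\<^sup>2 = 1" "u \<in> W"
  shows "nab N u a = (\<lambda>c. 0)"
proof -
  have "T w = (\<lambda>c. 0)" if "w \<in> W" for w
    using T_norm[OF that] assms(1) riem_inner_self_eq_0[OF x_mem T_tangent, OF that that] by simp
  from cov_deriv_zero_field[OF open_W assms(2) this]
  have "nab T u a = (\<lambda>c. 0)" .
  then have "C *\<^sub>R nab N u a c = 0" for c using fun_cong[OF nab_T[OF assms(2), of a], of c] by simp
  moreover have "C \<noteq> 0" using assms(1) by auto
  ultimately show ?thesis by (intro ext) simp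
qed

text \<open>A dimension count in one chart: \<open>dx u\<close> embeds the plane into the orthogonal
  complement of the normal, which is itself two-dimensional because the ambient dimension is
  3.\<close>

lemma orthogonal_imp_differential:
  assumes u: "u \<in> W" and v: "v \<in> TS u" and orth: "ip u (N u) v = 0"
  shows "\<exists>a. v = dx u a"
proof -
  obtain c where c: "c \<in> charts_at A (x u)" using charts_at_nonempty[OF x_mem[OF u]] by blast
  \<comment> \<open>\<open>?n\<close> is the covector dual to the normal; it turns orthogonality for
    \<open>g\<close> into a Euclidean hyperplane condition.\<close>
  let ?f = "\<lambda>a. dx u a c" and ?n = "transpose (g c (x u)) *v N u c"
  have n: "ip u (N u) w = ?n \<bullet> w c" if "w \<in> TS u" for w
    unfolding riem_inner_chart[OF c N_tangent[OF u] that]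
    by (simp add: transpose_matrix_vector dot_lmul_matrix)
  have "?n \<noteq> 0" using n[OF N_tangent[OF u]] N_unit[OF u] by auto
  have lin: "linear ?f" by (rule has_derivative_linear[OF smooth_map_has_derivative[OF x u c]])
  have "inj ?f"
  proof (rule injI)
    fix a b assume "?f a = ?f b"
    then have "dx u a = dx u b" by (rule tangent_eqI[OF dx_tangent[OF u] dx_tangent[OF u] c])
    then show "a = b" using inj_dx[OF u] by (simp add: inj_def)
  qed
  have "range ?f = {y. ?n \<bullet> y = 0}"
  proof (rule subspace_dim_equal)
    show "subspace (range ?f)" by (rule linear_subspace_image[OF lin subspace_UNIV])
    show "subspace {y. ?n \<bullet> y = 0}" by (rule subspace_hyperplane)
    show "range ?f \<subseteq> {y. ?n \<bullet> y = 0}" using n[OF dx_tangent[OF u]] N_normal[OF u] by auto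
    have "dim (range ?f) = 2" using dim_image_eq[OF lin, of UNIV] \<open>inj ?f\<close> by simp
    moreover have "dim {y. ?n \<bullet> y = 0} = 2" using dim_hyperplane[OF \<open>?n \<noteq> 0\<close>] by simp
    ultimately show "dim {y. ?n \<bullet> y = 0} \<le> dim (range ?f)" by simp
  qed
  moreover have "v c \<in> {y. ?n \<bullet> y = 0}" using n[OF v] orth by simp
  ultimately obtain a where "v c = dx u a c" by blast
  then have "v = dx u a" by (rule tangent_eqI[OF v dx_tangent[OF u] c])
  then show ?thesis by blast
qed

theorem shape_operator_degenerate:
  assumes u: "u \<in> W" and N': "N' \<circ> x = N"
  shows "\<exists>B. shape_operator_matrix A g N' x u B \<and> det B = 0"
proof -
  have "\<exists>b. (\<lambda>c. - nab N u a c) = dx u b" for a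
  proof (rule orthogonal_imp_differential[OF u])
    show "(\<lambda>c. - nab N u a c) \<in> TS u"
      using tangent_lincomb[OF nab_N_tangent[OF u] nab_N_tangent[OF u], of "-1" a 0 a] by simp
    show "ip u (N u) (\<lambda>c. - nab N u a c) = 0"
      using riem_inner_lincomb_right[of A g "x u" "N u" "-1" "nab N u a" 0 "nab N u a"]
        nab_N_N[OF u, of a] riem_inner_commute[OF x_mem[OF u] nab_N_tangent[OF u] N_tangent[OF u]] by simp
  qed
  then obtain b where b: "\<And>a. (\<lambda>c. - nab N u a c) = dx u (b a)" by metis
  have b_lin: "b (r *\<^sub>R a + q *\<^sub>R a') = r *\<^sub>R b a + q *\<^sub>R b a'" for r a q a'
  proof -
    have "dx u (b (r *\<^sub>R a + q *\<^sub>R a')) = dx u (r *\<^sub>R b a + q *\<^sub>R b a')"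
      unfolding dx_lin[OF u] b[symmetric] cov_deriv_smooth_linear[OF x N u] by (simp add: fun_eq_iff)
    then show ?thesis using inj_dx[OF u] by (simp add: inj_def)
  qed
  have "linear b"
    using b_lin[of 1 _ 1] b_lin[of _ _ 0] by (intro linearI) auto
  define B where "B = matrix b"
  have B: "B *v a = b a" for a unfolding B_def by (rule fun_cong[OF matrix_vector_mul(2)[OF \<open>linear b\<close>]])
  have "det B = 0"
  proof (rule ccontr)
    assume "det B \<noteq> 0"
    then obtain B' where "B ** B' = mat 1" using invertible_det_nz invertible_def by blast
    then have "b (B' *v v) = v" for v by (simp flip: B add: matrix_vector_mul_assoc)
    then have surj: "\<exists>a. b a = v" for v by blast
    obtain \<tau> where \<tau>: "T u = dx u \<tau>"
      using orthogonal_imp_differential[OF u T_tangent[OF u] T_normal[OF u]] by blast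
    obtain a where "b a = \<tau>" using surj by blast
    then have Ta: "T u = (\<lambda>c. - nab N u a c)" using b \<tau> by simp
    \<comment> \<open>Surjectivity puts \<open>T\<close> into the image of the shape operator, which
      is orthogonal to \<open>T\<close>. So \<open>T\<close> has length 0, that is
      \<open>C\<^sup>2 = 1\<close>; but then the shape operator is zero, which contradicts
      surjectivity again.\<close>
    have "ip u (T u) (T u) = - ip u (nab N u a) (T u)"
      by (subst (1) Ta) (rule riem_inner_minus_left)
    then have "C\<^sup>2 = 1" using nab_N_T[OF u] T_norm[OF u] by simp
    then have "dx u (b a) = (\<lambda>c. 0)" for a
      using nab_N_zero_of_unit_cosine[OF _ u, of a] b[of a] by simp
    then have "dx u (axis 1 1) = (\<lambda>c. 0)" "dx u 0 = (\<lambda>c. 0)" using surj by metis+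
    then have "axis 1 1 = (0 :: real^2)" using injD[OF inj_dx[OF u], of "axis 1 1" 0] by simp
    then show False by (simp add: axis_eq_0_iff)
  qed
  moreover have "shape_operator_matrix A g N' x u B"
    unfolding shape_operator_matrix_def B N' using b by simp
  ultimately show ?thesis by blast
qed

lemma axis_expand: "(a::real^2) = a $ 1 *\<^sub>R axis 1 1 + a $ 2 *\<^sub>R axis 2 1"
  by (simp add: vec_eq_iff forall_2 axis_def)

text \<open>The coefficients solve the Gram system of the two partial derivatives, and Cramer's rule
  shows that they are smooth. Regularity enters through inner products with \<open>dx u b\<close>,
  because the Koszul formula in \<open>induced_connection\<close> supplies it in this form.\<close>

lemma smooth_coefficients:
  assumes Y: "\<And>u. u \<in> W \<Longrightarrow> Y u \<in> TS u" "\<And>u. u \<in> W \<Longrightarrow> ip u (N u) (Y u) = 0"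
    and smooth: "\<And>b. smooth_on W (\<lambda>u. ip u (Y u) (dx u b))"
  obtains \<tau> where "smooth_on W \<tau>" "\<And>u. u \<in> W \<Longrightarrow> Y u = dx u (\<tau> u)"
proof -
  obtain \<tau> where \<tau>: "\<And>u. u \<in> W \<Longrightarrow> Y u = dx u (\<tau> u)"
    using orthogonal_imp_differential[OF _ Y] by metis
  define e1 e2 :: "real^2" where "e1 = axis 1 1" and "e2 = axis 2 1"
  define E F G where "E u = ip u (dx u e1) (dx u e1)" and "F u = ip u (dx u e1) (dx u e2)"
    and "G u = ip u (dx u e2) (dx u e2)" for u
  define p q where "p u = ip u (Y u) (dx u e1)" and "q u = ip u (Y u) (dx u e2)" for u
  define \<Delta> where "\<Delta> u = E u * G u - F u * F u" for u
  have F': "ip u (dx u e2) (dx u e1) = F u" if "u \<in> W" for u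
    unfolding F_def by (rule riem_inner_commute[OF x_mem dx_tangent dx_tangent]) (use that in auto)
  have \<Delta>: "\<Delta> u \<noteq> 0" if u: "u \<in> W" for u
  proof -
    have ne: "dx u v \<noteq> (\<lambda>c. 0)" if "v \<noteq> 0" for v
    proof
      assume "dx u v = (\<lambda>c. 0)"
      moreover have "dx u 0 = (\<lambda>c. 0)" using dx_lin[OF u, of 0 0 0 0] by simp
      ultimately show False using inj_dx[OF u] \<open>v \<noteq> 0\<close> by (metis injD)
    qed
    have E: "E u > 0"
      unfolding E_def by (rule riem_inner_pos[OF x_mem[OF u] dx_tangent[OF u] ne]) (simp add: e1_def axis_eq_0_iff)
    \<comment> \<open>The Gram-Schmidt combination: its image under \<open>dx u\<close> is
      orthogonal to \<open>dx u e1\<close> and has squared length \<open>E u * \<Delta> u\<close>,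
      so positivity of the metric gives \<open>\<Delta> u > 0\<close>.\<close>
    have "E u *\<^sub>R e2 + (- F u) *\<^sub>R e1 \<noteq> 0"
      using E by (auto simp: vec_eq_iff forall_2 e1_def e2_def axis_def)
    from riem_inner_pos[OF x_mem[OF u] dx_tangent[OF u] ne[OF this]]
    have "0 < E u * (E u * G u - F u * F u)"
      unfolding dx_lin[OF u] riem_inner_lincomb_left riem_inner_lincomb_right F'[OF u]
      by (simp add: E_def[symmetric] F_def[symmetric] G_def[symmetric] algebra_simps)
    then show ?thesis unfolding \<Delta>_def by auto
  qed
  have Gram: "p u = \<tau> u $ 1 * E u + \<tau> u $ 2 * F u" "q u = \<tau> u $ 1 * F u + \<tau> u $ 2 * G u" if u: "u \<in> W" for u
  proof -
    have "Y u = (\<lambda>c. \<tau> u $ 1 *\<^sub>R dx u e1 c + \<tau> u $ 2 *\<^sub>R dx u e2 c)"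
      unfolding \<tau>[OF u] e1_def e2_def by (subst axis_expand[of "\<tau> u"]) (rule dx_lin[OF u])
    then show "p u = \<tau> u $ 1 * E u + \<tau> u $ 2 * F u" "q u = \<tau> u $ 1 * F u + \<tau> u $ 2 * G u"
      unfolding p_def q_def by (simp_all add: riem_inner_lincomb_left F'[OF u] E_def F_def G_def)
  qed
  have EFG: "smooth_on W E" "smooth_on W F" "smooth_on W G" "smooth_on W p" "smooth_on W q"
    unfolding E_def F_def G_def p_def q_def by (intro riem_inner_smooth[OF x dx_field dx_field] smooth)+
  note mult = bounded_bilinear.Ck_on[OF bounded_bilinear_mult open_W]
  have minus: "Ck_on k W (\<lambda>u. f u - h u)" if "Ck_on k W f" "Ck_on k W h" for k and f h :: "real^2 \<Rightarrow> real"
    using Ck_on_add[OF open_W that(1) Ck_on_bounded_linear[OF bounded_linear_minus[OF bounded_linear_ident] open_W that(2)]]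
    by simp
  have "Ck_on k W \<tau>" for k
  proof (rule Ck_on_vec[OF open_W])
    fix i :: 2
    note S = EFG[THEN smooth_on_imp_Ck, of k]
    have "Ck_on k W \<Delta>" unfolding \<Delta>_def by (intro minus mult S)
    from Ck_on_inverse[OF open_W \<Delta> this] have inv: "Ck_on k W (\<lambda>u. inverse (\<Delta> u))" .
    have sol: "(p u * G u - q u * F u) * inverse (\<Delta> u) = \<tau> u $ 1" "(q u * E u - p u * F u) * inverse (\<Delta> u) = \<tau> u $ 2"
      if "u \<in> W" for u
      using \<Delta>[OF that] unfolding Gram[OF that] by (simp_all add: \<Delta>_def divide_simps) (simp_all add: algebra_simps)
    have "Ck_on k W (\<lambda>u. (p u * G u - q u * F u) * inverse (\<Delta> u))"
      "Ck_on k W (\<lambda>u. (q u * E u - p u * F u) * inverse (\<Delta> u))" by (intro mult minus S inv)+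
    from Ck_on_cong[OF open_W sol(1) this(1)] Ck_on_cong[OF open_W sol(2) this(2)]
    have "Ck_on k W (\<lambda>u. \<tau> u $ 1)" "Ck_on k W (\<lambda>u. \<tau> u $ 2)" by blast+
    then show "Ck_on k W (\<lambda>u. \<tau> u $ i)" using exhaust_2[of i] by auto
  qed
  then have "smooth_on W \<tau>" by (simp add: smooth_on_def)
  then show thesis using that \<tau> by blast
qed

end

section \<open>Rulings by geodesics\<close>

context constant_angle_patch
begin

text \<open>The velocity \<open>\<omega>\<close> is a separate function so that its derivative can
  be read off the differential equation, be it the field along its integral curve or the second
  component of a first-order system.\<close>

lemma curve_acceleration:
  fixes \<sigma> \<omega> :: "real \<Rightarrow> real^2"
  assumes I: "open I" "s \<in> I" and \<sigma>: "\<And>r. r \<in> I \<Longrightarrow> \<sigma> r \<in> W"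
    "\<And>r. r \<in> I \<Longrightarrow> (\<sigma> has_vector_derivative \<omega> r) (at r)" and \<omega>: "(\<omega> has_vector_derivative \<omega>') (at s)"
  shows "cov_deriv A g (x \<circ> \<sigma>) (\<lambda>s. differential A (x \<circ> \<sigma>) s 1) s 1 =
    (\<lambda>c. nab (\<lambda>u. dx u (\<omega> s)) (\<sigma> s) (\<omega> s) c + dx (\<sigma> s) \<omega>' c)"
proof -
  have "differential A (x \<circ> \<sigma>) r 1 = dx (\<sigma> r) (\<omega> r)" if "r \<in> I" for r
    using differential_compose[OF x \<sigma>(1)[OF that] \<sigma>(2)[OF that, unfolded has_vector_derivative_def], of 1] by simp
  then have "cov_deriv A g (x \<circ> \<sigma>) (\<lambda>s. differential A (x \<circ> \<sigma>) s 1) s 1 =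
      cov_deriv A g (x \<circ> \<sigma>) (\<lambda>s. dx (\<sigma> s) (\<omega> s)) s 1"
    by (rule cov_deriv_cong[OF I])
  also have "\<dots> = (\<lambda>c. nab (\<lambda>u. dx u (\<omega> s)) (\<sigma> s) (\<omega> s) c + dx (\<sigma> s) \<omega>' c)"
    using cov_deriv_differential_compose[OF x \<sigma>(1)[OF I(2)] \<sigma>(2)[OF I(2), unfolded has_vector_derivative_def]
        \<omega>[unfolded has_vector_derivative_def], of 1] by simp
  finally show ?thesis .
qed

lemma nab_dx_product:
  assumes u: "u \<in> W" and \<tau>: "(\<tau> has_derivative \<tau>') (at u)"
  shows "nab (\<lambda>u. dx u (\<tau> u)) u a = (\<lambda>c. nab (\<lambda>w. dx w (\<tau> u)) u a c + dx u (\<tau>' a) c)"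
  using cov_deriv_differential_compose[where \<sigma> = "\<lambda>u. u", OF x u has_derivative_ident \<tau>, of a]
  by (simp add: o_def)

text \<open>Self-adjointness of the shape operator, tested against its kernel.\<close>

lemma nab_N_kernel:
  assumes u: "u \<in> W" and \<tau>: "T u = dx u \<tau>"
  shows "nab N u \<tau> = (\<lambda>c. 0)"
proof -
  have comm: "ip u (N u) (nab (\<lambda>u. dx u b) u a) = - ip u (nab N u a) (dx u b)" for a b
    using ip_const_derivative[OF N dx_field u, of b 0 a] N_normal by simp
  \<comment> \<open>The vector that should vanish is tangent to the surface. It is paired with
    itself in the form \<open>dx u b\<close>, so that \<open>b\<close> and \<open>\<tau>\<close> can
    be exchanged by the symmetry of second derivatives, which brings in \<open>T\<close>.\<close>
  obtain b where b: "nab N u \<tau> = dx u b"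
    using orthogonal_imp_differential[OF u nab_N_tangent[OF u], of \<tau>] nab_N_N[OF u, of \<tau>]
      ip_commute[OF u nab_N_tangent[OF u] N_tangent[OF u], of \<tau>] by auto
  have "ip u (nab N u \<tau>) (dx u b) = - ip u (N u) (nab (\<lambda>u. dx u b) u \<tau>)" by (simp add: comm)
  also have "\<dots> = - ip u (N u) (nab (\<lambda>u. dx u \<tau>) u b)" by (simp add: cov_deriv_differential_sym[OF x u, of b])
  also have "\<dots> = ip u (nab N u b) (T u)" by (simp add: comm \<tau>)
  also have "\<dots> = 0" by (rule nab_N_T[OF u])
  finally have "ip u (nab N u \<tau>) (nab N u \<tau>) = 0" by (simp add: b)
  then show ?thesis by (rule riem_inner_self_eq_0[OF x_mem[OF u] nab_N_tangent[OF u]])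
qed

lemma ruling_nonunit_cosine:
  assumes C: "C\<^sup>2 \<noteq> 1" and q: "q \<in> W"
  obtains e h v w where "e > 0" "smooth_on ({-e<..<e} \<times> {-e<..<e}) h"
    "\<And>s t. s \<in> {-e<..<e} \<Longrightarrow> t \<in> {-e<..<e} \<Longrightarrow> h (s, t) \<in> W" "h (0, 0) = q"
    "((\<lambda>s. h (s, 0)) has_vector_derivative v) (at 0)" "((\<lambda>t. h (0, t)) has_vector_derivative w) (at 0)"
    "v $ 1 * w $ 2 - v $ 2 * w $ 1 \<noteq> 0"
    "\<And>s t. s \<in> {-e<..<e} \<Longrightarrow> t \<in> {-e<..<e} \<Longrightarrow> cov_deriv A g (\<lambda>s. x (h (s, t)))
        (\<lambda>s. differential A (\<lambda>s. x (h (s, t))) s 1) s 1 = (\<lambda>c. 0)"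
proof -
  obtain \<tau> where \<tau>: "smooth_on W \<tau>" "\<And>u. u \<in> W \<Longrightarrow> T u = dx u (\<tau> u)"
    using smooth_coefficients[OF T_tangent T_normal riem_inner_smooth[OF x T_field dx_field]] by metis
  have d\<tau>: "(\<tau> has_derivative frechet_derivative \<tau> (at u)) (at u)" if "u \<in> W" for u
    by (rule smooth_on_has_derivative[OF \<tau>(1) that])
  \<comment> \<open>The vanishing of the derivative of \<open>T\<close> along itself, split into the
    two summands in which \<open>curve_acceleration\<close> presents the acceleration of an integral
    curve.\<close>
  have auto_parallel: "(\<lambda>c. nab (\<lambda>w. dx w (\<tau> u)) u (\<tau> u) c + dx u (frechet_derivative \<tau> (at u) (\<tau> u)) c) = (\<lambda>c. 0)"
    if u: "u \<in> W" for u
  proof -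
    have "nab T u (\<tau> u) = (\<lambda>c. 0)"
      unfolding nab_T[OF u] nab_N_kernel[OF u \<tau>(2)[OF u]] by simp
    moreover have "nab T u (\<tau> u) = nab (\<lambda>w. dx w (\<tau> w)) u (\<tau> u)"
      by (rule cov_deriv_cong[OF open_W u \<tau>(2)])
    ultimately show ?thesis using nab_dx_product[OF u d\<tau>[OF u], of "\<tau> u"] by simp
  qed
  have \<tau>q: "\<tau> q \<noteq> 0"
  proof
    assume "\<tau> q = 0"
    moreover have "dx q 0 = (\<lambda>c. 0)" using dx_lin[OF q, of 0 0 0 0] by simp
    ultimately have "T q = (\<lambda>c. 0)" using \<tau>(2)[OF q] by simp
    then show False using T_norm[OF q] C by simp
  qed
  \<comment> \<open>\<open>\<tau> q\<close> turned by a right angle: the determinant of the two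
    directions is the squared Euclidean length of \<open>\<tau> q\<close>.\<close>
  define n :: "real^2" where "n = vector [- \<tau> q $ 2, \<tau> q $ 1]"
  define u0 where "u0 t = q + t *\<^sub>R n" for t :: real
  have u0: "smooth_on UNIV u0"
    unfolding u0_def
    by (intro smooth_on_add smooth_on_const smooth_on_bounded_linear[OF bounded_linear_scaleR_left]) auto
  have "u0 0 \<in> W" using q by (simp add: u0_def)
  from ode_smooth_solution_family[OF open_W \<tau>(1) u0 this]
  obtain e h where e: "e > 0" and h: "smooth_on ({-e<..<e} \<times> {-e<..<e}) h"
    and h0: "\<And>t. t \<in> {-e<..<e} \<Longrightarrow> h (0, t) = u0 t"
    and hW: "\<And>s t. s \<in> {-e<..<e} \<Longrightarrow> t \<in> {-e<..<e} \<Longrightarrow> h (s, t) \<in> W"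
    and hd: "\<And>s t. s \<in> {-e<..<e} \<Longrightarrow> t \<in> {-e<..<e} \<Longrightarrow>
      ((\<lambda>s. h (s, t)) has_vector_derivative \<tau> (h (s, t))) (at s)"
    by metis
  have h00: "h (0, 0) = q" using h0[of 0] e by (simp add: u0_def)
  show thesis
  proof (rule that[OF e h hW h00])
    show "((\<lambda>s. h (s, 0)) has_vector_derivative \<tau> q) (at 0)" using hd[of 0 0] e h00 by simp
    have "(u0 has_vector_derivative n) (at 0)" unfolding u0_def by (auto intro!: derivative_eq_intros)
    then show "((\<lambda>t. h (0, t)) has_vector_derivative n) (at 0)"
      by (rule has_vector_derivative_transform_within_open[of _ _ _ "{-e<..<e}"]) (use e h0 in auto)
    have "\<tau> q $ 1 * \<tau> q $ 1 + \<tau> q $ 2 * \<tau> q $ 2 \<noteq> 0"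
      using \<tau>q by (auto simp: vec_eq_iff forall_2)
    then show "\<tau> q $ 1 * n $ 2 - \<tau> q $ 2 * n $ 1 \<noteq> 0" by (simp add: n_def)
  next
    fix s t assume s: "s \<in> {-e<..<e}" and t: "t \<in> {-e<..<e}"
    have "((\<lambda>s. \<tau> (h (s, t))) has_vector_derivative frechet_derivative \<tau> (at (h (s, t))) (\<tau> (h (s, t)))) (at s)"
    proof -
      have l: "linear (frechet_derivative \<tau> (at (h (s, t))))"
        by (rule has_derivative_linear[OF d\<tau>[OF hW[OF s t]]])
      from has_derivative_compose[OF hd[OF s t, unfolded has_vector_derivative_def] d\<tau>[OF hW[OF s t]]]
      show ?thesis by (simp add: has_vector_derivative_def linear_scale[OF l])
    qed
    from curve_acceleration[OF open_greaterThanLessThan s hW[OF _ t] hd[OF _ t] this]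
    show "cov_deriv A g (\<lambda>s. x (h (s, t))) (\<lambda>s. differential A (\<lambda>s. x (h (s, t))) s 1) s 1 = (\<lambda>c. 0)"
      unfolding auto_parallel[OF hW[OF s t]] by (simp add: o_def)
  qed
qed

text \<open>When \<^term>\<open>V\<close> is normal to the surface, the surface is totally geodesic and
  its Christoffel symbols \<open>\<kappa>\<close> come from the Koszul formula.\<close>

lemma induced_connection:
  assumes C: "C\<^sup>2 = 1"
  shows "\<exists>\<kappa>. smooth_on W \<kappa> \<and> (\<forall>u\<in>W. nab (\<lambda>u. dx u b) u a = dx u (\<kappa> u))"
proof -
  define Y where "Y u = nab (\<lambda>u. dx u b) u a" for u
  define I where "I a b u = ip u (dx u a) (dx u b)" for a b u
  have I_smooth: "smooth_on W (I a b)" for a b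
    unfolding I_def by (rule riem_inner_smooth[OF x dx_field dx_field])
  have I_deriv: "frechet_derivative (I a b) (at u) c =
      ip u (nab (\<lambda>u. dx u a) u c) (dx u b) + ip u (dx u a) (nab (\<lambda>u. dx u b) u c)" if "u \<in> W" for a b c u
    using fun_cong[OF frechet_derivative_at[OF riem_inner_has_derivative[OF x dx_field dx_field that]]]
    unfolding I_def by metis
  have Y_tangent: "Y u \<in> TS u" if "u \<in> W" for u unfolding Y_def by (rule nab_dx_tangent[OF that])
  \<comment> \<open>The normal is parallel, so the second fundamental form vanishes and the second
    covariant derivatives of \<open>x\<close> are tangent to the surface.\<close>
  have Y_normal: "ip u (N u) (Y u) = 0" if u: "u \<in> W" for u
    using ip_const_derivative[OF N dx_field u, of b 0 a] N_normal nab_N_zero_of_unit_cosine[OF C u, of a]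
    by (simp add: Y_def)
  \<comment> \<open>By the symmetry of second covariant derivatives, four of the six terms cancel
    and the other two coincide; hence the factor 1/2.\<close>
  have Koszul: "(1/2) * (frechet_derivative (I b c) (at u) a + frechet_derivative (I a c) (at u) b
      + - frechet_derivative (I a b) (at u) c) = ip u (Y u) (dx u c)" if u: "u \<in> W" for u c
  proof -
    have comm: "ip u (dx u p) (nab (\<lambda>u. dx u r) u s) = ip u (nab (\<lambda>u. dx u r) u s) (dx u p)" for p r s
      by (rule ip_commute[OF u dx_tangent[OF u] nab_dx_tangent[OF u]])
    show ?thesis
      unfolding I_deriv[OF u] comm Y_def cov_deriv_differential_sym[OF x u, of c a]
        cov_deriv_differential_sym[OF x u, of c b] cov_deriv_differential_sym[OF x u, of a b]
      by simp
  qed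
  have "smooth_on W (\<lambda>u. ip u (Y u) (dx u c))" for c
  proof -
    have "smooth_on W (\<lambda>u. (1/2) *\<^sub>R (frechet_derivative (I b c) (at u) a + frechet_derivative (I a c) (at u) b
      + - frechet_derivative (I a b) (at u) c))"
      by (intro smooth_on_add smooth_on_minus smooth_on_scaleR smooth_on_const smooth_on_derivative I_smooth open_W)
    then have "Ck_on k W (\<lambda>u. ip u (Y u) (dx u c))" for k
      unfolding smooth_on_def real_scaleR_def by (intro Ck_on_cong[OF open_W Koszul]) auto
    then show ?thesis by (simp add: smooth_on_def)
  qed
  from smooth_coefficients[OF Y_tangent Y_normal this] show ?thesis unfolding Y_def by metis
qed

lemma ruling_unit_cosine:
  assumes C: "C\<^sup>2 = 1" and q: "q \<in> W"
  obtains e h v w where "e > 0" "smooth_on ({-e<..<e} \<times> {-e<..<e}) h"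
    "\<And>s t. s \<in> {-e<..<e} \<Longrightarrow> t \<in> {-e<..<e} \<Longrightarrow> h (s, t) \<in> W" "h (0, 0) = q"
    "((\<lambda>s. h (s, 0)) has_vector_derivative v) (at 0)" "((\<lambda>t. h (0, t)) has_vector_derivative w) (at 0)"
    "v $ 1 * w $ 2 - v $ 2 * w $ 1 \<noteq> 0"
    "\<And>s t. s \<in> {-e<..<e} \<Longrightarrow> t \<in> {-e<..<e} \<Longrightarrow> cov_deriv A g (\<lambda>s. x (h (s, t)))
        (\<lambda>s. differential A (\<lambda>s. x (h (s, t))) s 1) s 1 = (\<lambda>c. 0)"
proof -
  have "\<forall>a b. \<exists>\<kappa>. smooth_on W \<kappa> \<and> (\<forall>u\<in>W. nab (\<lambda>u. dx u b) u a = dx u (\<kappa> u))"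
    using induced_connection[OF C] by blast
  then obtain \<kappa> where \<kappa>: "\<And>a b. smooth_on W (\<kappa> a b)"
    "\<And>a b u. u \<in> W \<Longrightarrow> nab (\<lambda>u. dx u b) u a = dx u (\<kappa> a b u)"
    by (subst (asm) choice_iff, subst (asm) choice_iff) blast
  define e1 e2 :: "real^2" where "e1 = axis 1 1" and "e2 = axis 2 1"
  \<comment> \<open>The maps \<open>\<kappa> a b\<close> are chosen for each pair \<open>a\<close>,
    \<open>b\<close> separately, without control of the dependence on the pair. Extending from the
    basis makes the coefficient quadratic, hence smooth, in the velocity \<open>w\<close>.\<close>
  define \<Gamma> where "\<Gamma> u w = (w $ 1) *\<^sub>R ((w $ 1) *\<^sub>R \<kappa> e1 e1 u + (w $ 2) *\<^sub>R \<kappa> e2 e1 u)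
    + (w $ 2) *\<^sub>R ((w $ 1) *\<^sub>R \<kappa> e1 e2 u + (w $ 2) *\<^sub>R \<kappa> e2 e2 u)" for u and w :: "real^2"
  have nab_dx: "nab (\<lambda>u. dx u w) u w = dx u (\<Gamma> u w)" if u: "u \<in> W" for u w
  proof -
    have 1: "nab (\<lambda>u. dx u b) u w = dx u ((w $ 1) *\<^sub>R \<kappa> e1 b u + (w $ 2) *\<^sub>R \<kappa> e2 b u)" for b
      unfolding dx_lin[OF u] \<kappa>(2)[OF u, symmetric] e1_def e2_def
      by (subst axis_expand[of w]) (rule cov_deriv_smooth_linear[OF x dx_field u])
    have "dx v w = (\<lambda>c. (w $ 1) *\<^sub>R dx v e1 c + (w $ 2) *\<^sub>R dx v e2 c)" if "v \<in> W" for v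
      unfolding e1_def e2_def by (subst axis_expand[of w]) (rule dx_lin[OF that])
    then have "nab (\<lambda>u. dx u w) u w = nab (\<lambda>u c. (w $ 1) *\<^sub>R dx u e1 c + (w $ 2) *\<^sub>R dx u e2 c) u w"
      by (rule cov_deriv_cong[OF open_W u])
    also have "\<dots> = dx u (\<Gamma> u w)"
      unfolding cov_deriv_lincomb[OF dx_field dx_field u] 1 \<Gamma>_def by (rule dx_lin[OF u, symmetric])
    finally show ?thesis .
  qed
  \<comment> \<open>The geodesic equation of the surface as an autonomous first-order system for
    position and velocity.\<close>
  define f where "f p = (snd p, - \<Gamma> (fst p) (snd p))" for p
  \<comment> \<open>The geodesics leave the coordinate line through \<open>q\<close> in direction
    \<open>e2\<close> with velocity \<open>e1\<close>, so the determinant of the two directions is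
    1.\<close>
  define u0 where "u0 t = (q + t *\<^sub>R e2, e1)" for t :: real
  let ?U = "W \<times> (UNIV :: (real^2) set)"
  have oU: "open ?U" using open_W by (intro open_Times) auto
  have "smooth_on ?U f"
  proof -
    have k: "smooth_on ?U (\<lambda>p. \<kappa> a b (fst p))" for a b
      by (rule smooth_on_compose[where f = fst, OF oU open_W _ smooth_on_bounded_linear[OF bounded_linear_fst] \<kappa>(1)]) auto
    have c: "smooth_on ?U (\<lambda>p. snd p $ i)" for i
      by (rule smooth_on_bounded_linear[OF bounded_linear_compose[OF bounded_linear_vec_nth bounded_linear_snd]])
    show ?thesis
      unfolding f_def \<Gamma>_def
      by (intro smooth_on_add smooth_on_Pair smooth_on_minus smooth_on_scaleR oU k c smooth_on_bounded_linear[OF bounded_linear_snd])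
  qed
  moreover have "smooth_on UNIV u0"
    unfolding u0_def
    by (intro smooth_on_add smooth_on_Pair smooth_on_const smooth_on_bounded_linear[OF bounded_linear_scaleR_left]) auto
  moreover have "u0 0 \<in> ?U" using q by (simp add: u0_def)
  ultimately obtain e u where e: "e > 0" and u: "smooth_on ({-e<..<e} \<times> {-e<..<e}) u"
    and u0': "\<And>t. t \<in> {-e<..<e} \<Longrightarrow> u (0, t) = u0 t"
    and uW: "\<And>s t. s \<in> {-e<..<e} \<Longrightarrow> t \<in> {-e<..<e} \<Longrightarrow> u (s, t) \<in> ?U"
    and ud: "\<And>s t. s \<in> {-e<..<e} \<Longrightarrow> t \<in> {-e<..<e} \<Longrightarrow>
      ((\<lambda>s. u (s, t)) has_vector_derivative f (u (s, t))) (at s)"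
    using ode_smooth_solution_family[OF oU] by metis
  define h where "h p = fst (u p)" for p
  have hW: "h (s, t) \<in> W" if "s \<in> {-e<..<e}" "t \<in> {-e<..<e}" for s t
    using uW[OF that] by (auto simp: h_def mem_Times_iff)
  have hd: "((\<lambda>s. h (s, t)) has_vector_derivative snd (u (s, t))) (at s)"
    if "s \<in> {-e<..<e}" "t \<in> {-e<..<e}" for s t
    using bounded_linear.has_vector_derivative[OF bounded_linear_fst ud[OF that]] by (simp add: h_def f_def)
  have h00: "h (0, 0) = q" "snd (u (0, 0)) = e1" using u0'[of 0] e by (simp_all add: u0_def h_def)
  have "open ({-e<..<e} \<times> {-e<..<e})" by (intro open_Times) auto
  then have h: "smooth_on ({-e<..<e} \<times> {-e<..<e}) h"
    using u unfolding h_def smooth_on_def by (blast intro: Ck_on_bounded_linear[OF bounded_linear_fst])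
  show thesis
  proof (rule that[OF e h hW h00(1)])
    show "((\<lambda>s. h (s, 0)) has_vector_derivative e1) (at 0)" using hd[of 0 0] e h00 by simp
    have "((\<lambda>t. q + t *\<^sub>R e2) has_vector_derivative e2) (at 0)" by (auto intro!: derivative_eq_intros)
    then show "((\<lambda>t. h (0, t)) has_vector_derivative e2) (at 0)"
      by (rule has_vector_derivative_transform_within_open[of _ _ _ "{-e<..<e}"])
        (use e u0' in \<open>auto simp: h_def u0_def\<close>)
    show "e1 $ 1 * e2 $ 2 - e1 $ 2 * e2 $ 1 \<noteq> 0" by (simp add: e1_def e2_def axis_def)
  next
    fix s t assume s: "s \<in> {-e<..<e}" and t: "t \<in> {-e<..<e}"
    have wd: "((\<lambda>s. snd (u (s, t))) has_vector_derivative - \<Gamma> (h (s, t)) (snd (u (s, t)))) (at s)"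
      using bounded_linear.has_vector_derivative[OF bounded_linear_snd ud[OF s t]] by (simp add: h_def f_def)
    have minus: "dx v (- a) = (\<lambda>c. - dx v a c)" if "v \<in> W" for v a
      using dx_lin[OF that, of "-1" a 0 a] by simp
    from curve_acceleration[OF open_greaterThanLessThan s hW[OF _ t] hd[OF _ t] wd]
    show "cov_deriv A g (\<lambda>s. x (h (s, t))) (\<lambda>s. differential A (\<lambda>s. x (h (s, t))) s 1) s 1 = (\<lambda>c. 0)"
      unfolding nab_dx[OF hW[OF s t]] minus[OF hW[OF s t]] by (simp add: o_def)
  qed
qed

end

section \<open>Reparametrization of surfaces\<close>

lemma smooth_map_compose:
  fixes h :: "'b::real_normed_vector \<Rightarrow> 'a::euclidean_space"
  assumes "smooth_manifold X A" and x: "smooth_map X A W x" and I: "open I" and h: "smooth_on I h" and hW: "h ` I \<subseteq> W"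
  shows "smooth_map X A I (x \<circ> h)"
proof -
  interpret smooth_manifold X A by fact
  have hc: "continuous_on I h" by (rule Ck_on_imp_continuous_on[OF smooth_on_imp_Ck[OF h, of 0]])
  have "continuous_map (top_of_set I) (top_of_set W) h"
    using hc hW by (simp add: image_subset_iff_funcset)
  moreover have "continuous_map (top_of_set W) X x" using x by (simp add: smooth_map_def)
  ultimately have c: "continuous_map (top_of_set I) X (x \<circ> h)" by (rule continuous_map_compose)
  have "smooth_on {u \<in> I. (x \<circ> h) u \<in> fst c} (snd c \<circ> (x \<circ> h))" if cA: "c \<in> A" for c
  proof -
    let ?I = "{u \<in> I. (x \<circ> h) u \<in> fst c}"
    have "?I = I \<inter> h -` {u \<in> W. x u \<in> fst c}" using hW by auto
    then have oI: "open ?I"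
      using continuous_open_preimage[OF hc I smooth_map_open[OF x cA]] by simp
    have "smooth_on ?I (\<lambda>u. (snd c \<circ> x) (h u))"
      by (rule smooth_on_compose[OF oI smooth_map_open[OF x cA] _ smooth_on_subset[OF h] smooth_map_chart[OF x cA]])
        (use hW in auto)
    then show ?thesis by (simp add: o_def)
  qed
  then show ?thesis using c I by (simp add: smooth_map_def)
qed

lemma surface_param_reparametrization:
  assumes X: "smooth_manifold X A" and x: "surface_param X A S W x" and Q: "open Q" "open R" "R \<subseteq> W"
    and H: "smooth_on Q H" "homeomorphism Q R H G" "\<And>u. u \<in> Q \<Longrightarrow> inj (frechet_derivative H (at u))"
  shows "surface_param X A S Q (x \<circ> H)"
  unfolding surface_param_def
proof (intro conjI ballI)
  interpret smooth_manifold X A by (rule X)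
  have x': "smooth_map X A W x" "openin (subtopology X S) (x ` W)"
    "homeomorphic_map (top_of_set W) (subtopology X (x ` W)) x" "\<And>u. u \<in> W \<Longrightarrow> inj (differential A x u)"
    using x by (auto simp: surface_param_def)
  have HQ: "H ` Q = R" using H(2) by (simp add: homeomorphism_def)
  show "smooth_map X A Q (x \<circ> H)"
    by (rule smooth_map_compose[OF X x'(1) Q(1) H(1)]) (simp add: HQ Q(3))
  have xX: "x ` W \<subseteq> topspace X" using x'(1) by (auto simp: smooth_map_def continuous_map_def)
  have xS: "x ` W \<subseteq> S" using openin_subset[OF x'(2)] by simp
  have "openin (top_of_set W) R" by (rule open_subset[OF Q(3,2)])
  then have "openin (subtopology X (x ` W)) (x ` R)"
    using homeomorphic_imp_open_map[OF x'(3)] by (simp add: open_map_def)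
  moreover have "subtopology X (x ` W) = subtopology (subtopology X S) (x ` W)"
    using xS by (simp add: subtopology_subtopology Int_absorb1)
  ultimately have "openin (subtopology (subtopology X S) (x ` W)) (x ` R)" by simp
  from openin_trans_full[OF this x'(2)] have "openin (subtopology X S) (x ` R)" .
  moreover have img: "(x \<circ> H) ` Q = x ` R" by (simp only: image_comp[symmetric] HQ)
  ultimately show "openin (subtopology X S) ((x \<circ> H) ` Q)" by simp
  have "homeomorphic_map (top_of_set Q) (top_of_set R) H"
    unfolding homeomorphic_map_maps homeomorphic_maps_def using H(2)
    by (intro exI[of _ G]) (auto simp: homeomorphism_def)
  moreover have "homeomorphic_map (subtopology (top_of_set W) R) (subtopology (subtopology X (x ` W)) (x ` R)) x"
    by (rule homeomorphic_map_subtopologies[OF x'(3)]) (use xX Q(3) in auto)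
  then have "homeomorphic_map (top_of_set R) (subtopology X (x ` R)) x"
    using Q(3) by (simp add: subtopology_subtopology Int_absorb1 image_mono)
  ultimately show "homeomorphic_map (top_of_set Q) (subtopology X ((x \<circ> H) ` Q)) (x \<circ> H)"
    unfolding img by (rule homeomorphic_map_compose)
  fix u assume u: "u \<in> Q"
  then have Hu: "H u \<in> W" using HQ Q(3) by auto
  have "differential A (x \<circ> H) u = differential A x (H u) \<circ> frechet_derivative H (at u)"
    by (rule ext) (simp add: differential_compose[OF x'(1) Hu smooth_on_has_derivative[OF H(1) u]])
  then show "inj (differential A (x \<circ> H) u)" using x'(4)[OF Hu] H(3)[OF u] by (simp add: inj_compose)
qed

context constant_angle_patch
begin

text \<open>The common interface of the two cases. Independence of \<open>v\<close> and
  \<open>w\<close> at the centre is what will make the family of curves a local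
  diffeomorphism.\<close>

lemma ruling:
  assumes q: "q \<in> W"
  obtains e h v w where "e > 0" "smooth_on ({-e<..<e} \<times> {-e<..<e}) h"
    "\<And>s t. s \<in> {-e<..<e} \<Longrightarrow> t \<in> {-e<..<e} \<Longrightarrow> h (s, t) \<in> W" "h (0, 0) = q"
    "((\<lambda>s. h (s, 0)) has_vector_derivative v) (at 0)" "((\<lambda>t. h (0, t)) has_vector_derivative w) (at 0)"
    "v $ 1 * w $ 2 - v $ 2 * w $ 1 \<noteq> 0"
    "\<And>s t. s \<in> {-e<..<e} \<Longrightarrow> t \<in> {-e<..<e} \<Longrightarrow> cov_deriv A g (\<lambda>s. x (h (s, t)))
        (\<lambda>s. differential A (\<lambda>s. x (h (s, t))) s 1) s 1 = (\<lambda>c. 0)"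
proof (cases "C\<^sup>2 = 1")
  case True
  show thesis by (rule ruling_unit_cosine[OF True q]) (rule that; assumption)
next
  case False
  show thesis by (rule ruling_nonunit_cosine[OF False q]) (rule that; assumption)
qed

text \<open>The ruled chart is \<open>x\<close> composed with the family of curves, whose derivative
  at the origin has columns \<open>v\<close> and \<open>w\<close>. The inverse function theorem
  applies, and its domain is cut down to a rectangle, as the notion of a ruled surface
  demands.\<close>

lemma ruled_parametrization:
  assumes S: "surface_param X A S W x" and q: "q \<in> W"
  shows "\<exists>a b y. surface_param X A S (box a b) y \<and> x q \<in> y ` box a b \<and>
    (\<forall>t\<in>{a$2<..<b$2}. geodesic_on X A g {a$1<..<b$1} (\<lambda>s. y (vector [s, t])))"
proof -
  obtain e h v w where e: "e > 0" and h: "smooth_on ({-e<..<e} \<times> {-e<..<e}) h"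
    and hW: "\<And>s t. s \<in> {-e<..<e} \<Longrightarrow> t \<in> {-e<..<e} \<Longrightarrow> h (s, t) \<in> W" and h0: "h (0, 0) = q"
    and hv: "((\<lambda>s. h (s, 0)) has_vector_derivative v) (at 0)"
    and hw: "((\<lambda>t. h (0, t)) has_vector_derivative w) (at 0)"
    and vw: "v $ 1 * w $ 2 - v $ 2 * w $ 1 \<noteq> 0"
    and geo: "\<And>s t. s \<in> {-e<..<e} \<Longrightarrow> t \<in> {-e<..<e} \<Longrightarrow> cov_deriv A g (\<lambda>s. x (h (s, t)))
        (\<lambda>s. differential A (\<lambda>s. x (h (s, t))) s 1) s 1 = (\<lambda>c. 0)"
    by (rule ruling[OF q]) blast
  \<comment> \<open>Passes from \<open>real^2\<close>, where surfaces are parametrized, to the pairs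
    of time and parameter on which solution families live.\<close>
  define L :: "real^2 \<Rightarrow> real \<times> real" where "L u = (u $ 1, u $ 2)" for u
  have L: "bounded_linear L" unfolding L_def by (intro bounded_linear_Pair bounded_linear_vec_nth)
  define H where "H u = h (L u)" for u
  let ?I = "{-e<..<e}"
  define U where "U = L -` (?I \<times> ?I)"
  have oI: "open (?I \<times> ?I)" by (intro open_Times) auto
  have U: "open U"
    unfolding U_def by (rule open_vimage[OF oI]) (rule linear_continuous_on[OF L])
  have H: "smooth_on U H"
    unfolding H_def by (rule smooth_on_compose[OF U oI _ smooth_on_bounded_linear[OF L] h]) (auto simp: U_def)
  have HW: "H u \<in> W" if "u \<in> U" for u using that hW by (auto simp: U_def H_def L_def)
  have U0: "0 \<in> U" using e by (simp add: U_def L_def)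
  let ?D = "frechet_derivative H (at 0)"
  have dH: "(H has_derivative ?D) (at 0)" by (rule smooth_on_has_derivative[OF H U0])
  have lin: "linear ?D" by (rule has_derivative_linear[OF dH])
  have D_dir: "((\<lambda>r. H (r *\<^sub>R d)) has_vector_derivative ?D d) (at 0)" for d
  proof -
    have "((\<lambda>r. r *\<^sub>R d) has_derivative (\<lambda>r. r *\<^sub>R d)) (at 0)" by (auto intro!: derivative_eq_intros)
    from has_derivative_compose[OF this, of H ?D] dH show ?thesis
      by (simp add: has_vector_derivative_def linear_scale[OF lin])
  qed
  have "?D (axis 1 1) = v"
    by (rule vector_derivative_unique_at[OF D_dir]) (use hv in \<open>simp add: H_def L_def axis_def\<close>)
  moreover have "?D (axis 2 1) = w"
    by (rule vector_derivative_unique_at[OF D_dir]) (use hw in \<open>simp add: H_def L_def axis_def\<close>)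
  ultimately have D: "?D a = a $ 1 *\<^sub>R v + a $ 2 *\<^sub>R w" for a
    by (subst axis_expand[of a]) (simp only: linear_add[OF lin] linear_scale[OF lin])
  have "inj ?D"
    unfolding linear_injective_0[OF lin]
  proof (intro allI impI)
    fix a assume "?D a = 0"
    then have "a $ 1 * v $ 1 + a $ 2 * w $ 1 = 0" "a $ 1 * v $ 2 + a $ 2 * w $ 2 = 0"
      by (auto simp: D vec_eq_iff)
    \<comment> \<open>Cramer's rule: each coordinate of \<open>a\<close> times the determinant
      vanishes.\<close>
    then have "a $ 1 * (v $ 1 * w $ 2 - v $ 2 * w $ 1) = 0" "a $ 2 * (v $ 1 * w $ 2 - v $ 2 * w $ 1) = 0"
      by algebra+
    then show "a = 0" using vw by (simp add: vec_eq_iff forall_2)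
  qed
  from smooth_local_diffeomorphism[OF U H U0 this]
  obtain U' R G where U': "open U'" "U' \<subseteq> U" "0 \<in> U'" "open R" "homeomorphism U' R H G"
    "\<And>u. u \<in> U' \<Longrightarrow> inj (frechet_derivative H (at u))" by blast
  obtain r where r: "r > 0" "ball 0 r \<subseteq> U'" using U' openE by blast
  obtain a b :: "real^2" where ab: "0 \<in> box a b" "box a b \<subseteq> U'" using rational_boxes[OF r(1), of 0] r(2) by blast
  let ?Q = "box a b"
  have abU: "?Q \<subseteq> U" using ab U' by blast
  have HQ: "homeomorphism ?Q (H ` ?Q) H G"
    by (rule homeomorphism_of_subsets[OF U'(5) ab(2)]) (use U'(5) ab(2) in \<open>auto simp: homeomorphism_def\<close>)
  have "openin (top_of_set U') ?Q" by (rule open_subset[OF ab(2) open_box])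
  from homeomorphism_imp_open_map[OF U'(5) this] have oHQ: "open (H ` ?Q)"
    using U'(4) openin_open_trans by blast
  have "surface_param X A S ?Q (x \<circ> H)"
    by (rule surface_param_reparametrization[OF smooth_manifold_axioms S open_box oHQ _ smooth_on_subset[OF H abU] HQ])
      (use HW abU ab U'(6) in auto)
  moreover have "x q \<in> (x \<circ> H) ` ?Q"
    using ab(1) h0 by (intro image_eqI[of _ _ 0]) (simp_all add: H_def L_def)
  moreover have "geodesic_on X A g {a$1<..<b$1} (\<lambda>s. (x \<circ> H) (vector [s, t]))" if t: "t \<in> {a$2<..<b$2}" for t
  proof -
    have st: "s \<in> ?I" "t \<in> ?I" if "s \<in> {a$1<..<b$1}" for s
    proof -
      have "vector [s, t] \<in> ?Q" using that t by (simp add: mem_box_cart forall_2)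
      then have "vector [s, t] \<in> U" using abU by blast
      then show "s \<in> ?I" "t \<in> ?I" by (auto simp: U_def L_def)
    qed
    have eq: "(\<lambda>s. (x \<circ> H) (vector [s, t])) = (\<lambda>s. x (h (s, t)))" by (simp add: H_def L_def)
    have "smooth_on {a$1<..<b$1} (\<lambda>s. (s, t))"
      by (intro smooth_on_Pair smooth_on_const smooth_on_bounded_linear[OF bounded_linear_ident]) auto
    then have "smooth_on {a$1<..<b$1} (\<lambda>s. h (s, t))"
      by (rule smooth_on_compose[OF _ oI _ _ h, rotated 2]) (use st in auto)
    moreover have "(\<lambda>s. h (s, t)) ` {a$1<..<b$1} \<subseteq> W"
      by (rule image_subsetI) (rule hW[OF st])
    ultimately have "smooth_map X A {a$1<..<b$1} (x \<circ> (\<lambda>s. h (s, t)))"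
      by (intro smooth_map_compose[OF smooth_manifold_axioms x]) auto
    then have "smooth_map X A {a$1<..<b$1} (\<lambda>s. x (h (s, t)))" by (simp add: o_def)
    moreover have "\<forall>s\<in>{a$1<..<b$1}. cov_deriv A g (\<lambda>s. x (h (s, t)))
        (\<lambda>s. differential A (\<lambda>s. x (h (s, t))) s 1) s 1 = (\<lambda>c. 0)"
      by (intro ballI geo st)
    ultimately show ?thesis unfolding eq geodesic_on_def by blast
  qed
  ultimately show ?thesis by blast
qed

end

section \<open>From the surface to its parametrizations\<close>

lemma surface_param_image: "surface_param X A S W x \<Longrightarrow> x ` W \<subseteq> S \<inter> topspace X"
  using openin_subset[of "subtopology X S" "x ` W"] by (auto simp: surface_param_def)

text \<open>\<open>cos\<close> undoes \<open>arccos\<close> on the interval from -1 to 1, so the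
  Cauchy-Schwarz inequality has to come first. For unit vectors with inner product \<open>y\<close>
  it follows from the squared length \<open>1 - y * y\<close> of the part of \<open>V\<close>
  orthogonal to \<open>\<nu>\<close>.\<close>

lemma (in riemannian_manifold) cosine_of_riem_angle:
  fixes \<nu> V :: "'m \<Rightarrow> ('m, 'n) tvec"
  assumes S: "surface_param X A S W x" and \<nu>: "unit_normal_field X A g S \<nu>"
    and V: "unit_vector_field_along X A g S V"
    and angle: "\<And>p. p \<in> S \<Longrightarrow> riem_angle A g p (V p) (\<nu> p) = \<theta>" and u: "u \<in> W"
  shows "riem_inner A g (x u) (V (x u)) (\<nu> (x u)) = cos \<theta>"
proof -
  let ?p = "x u" and ?ip = "riem_inner A g (x u)"
  have pS: "?p \<in> S" and pX: "?p \<in> topspace X"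
    using surface_param_image[OF S] u by blast+
  have t: "V ?p \<in> tangent_space A ?p" "\<nu> ?p \<in> tangent_space A ?p"
    using V \<nu> pS unfolding unit_vector_field_along_def unit_normal_field_def vector_field_along_def by blast+
  have n: "riem_norm A g ?p (V ?p) = 1" "riem_norm A g ?p (\<nu> ?p) = 1"
    using V \<nu> pS unfolding unit_vector_field_along_def unit_normal_field_def by blast+
  then have unit: "?ip (V ?p) (V ?p) = 1" "?ip (\<nu> ?p) (\<nu> ?p) = 1" by (auto simp: riem_norm_def)
  define y where "y = ?ip (V ?p) (\<nu> ?p)"
  have "0 \<le> ?ip (\<lambda>c. 1 *\<^sub>R V ?p c + (- y) *\<^sub>R \<nu> ?p c) (\<lambda>c. 1 *\<^sub>R V ?p c + (- y) *\<^sub>R \<nu> ?p c)"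
    by (rule riem_inner_nonneg[OF pX tangent_lincomb[OF t]])
  also have "\<dots> = 1 - y * y"
    unfolding riem_inner_lincomb_left riem_inner_lincomb_right unit riem_inner_commute[OF pX t(2,1)]
    by (simp add: y_def[symmetric] algebra_simps)
  finally have "\<bar>y\<bar> \<le> 1" by (simp add: abs_square_le_1[symmetric] power2_eq_square)
  moreover have "arccos y = \<theta>" using angle[OF pS] n by (simp add: riem_angle_def y_def)
  ultimately show ?thesis using cos_arccos_abs[of y] by (simp add: y_def)
qed

theorem theorem4:
  fixes X :: "'m topology" and A :: "('m, 3) chart set" and g :: "('m, 3) metric_coeffs"
    and S :: "'m set" and \<nu> :: "'m \<Rightarrow> ('m, 3) tvec"
  assumes "riemannian_manifold X A g"
    and "regular_surface X A S"
    and "unit_normal_field X A g S \<nu>"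
    and "constant_parallel_angle X A g S \<nu>"
  shows "extrinsically_flat X A g S \<nu> \<and> ruled_surface X A g S"
proof -
  interpret riemannian_manifold X A g by fact
  obtain V \<theta> where V: "unit_vector_field_along X A g S V" "parallel_along X A g S V"
    and \<theta>: "\<And>p. p \<in> S \<Longrightarrow> riem_angle A g p (V p) (\<nu> p) = \<theta>"
    using assms(4) by (auto simp: constant_parallel_angle_def)
  \<comment> \<open>The angle is one constant on all of \<open>S\<close>, so every parametrization
    yields a patch with the same cosine.\<close>
  have patch: "constant_angle_patch X A g W x (\<nu> \<circ> x) (V \<circ> x) (cos \<theta>)" if S: "surface_param X A S W x" for W x
  proof -
    have xS: "x u \<in> S" if "u \<in> W" for u
      using surface_param_image[OF S] that by blast
    have field: "smooth_field_along A W x (Y \<circ> x)" if "vector_field_along X A g' Y" "g' = S" for Y g'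
      using that S xS by (auto simp: vector_field_along_def smooth_field_along_def)
    have unit: "riem_inner A g (x u) (Y (x u)) (Y (x u)) = 1" if "unit_vector_field_along X A g S Y" "u \<in> W" for Y u
      using that xS by (auto simp: unit_vector_field_along_def riem_norm_def)
    show ?thesis
    proof unfold_locales
      show "smooth_map X A W x" "\<And>u. u \<in> W \<Longrightarrow> inj (differential A x u)"
        using S by (auto simp: surface_param_def)
      show "smooth_field_along A W x (\<nu> \<circ> x)" "smooth_field_along A W x (V \<circ> x)"
        using field assms(3) V(1) by (auto simp: unit_normal_field_def unit_vector_field_along_def)
      show "riem_inner A g (x u) ((\<nu> \<circ> x) u) ((\<nu> \<circ> x) u) = 1" "riem_inner A g (x u) ((V \<circ> x) u) ((V \<circ> x) u) = 1"
        if "u \<in> W" for u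
        using unit[OF _ that] assms(3) V(1) by (auto simp: unit_normal_field_def)
      show "riem_inner A g (x u) ((\<nu> \<circ> x) u) (differential A x u a) = 0" if "u \<in> W" for u a
      proof -
        have "differential A x u a \<in> surface_tangent_space X A S (x u)"
          unfolding surface_tangent_space_def using S that by blast
        then show ?thesis using assms(3) xS[OF that] by (simp add: unit_normal_field_def)
      qed
      show "cov_deriv A g x (V \<circ> x) u a = (\<lambda>c. 0)" if "u \<in> W" for u a
        using V(2) S that unfolding parallel_along_def by blast
      show "riem_inner A g (x u) ((V \<circ> x) u) ((\<nu> \<circ> x) u) = cos \<theta>" if "u \<in> W" for u
        using cosine_of_riem_angle[OF S assms(3) V(1) \<theta> that] by simp
    qed
  qed
  have "extrinsically_flat X A g S \<nu>"
    unfolding extrinsically_flat_def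
    using constant_angle_patch.shape_operator_degenerate[OF patch _ refl] by blast
  moreover have "ruled_surface X A g S"
    unfolding ruled_surface_def
  proof
    fix p assume "p \<in> S"
    then obtain W x q where "surface_param X A S W x" "q \<in> W" "p = x q"
      using assms(2) by (auto simp: regular_surface_def)
    then show "\<exists>a b x. surface_param X A S (box a b) x \<and> p \<in> x ` box a b \<and>
        (\<forall>t\<in>{a$2<..<b$2}. geodesic_on X A g {a$1<..<b$1} (\<lambda>s. x (vector [s, t])))"
      using constant_angle_patch.ruled_parametrization[OF patch] by blast
  qed
  ultimately show ?thesis by blast
qed

end
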